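(* Let $\mathcal{G}=(\mathsf V,\mathsf E)$ be a finite, connected, compact metric graph without loops which is a line graph, i.e. $\deg(\mathsf v)\in\{1,2\}$ for all $\mathsf v\in\mathsf V$. Let $q\in L^\infty(\mathcal G)\cap\bigoplus_{\mathsf e\in\mathsf E}C^\infty(0,\ell_{\mathsf e})$ be real-valued and let $\sigma=(\sigma_{\mathsf v})_{\mathsf v\in\mathsf V}\in\mathbb R^{|\mathsf V|}$. Assume that the Schrödinger operator $H_{\mathcal G}^{q,\sigma}$ satisfies $$\lambda_n^{q,\sigma}=\lambda_n^0,\qquad n=0,1,\dots,$$ where $\lambda_n^0$ are the eigenvalues of $H_{\mathcal G}^0$. Then, if either $\mathcal G$ is a loop graph (i.e. $\deg(\mathsf v)=2$ for all $\mathsf v\in\mathsf V$) or $\sigma\ge 0$ (i.e. $\sigma_{\mathsf v}\ge 0$ for all $\mathsf v\in\mathsf V$), one has $q=0$ and $\sigma=0$.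
   Context: $\mathcal G=(\mathsf V,\mathsf E)$ is a finite, connected, compact metric graph with vertex set $\mathsf V$ and edge set $\mathsf E$; each edge $\mathsf e\in\mathsf E$ is identified with an interval of length $\ell_{\mathsf e}\in(0,\infty)$. The graph is assumed to have no loops (no edge joining a vertex to itself). $\deg(\mathsf v)$ is the degree of the vertex $\mathsf v$ (the number of edges incident to $\mathsf v$). A graph is called a line graph if $\deg(\mathsf v)\in\{1,2\}$ for all $\mathsf v\in\mathsf V$, and a line graph is called a loop graph if $\deg(\mathsf v)=2$ for all $\mathsf v\in\mathsf V$. The Hilbert space is $L^2(\mathcal G)=\bigoplus_{\mathsf e\in\mathsf E}L^2(0,\ell_{\mathsf e})$, and $\int_{\mathcal G}$ denotes the sum of the integrals over all edges. $C(\mathcal G)$ is the space of continuous functions on $\mathcal G$ (in particular continuous across vertices), and $H^1(\mathcal G):=\bigoplus_{\mathsf e\in\mathsf E}H^1(0,\ell_{\mathsf e})\cap C(\mathcal G)$. For real-valued $q=(q_{\mathsf e})_{\mathsf e\in\mathsf E}\in L^\infty(\mathcal G)\cap\bigoplus_{\mathsf e\in\mathsf E}C^\infty(0,\ell_{\mathsf e})$ and $\sigma=(\sigma_{\mathsf v})_{\mathsf v\in\mathsf V}\in\mathbb R^{|\mathsf V|}$, $H_{\mathcal G}^{q,\sigma}=-\frac{\mathrm d^2}{\mathrm dx^2}+q(x)$ is the self-adjoint operator on $L^2(\mathcal G)$ associated with the quadratic form $$h_{\mathcal G}^{q,\sigma}(f)=\int_{\mathcal G}|f'|^2\,\mathrm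 dx+\int_{\mathcal G}q|f|^2\,\mathrm dx+\sum_{\mathsf v\in\mathsf V}\sigma_{\mathsf v}|f(\mathsf v)|^2$$ with form domain $H^1(\mathcal G)$. It has compact resolvent, hence purely discrete spectrum, with eigenvalues (counted with multiplicity) $\lambda_0^{q,\sigma}<\lambda_1^{q,\sigma}\le\lambda_2^{q,\sigma}\le\dots\to+\infty$. $H_{\mathcal G}^0:=H_{\mathcal G}^{q=0,\sigma=0}$ denotes the operator with zero potential and $\sigma=0$, and $(\lambda_n^0)_{n\in\mathbb N_0}$ denotes its eigenvalues, ordered in the same way. *)

theory Defs
  imports
    "HOL-Analysis.Analysis"
    "HOL-Library.Function_Algebras"
    "Graph_Theory.Digraph_Component"
begin

text \<open>
  A metric graph is a multigraph together with edge lengths. The orientation of an arc only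
  records the identification of the edge with an interval: the point \<open>0\<close> is glued to the tail and
  the point \<open>len e\<close> to the head. Parallel edges are allowed.
\<close>

locale metric_graph = fin_digraph G + loopfree_digraph G
  for G :: "('v, 'e) pre_digraph" (structure) +
  fixes len :: "'e \<Rightarrow> real"
  assumes connected_graph: "Digraph_Component.connected G"
    and len_pos: "e \<in> arcs G \<Longrightarrow> 0 < len e"

definition deg :: "('v, 'e) pre_digraph \<Rightarrow> 'v \<Rightarrow> nat" where
  "deg G v = card (in_arcs G v \<union> out_arcs G v)"

definition line_graph :: "('v, 'e) pre_digraph \<Rightarrow> bool" where
  "line_graph G \<longleftrightarrow> (\<forall>v\<in>verts G. deg G v \<in> {1, 2})"

definition loop_graph :: "('v, 'e) pre_digraph \<Rightarrow> bool" where
  "loop_graph G \<longleftrightarrow> line_graph G \<and> (\<forall>v\<in>verts G. deg G v = 2)"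

text \<open>Functions on the graph are families of functions on the edges, a complex vector space.\<close>

type_synonym 'e graph_fun = "'e \<Rightarrow> real \<Rightarrow> complex"

definition gscale :: "complex \<Rightarrow> 'e graph_fun \<Rightarrow> 'e graph_fun" where
  "gscale c f = (\<lambda>e x. c * f e x)"

interpretation gfun: vector_space gscale
  by unfold_locales (auto simp: gscale_def fun_eq_iff algebra_simps)

abbreviation edge_measure :: "real \<Rightarrow> real measure" where
  "edge_measure l \<equiv> lebesgue_on {0<..<l}"

definition L2 :: "real \<Rightarrow> (real \<Rightarrow> complex) set" where
  "L2 l = {u. u \<in> borel_measurable (edge_measure l) \<and>
              integrable (edge_measure l) (\<lambda>x. (cmod (u x))\<^sup>2)}"

definition Linfty :: "real \<Rightarrow> (real \<Rightarrow> real) set" where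
  "Linfty l = {u. u \<in> borel_measurable (edge_measure l) \<and>
                  (\<exists>C. AE x in edge_measure l. \<bar>u x\<bar> \<le> C)}"

definition Cinfty :: "real \<Rightarrow> (real \<Rightarrow> real) set" where
  "Cinfty l = {u. \<forall>k. \<forall>x\<in>{0<..<l}. (deriv ^^ k) u differentiable (at x)}"

text \<open>Test functions of class \<open>C\<^sup>1\<close> yield the same weak derivatives as smooth ones.\<close>

definition test_fun :: "real \<Rightarrow> (real \<Rightarrow> real) \<Rightarrow> bool" where
  "test_fun l \<phi> \<longleftrightarrow> \<phi> C1_differentiable_on UNIV \<and> closure {x. \<phi> x \<noteq> 0} \<subseteq> {0<..<l}"

definition is_weak_deriv :: "real \<Rightarrow> (real \<Rightarrow> complex) \<Rightarrow> (real \<Rightarrow> complex) \<Rightarrow> bool" where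
  "is_weak_deriv l u g \<longleftrightarrow>
     (\<forall>\<phi>. test_fun l \<phi> \<longrightarrow>
        (LINT x|edge_measure l. u x * complex_of_real (deriv \<phi> x)) =
        - (LINT x|edge_measure l. g x * complex_of_real (\<phi> x)))"

text \<open>The Sobolev space of order one on an interval; a weak derivative is unique up to null sets.\<close>

definition H1_interval :: "real \<Rightarrow> (real \<Rightarrow> complex) set" where
  "H1_interval l = {u \<in> L2 l. \<exists>g\<in>L2 l. is_weak_deriv l u g}"

definition weak_deriv :: "real \<Rightarrow> (real \<Rightarrow> complex) \<Rightarrow> real \<Rightarrow> complex" where
  "weak_deriv l u = (SOME g. g \<in> L2 l \<and> is_weak_deriv l u g)"

definition L2_graph :: "('v, 'e) pre_digraph \<Rightarrow> ('e \<Rightarrow> real) \<Rightarrow> 'e graph_fun set" where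
  "L2_graph G len = {f. \<forall>e\<in>arcs G. f e \<in> L2 (len e)}"

definition L2_inner ::
  "('v, 'e) pre_digraph \<Rightarrow> ('e \<Rightarrow> real) \<Rightarrow> 'e graph_fun \<Rightarrow> 'e graph_fun \<Rightarrow> complex" where
  "L2_inner G len f g = (\<Sum>e\<in>arcs G. LINT x|edge_measure (len e). f e x * cnj (g e x))"

text \<open>
  Continuous functions are extended by zero off the closed edges, so that every function on the
  graph has exactly one representative.
\<close>

definition C_graph :: "('v, 'e) pre_digraph \<Rightarrow> ('e \<Rightarrow> real) \<Rightarrow> 'e graph_fun set" where
  "C_graph G len = {f.
     (\<forall>e\<in>arcs G. continuous_on {0..len e} (f e)) \<and>
     (\<exists>F. \<forall>e\<in>arcs G. f e 0 = F (tail G e) \<and> f e (len e) = F (head G e)) \<and>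
     (\<forall>e x. e \<notin> arcs G \<or> x \<notin> {0..len e} \<longrightarrow> f e x = 0)}"

text \<open>The value of a continuous function at a vertex of positive degree.\<close>

definition vertex_value ::
  "('v, 'e) pre_digraph \<Rightarrow> ('e \<Rightarrow> real) \<Rightarrow> 'e graph_fun \<Rightarrow> 'v \<Rightarrow> complex" where
  "vertex_value G len f v =
     (THE c. \<forall>e\<in>arcs G. (tail G e = v \<longrightarrow> f e 0 = c) \<and> (head G e = v \<longrightarrow> f e (len e) = c))"

definition H1_graph :: "('v, 'e) pre_digraph \<Rightarrow> ('e \<Rightarrow> real) \<Rightarrow> 'e graph_fun set" where
  "H1_graph G len = {f \<in> C_graph G len. \<forall>e\<in>arcs G. f e \<in> H1_interval (len e)}"

definition potential ::
  "('v, 'e) pre_digraph \<Rightarrow> ('e \<Rightarrow> real) \<Rightarrow> ('e \<Rightarrow> real \<Rightarrow> real) \<Rightarrow> bool" where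
  "potential G len q \<longleftrightarrow> (\<forall>e\<in>arcs G. q e \<in> Linfty (len e) \<inter> Cinfty (len e))"

text \<open>The sesquilinear form whose diagonal is the quadratic form of the operator.\<close>

definition schroedinger_form ::
  "('v, 'e) pre_digraph \<Rightarrow> ('e \<Rightarrow> real) \<Rightarrow> ('e \<Rightarrow> real \<Rightarrow> real) \<Rightarrow> ('v \<Rightarrow> real) \<Rightarrow>
   'e graph_fun \<Rightarrow> 'e graph_fun \<Rightarrow> complex" where
  "schroedinger_form G len q \<sigma> f g =
     (\<Sum>e\<in>arcs G. LINT x|edge_measure (len e).
        weak_deriv (len e) (f e) x * cnj (weak_deriv (len e) (g e) x)) +
     (\<Sum>e\<in>arcs G. LINT x|edge_measure (len e).
        complex_of_real (q e x) * f e x * cnj (g e x)) +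
     (\<Sum>v\<in>verts G. complex_of_real (\<sigma> v) * vertex_value G len f v * cnj (vertex_value G len g v))"

text \<open>
  The graph of the operator associated with the form by the first representation theorem:
  \<open>f\<close> is in the domain and is mapped to \<open>g\<close>, which is determined up to null sets.
\<close>

definition schroedinger_op ::
  "('v, 'e) pre_digraph \<Rightarrow> ('e \<Rightarrow> real) \<Rightarrow> ('e \<Rightarrow> real \<Rightarrow> real) \<Rightarrow> ('v \<Rightarrow> real) \<Rightarrow>
   ('e graph_fun \<times> 'e graph_fun) set" where
  "schroedinger_op G len q \<sigma> = {(f, g). f \<in> H1_graph G len \<and> g \<in> L2_graph G len \<and>
     (\<forall>\<phi>\<in>H1_graph G len. schroedinger_form G len q \<sigma> f \<phi> = L2_inner G len g \<phi>)}"

definition eigenspace ::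
  "('v, 'e) pre_digraph \<Rightarrow> ('e \<Rightarrow> real) \<Rightarrow> ('e \<Rightarrow> real \<Rightarrow> real) \<Rightarrow> ('v \<Rightarrow> real) \<Rightarrow>
   real \<Rightarrow> 'e graph_fun set" where
  "eigenspace G len q \<sigma> \<mu> = {f. (f, gscale (complex_of_real \<mu>) f) \<in> schroedinger_op G len q \<sigma>}"

text \<open>
  The sequence \<open>lam\<close> lists all eigenvalues in increasing order with multiplicity: every real \<open>\<mu>\<close>
  occurs exactly as often as the dimension of its eigenspace (zero times if \<open>\<mu>\<close> is no eigenvalue).
\<close>

definition eigenvalue_sequence ::
  "('v, 'e) pre_digraph \<Rightarrow> ('e \<Rightarrow> real) \<Rightarrow> ('e \<Rightarrow> real \<Rightarrow> real) \<Rightarrow> ('v \<Rightarrow> real) \<Rightarrow>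
   (nat \<Rightarrow> real) \<Rightarrow> bool" where
  "eigenvalue_sequence G len q \<sigma> lam \<longleftrightarrow> mono lam \<and>
     (\<forall>\<mu>. finite {n. lam n = \<mu>} \<and>
        (\<exists>B. finite B \<and> gfun.independent B \<and> gfun.span B = eigenspace G len q \<sigma> \<mu> \<and>
             card B = card {n. lam n = \<mu>}))"

end

theory Submission
  imports Defs "HOL-Complex_Analysis.Great_Picard"
begin

text \<open>
  A line graph is laid out along an interval or a circle of length \<open>L\<close>. If \<open>f\<close> and \<open>w\<close> are
  eigenfunctions of the perturbed and of the free operator for the same eigenvalue \<open>k\<^sup>2\<close>, then
  subtracting the two weak equations gives \<open>\<integral> q f w + \<Sum> \<sigma> f w = 0\<close> exactly. For large \<open>k\<close> a Volterra
  argument shows that \<open>f\<close> is a multiple of some such \<open>w\<close> up to \<open>O(1/k)\<close>, where \<open>w\<close> is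
  \<open>cos (k x)\<close> on the interval and \<open>exp (i k x)\<close> on the circle (there the eigenspaces are two-dimensional).
  Letting \<open>k\<close> tend to infinity, after averaging over \<open>k = n \<pi> / L\<close> for the interval, gives
  \<open>\<integral> q + \<Sum> \<sigma> = 0\<close> on the circle and \<open>\<integral> q + \<Sum> \<sigma> + \<sigma>(0) + \<sigma>(L) = 0\<close> on the interval. In both cases
  the form is \<open>\<le> 0\<close> at the constant function \<open>1\<close>. On the other hand the free operator has no negative
  eigenvalue, so the perturbed form, whose minimum over the unit sphere is an eigenvalue, is
  nonnegative. Hence \<open>1\<close> lies in its kernel, which forces \<open>q = 0\<close> and \<open>\<sigma> = 0\<close>.
\<close>

section \<open>Functions on an edge\<close>

text \<open>Isospectrality enters only through eigenspaces: at each free eigenvalue k^2 both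
  operators have eigenspaces of equal dimension, so eigenvalues need not be numbered. Eigenfunctions
  are only H^1 solutions of a weak equation; instead of solving an ODE, they are tested with
  trigonometric functions cut off at a point. This requires integration by parts with boundary
  terms, which is derived from compactly supported test functions. The Volterra error is relative to
  the sup norm of f. For k large against the perturbation it is at most half of that norm, so the
  multiple of w cannot vanish. On the interval |w|^2 = (1 + cos (2 k x)) / 2, and cos (2 k x) need
  not tend to zero at inner vertices. Its mean over n does, but at 0 and L it equals one; these two
  points produce the extra \<sigma>(0) + \<sigma>(L), and hence the sign assumption. One linear
  condition, f(z) = i f(0) with k z = pi / 2, achieves this, and a space of dimension two contains a
  nonzero solution.\<close>

lemma finite_edge_measure: "finite_measure (edge_measure l)"
  by (simp add: finite_measure_lebesgue_on)

lemma edge_measurable_continuous: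
  fixes u :: "real \<Rightarrow> 'a::{second_countable_topology, real_normed_vector}"
  assumes "continuous_on {0..l} u"
  shows "u \<in> borel_measurable (edge_measure l)"
  by (rule continuous_imp_measurable_on_sets_lebesgue) (auto intro: continuous_on_subset[OF assms])

lemma edge_AE_bounded_integrable:
  fixes u :: "real \<Rightarrow> 'a::{second_countable_topology, banach}"
  assumes "u \<in> borel_measurable (edge_measure l)" "AE x in edge_measure l. norm (u x) \<le> C"
  shows "integrable (edge_measure l) u"
proof -
  interpret finite_measure "edge_measure l" by (rule finite_edge_measure)
  show ?thesis using assms by (intro integrable_const_bound[of _ C])
qed

lemma edge_bounded_integrable:
  fixes u :: "real \<Rightarrow> 'a::{second_countable_topology, banach}"
  assumes "u \<in> borel_measurable (edge_measure l)" "\<And>x. x \<in> {0<..<l} \<Longrightarrow> norm (u x) \<le> C"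
  shows "integrable (edge_measure l) u"
  by (rule edge_AE_bounded_integrable[OF assms(1), of C]) (rule AE_I2, use assms(2) in simp)

lemma edge_continuous_integrable:
  fixes u :: "real \<Rightarrow> 'a::{second_countable_topology, banach}"
  assumes "continuous_on {0..l} u"
  shows "integrable (edge_measure l) u"
proof -
  have "bounded (u ` {0..l})"
    by (intro compact_imp_bounded compact_continuous_image assms) simp
  then obtain C where "\<forall>x\<in>{0..l}. norm (u x) \<le> C"
    by (auto simp: bounded_iff)
  then show ?thesis
    by (intro edge_bounded_integrable[of _ _ C] edge_measurable_continuous assms) auto
qed

lemma L2_measurable: "u \<in> L2 l \<Longrightarrow> u \<in> borel_measurable (edge_measure l)"
  by (simp add: L2_def)

lemma L2_square_integrable: "u \<in> L2 l \<Longrightarrow> integrable (edge_measure l) (\<lambda>x. (cmod (u x))\<^sup>2)"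
  by (simp add: L2_def)

lemma L2_mult_integrable:
  assumes "u \<in> L2 l" "v \<in> L2 l"
  shows "integrable (edge_measure l) (\<lambda>x. u x * v x)"
proof (rule Bochner_Integration.integrable_bound)
  show "integrable (edge_measure l) (\<lambda>x. (cmod (u x))\<^sup>2 + (cmod (v x))\<^sup>2)"
    using assms by (simp add: L2_def)
  show "(\<lambda>x. u x * v x) \<in> borel_measurable (edge_measure l)"
    using assms[THEN L2_measurable] by measurable
  have "cmod a * cmod b \<le> (cmod a)\<^sup>2 + (cmod b)\<^sup>2" for a b
    using sum_squares_bound[of "cmod a" "cmod b"] mult_nonneg_nonneg[OF norm_ge_zero[of a] norm_ge_zero[of b]]
    by linarith
  then show "AE x in edge_measure l. norm (u x * v x) \<le> norm ((cmod (u x))\<^sup>2 + (cmod (v x))\<^sup>2)"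
    by (simp add: norm_mult)
qed

lemma L2_bounded:
  assumes "u \<in> borel_measurable (edge_measure l)" "AE x in edge_measure l. cmod (u x) \<le> C"
  shows "u \<in> L2 l"
proof -
  have "integrable (edge_measure l) (\<lambda>x. (cmod (u x))\<^sup>2)"
  proof (rule edge_AE_bounded_integrable[where C="C\<^sup>2"])
    show "(\<lambda>x. (cmod (u x))\<^sup>2) \<in> borel_measurable (edge_measure l)"
      using assms(1) by measurable
    show "AE x in edge_measure l. norm ((cmod (u x))\<^sup>2) \<le> C\<^sup>2"
      using assms(2) by eventually_elim (simp add: power_mono)
  qed
  then show ?thesis using assms(1) by (simp add: L2_def)
qed

lemma L2_continuous:
  assumes "continuous_on {0..l} u" shows "u \<in> L2 l"
proof -
  have "continuous_on {0..l} (\<lambda>x. (cmod (u x))\<^sup>2)"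
    by (intro continuous_intros assms)
  then show ?thesis
    by (simp add: L2_def edge_measurable_continuous edge_continuous_integrable assms)
qed

lemma L2_integrable: "u \<in> L2 l \<Longrightarrow> integrable (edge_measure l) u"
  using L2_mult_integrable[of u l "\<lambda>x. 1"] L2_continuous[of l "\<lambda>x. 1"] by simp

lemma L2_add:
  assumes "u \<in> L2 l" "v \<in> L2 l"
  shows "(\<lambda>x. u x + v x) \<in> L2 l"
proof -
  have "integrable (edge_measure l) (\<lambda>x. (cmod (u x + v x))\<^sup>2)"
  proof (rule Bochner_Integration.integrable_bound)
    show "integrable (edge_measure l) (\<lambda>x. 2 * (cmod (u x))\<^sup>2 + 2 * (cmod (v x))\<^sup>2)"
      using assms by (simp add: L2_def)
    show "(\<lambda>x. (cmod (u x + v x))\<^sup>2) \<in> borel_measurable (edge_measure l)"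
      using assms[THEN L2_measurable] by measurable
    have "(cmod (a + b))\<^sup>2 \<le> 2 * (cmod a)\<^sup>2 + 2 * (cmod b)\<^sup>2" for a b
    proof -
      have "(cmod (a + b))\<^sup>2 \<le> (cmod a + cmod b)\<^sup>2"
        by (intro power_mono norm_triangle_ineq) simp
      then show ?thesis
        using sum_squares_bound[of "cmod a" "cmod b"] by (simp add: power2_sum)
    qed
    then show "AE x in edge_measure l. norm ((cmod (u x + v x))\<^sup>2)
        \<le> norm (2 * (cmod (u x))\<^sup>2 + 2 * (cmod (v x))\<^sup>2)"
      by simp
  qed
  then show ?thesis
    using assms[THEN L2_measurable] by (simp add: L2_def)
qed

lemma L2_scale: "u \<in> L2 l \<Longrightarrow> (\<lambda>x. c * u x) \<in> L2 l"
  by (auto simp: L2_def norm_mult power_mult_distrib)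

lemma L2_diff:
  assumes "u \<in> L2 l" "v \<in> L2 l"
  shows "(\<lambda>x. u x - v x) \<in> L2 l"
  using L2_add[OF assms(1) L2_scale[OF assms(2), of "- 1"]] by simp

lemma L2_bounded_mult:
  assumes "u \<in> L2 l" "c \<in> borel_measurable (edge_measure l)" "AE x in edge_measure l. cmod (c x) \<le> C"
  shows "(\<lambda>x. c x * u x) \<in> L2 l"
proof -
  have "integrable (edge_measure l) (\<lambda>x. (cmod (c x * u x))\<^sup>2)"
  proof (rule Bochner_Integration.integrable_bound)
    show "integrable (edge_measure l) (\<lambda>x. C\<^sup>2 * (cmod (u x))\<^sup>2)"
      using assms by (simp add: L2_def)
    show "(\<lambda>x. (cmod (c x * u x))\<^sup>2) \<in> borel_measurable (edge_measure l)"
      using assms(1)[THEN L2_measurable] assms(2) by measurable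
    show "AE x in edge_measure l. norm ((cmod (c x * u x))\<^sup>2) \<le> norm (C\<^sup>2 * (cmod (u x))\<^sup>2)"
      using assms(3) by eventually_elim (simp add: norm_mult power_mult_distrib power_mono mult_right_mono)
  qed
  then show ?thesis
    using assms(1)[THEN L2_measurable] assms(2) by (simp add: L2_def)
qed

lemma indicator_edge_measurable:
  "(indicator {a<..<b} :: real \<Rightarrow> 'a::real_normed_algebra_1) \<in> borel_measurable (edge_measure l)"
  by (rule measurable_restrict_space1) (intro borel_measurable_indicator, simp)

section \<open>Cutoff functions and integration by parts\<close>

text \<open>Transition p(t) / (p(t) + p(1 - t)) with p(t) the square of the positive part. Class C^1
  is all that \<open>test_fun\<close> asks for, so a square suffices in place of the usual
  exponential.\<close>

definition smooth_step :: "real \<Rightarrow> real" where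
  "smooth_step t = (max 0 t)\<^sup>2 / ((max 0 t)\<^sup>2 + (max 0 (1 - t))\<^sup>2)"

definition smooth_step' :: "real \<Rightarrow> real" where
  "smooth_step' t = (2 * max 0 t * (max 0 (1 - t))\<^sup>2 + (max 0 t)\<^sup>2 * (2 * max 0 (1 - t)))
     / ((max 0 t)\<^sup>2 + (max 0 (1 - t))\<^sup>2)\<^sup>2"

lemma smooth_step_denominator: "(max 0 t)\<^sup>2 + (max 0 (1 - t))\<^sup>2 \<noteq> (0::real)"
  by (auto simp: max_def sum_power2_eq_zero_iff)

lemma max_0_square_DERIV: "((\<lambda>t. (max 0 t)\<^sup>2) has_real_derivative 2 * max 0 t) (at t)"
proof -
  consider "t < 0" | "t = 0" | "t > 0" by linarith
  then show ?thesis
  proof cases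
    case 1
    have "((\<lambda>t. 0) has_real_derivative 0) (at t)" by simp
    then have "((\<lambda>t. (max 0 t)\<^sup>2) has_real_derivative 0) (at t)"
      by (rule has_field_derivative_transform_within_open[of _ _ _ "{..<0}"]) (use 1 in auto)
    then show ?thesis using 1 by simp
  next
    case 2
    have "((\<lambda>h. (max 0 h)\<^sup>2 / h) \<longlongrightarrow> 0) (at (0::real))"
    proof (rule tendsto_0_le[where K=1 and f="\<lambda>h. h"])
      show "((\<lambda>h. h) \<longlongrightarrow> 0) (at (0::real))" by (rule tendsto_ident_at)
      show "\<forall>\<^sub>F h in at (0::real). norm ((max 0 h)\<^sup>2 / h) \<le> norm h * 1"
        by (rule eventuallyI) (auto simp: max_def power2_eq_square)
    qed
    then show ?thesis using 2 by (simp add: DERIV_def)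
  next
    case 3
    have "((\<lambda>t. t\<^sup>2) has_real_derivative 2 * t) (at t)" 
      by (auto intro!: derivative_eq_intros)
    then have "((\<lambda>t. (max 0 t)\<^sup>2) has_real_derivative 2 * t) (at t)"
      by (rule has_field_derivative_transform_within_open[of _ _ _ "{0<..}"]) (use 3 in auto)
    then show ?thesis using 3 by simp
  qed
qed

lemma smooth_step_DERIV: "(smooth_step has_real_derivative smooth_step' t) (at t)"
proof -
  have *: "((\<lambda>t. (max 0 (1 - t))\<^sup>2) has_real_derivative 2 * max 0 (1 - t) * (-1)) (at t)"
    by (rule DERIV_chain'[where f="\<lambda>t. 1 - t" and g="\<lambda>t. (max 0 t)\<^sup>2", OF _ max_0_square_DERIV])
       (auto intro!: derivative_eq_intros)
  show ?thesis
    unfolding smooth_step_def[abs_def] smooth_step'_def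
    by (rule DERIV_cong[OF DERIV_divide[OF max_0_square_DERIV DERIV_add[OF max_0_square_DERIV *]
          smooth_step_denominator]])
       (simp add: field_simps power2_eq_square)
qed

lemma smooth_step'_continuous: "continuous_on A smooth_step'"
  unfolding smooth_step'_def[abs_def]
  by (intro continuous_intros) (use smooth_step_denominator in auto)

lemma smooth_step'_nonneg: "0 \<le> smooth_step' t"
  unfolding smooth_step'_def by (intro divide_nonneg_nonneg add_nonneg_nonneg mult_nonneg_nonneg) auto

lemma smooth_step_0: "t \<le> 0 \<Longrightarrow> smooth_step t = 0"
  by (simp add: smooth_step_def)

lemma smooth_step_1: "1 \<le> t \<Longrightarrow> smooth_step t = 1"
  by (simp add: smooth_step_def)

lemma smooth_step'_0: "t \<le> 0 \<or> 1 \<le> t \<Longrightarrow> smooth_step' t = 0"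
  by (auto simp: smooth_step'_def)

lemma smooth_step_bounds: "smooth_step t \<le> 1" "0 \<le> smooth_step t"
proof -
  have "0 < (max 0 t)\<^sup>2 + (max 0 (1 - t))\<^sup>2"
    using smooth_step_denominator[of t] by (simp only: sum_power2_gt_zero_iff sum_power2_eq_zero_iff de_Morgan_conj)
  then show "smooth_step t \<le> 1" "0 \<le> smooth_step t"
    by (simp_all add: smooth_step_def divide_le_eq_1)
qed

text \<open>The indicator keeps the measure that of the whole edge, so that integrals over different
  subintervals live on one measure space.\<close>

lemma edge_FTC:
  fixes F f :: "real \<Rightarrow> 'a::euclidean_space"
  assumes "0 \<le> a" "a \<le> b" "b \<le> l"
    and "\<And>x. x \<in> {a..b} \<Longrightarrow> (F has_vector_derivative f x) (at x)" "continuous_on {a..b} f"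
  shows "(LINT x|edge_measure l. indicator {a<..<b} x *\<^sub>R f x) = F b - F a"
proof -
  have "(LINT x|edge_measure l. indicator {a<..<b} x *\<^sub>R f x) =
      (LINT x|lebesgue. indicator {0<..<l} x *\<^sub>R indicator {a<..<b} x *\<^sub>R f x)"
    by (subst integral_restrict_space) auto
  also have "\<dots> = (LINT x|lebesgue. indicator {a<..<b} x *\<^sub>R f x)"
    by (rule Bochner_Integration.integral_cong) (use assms(1-3) in \<open>auto simp: indicator_def\<close>)
  also have "\<dots> = set_lebesgue_integral lebesgue {a<..<b} f"
    by (simp add: set_lebesgue_integral_def)
  also have "\<dots> = integral {a<..<b} f"
  proof (rule set_lebesgue_integral_eq_integral)
    have "f absolutely_integrable_on {a..b}"
      using absolutely_integrable_continuous_real[OF assms(5)] .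
    then show "f absolutely_integrable_on {a<..<b}"
      by (rule set_integrable_subset) auto
  qed
  also have "\<dots> = integral {a..b} f"
    by (rule integral_open_interval_real[symmetric])
  also have "\<dots> = F b - F a"
    by (intro integral_unique fundamental_theorem_of_calculus assms(2))
       (use assms(4) has_vector_derivative_at_within in blast)
  finally show ?thesis .
qed

text \<open>Each \<open>w n\<close> is a probability density concentrated within
  \<open>\<delta> n\<close> of \<open>a\<close>, so the error is an average of F x - F a over points
  near \<open>a\<close>. The point \<open>a\<close> may be an end of the edge.\<close>

lemma approximate_identity_tendsto:
  fixes F :: "real \<Rightarrow> complex"
  assumes F: "continuous_on {0..l} F" and a: "a \<in> {0..l}"
    and w: "\<And>n. integrable (edge_measure l) (w n)" "\<And>n x. 0 \<le> w n x"
      "\<And>n. (LINT x|edge_measure l. w n x) = 1"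
    and supp: "\<And>n x. x \<in> {0<..<l} \<Longrightarrow> w n x \<noteq> 0 \<Longrightarrow> \<bar>x - a\<bar> \<le> \<delta> n" and \<delta>: "\<delta> \<longlonglongrightarrow> 0"
  shows "(\<lambda>n. LINT x|edge_measure l. F x * complex_of_real (w n x)) \<longlonglongrightarrow> F a"
proof (rule LIMSEQ_I)
  fix r :: real assume r: "r > 0"
  from F a r obtain d where d: "d > 0" "\<And>x. x \<in> {0..l} \<Longrightarrow> dist x a < d \<Longrightarrow> dist (F x) (F a) < r/2"
    unfolding continuous_on_iff by (metis half_gt_zero)
  from LIMSEQ_D[OF \<delta> d(1)] obtain N where N: "\<And>n. n \<ge> N \<Longrightarrow> \<bar>\<delta> n\<bar> < d" by auto
  obtain C where C: "\<And>x. x \<in> {0..l} \<Longrightarrow> cmod (F x) \<le> C"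
    using compact_imp_bounded[OF compact_continuous_image[OF F]] by (fastforce simp: bounded_iff)
  have int: "integrable (edge_measure l) (\<lambda>x. F x * complex_of_real (w n x))" for n
  proof (rule Bochner_Integration.integrable_bound)
    show "integrable (edge_measure l) (\<lambda>x. C * w n x)" using w(1) by simp
    show "(\<lambda>x. F x * complex_of_real (w n x)) \<in> borel_measurable (edge_measure l)"
      using edge_measurable_continuous[OF F] borel_measurable_integrable[OF w(1)] by measurable
    show "AE x in edge_measure l. norm (F x * complex_of_real (w n x)) \<le> norm (C * w n x)"
      by (rule AE_I2) (use C w(2) in \<open>auto simp: norm_mult abs_mult intro!: mult_right_mono order_trans[OF _ abs_ge_self]\<close>)
  qed
  have "norm ((LINT x|edge_measure l. F x * complex_of_real (w n x)) - F a) < r" if n: "n \<ge> N" for n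
  proof -
    have "(LINT x|edge_measure l. F x * complex_of_real (w n x)) - F a =
      (LINT x|edge_measure l. F x * complex_of_real (w n x)) - (LINT x|edge_measure l. F a * complex_of_real (w n x))"
      using w(3) by simp
    also have "\<dots> = (LINT x|edge_measure l. (F x - F a) * complex_of_real (w n x))"
      by (subst Bochner_Integration.integral_diff[symmetric])
         (use int w(1) in \<open>auto simp: algebra_simps integrable_of_real\<close>)
    also have "norm \<dots> \<le> (LINT x|edge_measure l. r/2 * w n x)"
    proof (rule Bochner_Integration.integral_norm_bound_integral)
      show "integrable (edge_measure l) (\<lambda>x. (F x - F a) * complex_of_real (w n x))"
        using Bochner_Integration.integrable_diff[OF int[of n], of "\<lambda>x. F a * complex_of_real (w n x)"] w(1)
        by (simp add: algebra_simps integrable_of_real)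
      show "integrable (edge_measure l) (\<lambda>x. r/2 * w n x)" using w(1) by simp
      fix x assume "x \<in> space (edge_measure l)"
      then have x: "x \<in> {0<..<l}" by simp
      show "norm ((F x - F a) * complex_of_real (w n x)) \<le> r/2 * w n x"
      proof (cases "w n x = 0")
        case False
        then have "dist x a < d" using supp[OF x False] N[OF n] by (simp add: dist_real_def)
        then have "norm (F x - F a) \<le> r/2" using d(2)[of x] x by (simp add: dist_norm less_imp_le)
        from mult_right_mono[OF this w(2)[of n x]] show ?thesis using w(2)[of n x] by (simp add: norm_mult)
      qed simp
    qed
    also have "\<dots> = r/2" using w(3) by simp
    finally show ?thesis using r by simp
  qed
  then show "\<exists>no. \<forall>n\<ge>no. norm ((LINT x|edge_measure l. F x * complex_of_real (w n x)) - F a) < r"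
    by blast
qed

text \<open>The weak derivative is defined by functions supported inside the open edge, so boundary
  terms have to be created: \<psi> is multiplied by cutoffs that increase to the indicator of (a,
  b), and their derivatives act as approximate point masses at \<open>a\<close> and
  \<open>b\<close>.\<close>

lemma weak_deriv_integration_by_parts:
  fixes u g :: "real \<Rightarrow> complex" and \<psi> \<psi>' :: "real \<Rightarrow> real"
  assumes u: "continuous_on {0..l} u" and g: "g \<in> L2 l" and weak: "is_weak_deriv l u g"
    and ab: "0 \<le> a" "a \<le> b" "b \<le> l"
    and \<psi>: "\<And>x. (\<psi> has_real_derivative \<psi>' x) (at x)" and \<psi>': "continuous_on UNIV \<psi>'"
  shows "(LINT x|edge_measure l. indicator {a<..<b} x * (g x * complex_of_real (\<psi> x) + u x * complex_of_real (\<psi>' x)))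
    = u b * complex_of_real (\<psi> b) - u a * complex_of_real (\<psi> a)"
proof (cases "a = b")
  case False
  with ab have "a < b" by simp
  have \<psi>_cont: "continuous_on S \<psi>" for S
    using \<psi> by (meson DERIV_isCont continuous_at_imp_continuous_on)
  \<comment> \<open>The cutoffs rise on [a + \<epsilon>, a + 2 \<epsilon>] and fall on
    [b - 2 \<epsilon>, b - \<epsilon>]; the factor 4 keeps these intervals from overlapping.\<close>
  define \<epsilon> where "\<epsilon> n = (b - a) / (4 * real (Suc n))" for n
  have \<epsilon>: "\<epsilon> n > 0" "4 * \<epsilon> n \<le> b - a" for n
  proof -
    show "\<epsilon> n > 0" using \<open>a < b\<close> by (simp add: \<epsilon>_def)
    have "(b - a) * 1 \<le> (b - a) * real (Suc n)" using \<open>a < b\<close> by (intro mult_left_mono) auto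
    then show "4 * \<epsilon> n \<le> b - a"
      unfolding \<epsilon>_def by (simp add: field_simps)
  qed
  have \<epsilon>_lim: "\<epsilon> \<longlonglongrightarrow> 0"
  proof -
    have "(\<lambda>n. ((b - a) / 4) * inverse (real (Suc n))) \<longlonglongrightarrow> ((b - a) / 4) * 0"
      by (rule tendsto_mult[OF tendsto_const LIMSEQ_inverse_real_of_nat])
    moreover have "\<epsilon> = (\<lambda>n. ((b - a) / 4) * inverse (real (Suc n)))"
      by (rule ext) (simp add: \<epsilon>_def field_simps)
    ultimately show ?thesis by simp
  qed
  define A where "A n x = smooth_step ((x - a) / \<epsilon> n - 1)" for n x
  define B where "B n x = smooth_step ((b - x) / \<epsilon> n - 1)" for n x
  define A' where "A' n x = smooth_step' ((x - a) / \<epsilon> n - 1) / \<epsilon> n" for n x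
  define B' where "B' n x = smooth_step' ((b - x) / \<epsilon> n - 1) / \<epsilon> n" for n x
  \<comment> \<open>At every point one of \<open>A n\<close>, \<open>B n\<close> equals 1, so this
    is their product, written as a sum so that its derivative is simply
    \<open>A' n - B' n\<close>.\<close>
  define \<eta> where "\<eta> n x = A n x + B n x - 1" for n x
  have aff1: "((\<lambda>x. (x - a) / \<epsilon> n - 1) has_real_derivative 1 / \<epsilon> n) (at x)" for n x
    using \<epsilon>(1)[of n] by (auto intro!: derivative_eq_intros)
  have aff2: "((\<lambda>x. (b - x) / \<epsilon> n - 1) has_real_derivative - 1 / \<epsilon> n) (at x)" for n x
    using \<epsilon>(1)[of n] by (auto intro!: derivative_eq_intros)
  have A_deriv: "(A n has_real_derivative A' n x) (at x)" for n x
    using DERIV_chain'[OF aff1 smooth_step_DERIV, of n x] unfolding A_def[abs_def] A'_def by simp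
  have B_deriv: "(B n has_real_derivative - B' n x) (at x)" for n x
    using DERIV_chain'[OF aff2 smooth_step_DERIV, of n x] unfolding B_def[abs_def] B'_def by simp
  have aff_cont: "continuous_on S (\<lambda>x. (x - a) / \<epsilon> n - 1)" "continuous_on S (\<lambda>x. (b - x) / \<epsilon> n - 1)" for S n
    using \<epsilon>(1)[of n] by (auto intro!: continuous_intros)
  have A'_cont: "continuous_on S (A' n)" and B'_cont: "continuous_on S (B' n)" for S n
    using continuous_on_compose2[OF smooth_step'_continuous[of UNIV] aff_cont(1)[of S n]]
      continuous_on_compose2[OF smooth_step'_continuous[of UNIV] aff_cont(2)[of S n]] \<epsilon>(1)[of n]
    unfolding A'_def[abs_def] B'_def[abs_def] by (auto intro!: continuous_on_divide)
  have \<eta>_0: "\<eta> n x = 0" if "x \<le> a + \<epsilon> n \<or> b - \<epsilon> n \<le> x" for n x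
    using that
  proof
    assume "x \<le> a + \<epsilon> n"
    then have "(x - a) / \<epsilon> n - 1 \<le> 0" "1 \<le> (b - x) / \<epsilon> n - 1"
      using \<epsilon>[of n] by (simp_all add: field_simps)
    then show ?thesis by (simp add: \<eta>_def A_def B_def smooth_step_0 smooth_step_1)
  next
    assume "b - \<epsilon> n \<le> x"
    then have "(b - x) / \<epsilon> n - 1 \<le> 0" "1 \<le> (x - a) / \<epsilon> n - 1"
      using \<epsilon>[of n] by (simp_all add: field_simps)
    then show ?thesis by (simp add: \<eta>_def A_def B_def smooth_step_0 smooth_step_1)
  qed
  have \<eta>_1: "\<bar>\<eta> n x\<bar> \<le> 1" for n x
    using smooth_step_bounds[of "(x - a) / \<epsilon> n - 1"] smooth_step_bounds[of "(b - x) / \<epsilon> n - 1"]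
    by (simp add: \<eta>_def A_def B_def)
  have \<eta>_lim: "(\<lambda>n. \<eta> n x) \<longlonglongrightarrow> indicator {a<..<b} x" for x
  proof (cases "x \<in> {a<..<b}")
    case True
    then have "min (x - a) (b - x) / 2 > 0" by simp
    from order_tendstoD(2)[OF \<epsilon>_lim this] have "\<forall>\<^sub>F n in sequentially. \<eta> n x = 1"
    proof eventually_elim
      case (elim n)
      then have "1 \<le> (x - a) / \<epsilon> n - 1" "1 \<le> (b - x) / \<epsilon> n - 1"
        using \<epsilon>[of n] by (simp_all add: field_simps)
      then show ?case by (simp add: \<eta>_def A_def B_def smooth_step_1)
    qed
    with True show ?thesis by (simp add: tendsto_eventually)
  next
    case False
    have "\<eta> n x = 0" for n using False \<epsilon>(1)[of n] by (intro \<eta>_0) auto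
    with False show ?thesis by simp
  qed
  define H where "H x = g x * complex_of_real (\<psi> x) + u x * complex_of_real (\<psi>' x)" for x
  define F where "F x = u x * complex_of_real (\<psi> x)" for x
  have F_cont: "continuous_on {0..l} F"
    unfolding F_def by (intro continuous_intros u \<psi>_cont)
  have [measurable]: "g \<in> borel_measurable (edge_measure l)" by (rule L2_measurable[OF g])
  have gpsi_int: "integrable (edge_measure l) (\<lambda>x. g x * complex_of_real (\<psi> x))"
    by (intro L2_mult_integrable g L2_continuous continuous_intros \<psi>_cont)
  have upsi_int: "integrable (edge_measure l) (\<lambda>x. u x * complex_of_real (\<psi>' x))"
    by (intro edge_continuous_integrable continuous_intros u continuous_on_subset[OF \<psi>']) auto
  have H_int: "integrable (edge_measure l) H"
    unfolding H_def[abs_def] by (intro Bochner_Integration.integrable_add gpsi_int upsi_int)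
  have \<eta>_cont: "continuous_on S (\<eta> n)" for S n
    unfolding \<eta>_def using A_deriv B_deriv
    by (intro continuous_intros) (meson DERIV_isCont continuous_at_imp_continuous_on)+
  have \<eta>_meas: "(\<lambda>x. complex_of_real (\<eta> n x)) \<in> borel_measurable (edge_measure l)" for n
    by (intro edge_measurable_continuous continuous_intros \<eta>_cont)
  have \<eta>H_int: "integrable (edge_measure l) (\<lambda>x. complex_of_real (\<eta> n x) * f x)"
    if f: "integrable (edge_measure l) f" for n f
  proof (rule Bochner_Integration.integrable_bound[OF f])
    show "(\<lambda>x. complex_of_real (\<eta> n x) * f x) \<in> borel_measurable (edge_measure l)"
      using \<eta>_meas borel_measurable_integrable[OF f] by measurable
    show "AE x in edge_measure l. norm (complex_of_real (\<eta> n x) * f x) \<le> norm (f x)"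
      by (rule AE_I2) (use \<eta>_1 in \<open>simp add: norm_mult mult_left_le_one_le\<close>)
  qed
  have lim1: "(\<lambda>n. LINT x|edge_measure l. complex_of_real (\<eta> n x) * H x)
     \<longlonglongrightarrow> (LINT x|edge_measure l. indicator {a<..<b} x * H x)"
  proof (rule integral_dominated_convergence[where w="\<lambda>x. norm (H x)"])
    show "(\<lambda>x. indicator {a<..<b} x * H x) \<in> borel_measurable (edge_measure l)"
      using indicator_edge_measurable borel_measurable_integrable[OF H_int] by measurable
    show "AE x in edge_measure l. (\<lambda>n. complex_of_real (\<eta> n x) * H x) \<longlonglongrightarrow> indicator {a<..<b} x * H x"
    proof (rule AE_I2)
      fix x
      have "(\<lambda>n. complex_of_real (\<eta> n x) * H x) \<longlonglongrightarrow> complex_of_real (indicator {a<..<b} x) * H x"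
        by (intro tendsto_intros \<eta>_lim)
      moreover have "complex_of_real (indicator {a<..<b} x) = indicator {a<..<b} x"
        by (simp add: indicator_def)
      ultimately show "(\<lambda>n. complex_of_real (\<eta> n x) * H x) \<longlonglongrightarrow> indicator {a<..<b} x * H x"
        by metis
    qed
  qed (use H_int \<eta>_1 \<eta>H_int in \<open>auto simp: norm_mult mult_left_le_one_le intro!: borel_measurable_integrable\<close>)
  have A'_lim: "(\<lambda>n. LINT x|edge_measure l. F x * complex_of_real (A' n x)) \<longlonglongrightarrow> F a"
  proof (rule approximate_identity_tendsto[OF F_cont, where \<delta>="\<lambda>n. 2 * \<epsilon> n"])
    show "a \<in> {0..l}" using ab by simp
    show "integrable (edge_measure l) (A' n)" for n
      by (intro edge_continuous_integrable A'_cont)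
    show "0 \<le> A' n x" for n x
      unfolding A'_def using smooth_step'_nonneg \<epsilon>(1)[of n] by simp
    show "(LINT x|edge_measure l. A' n x) = 1" for n
    proof -
      have "(LINT x|edge_measure l. A' n x) = (LINT x|edge_measure l. indicator {0<..<l} x *\<^sub>R A' n x)"
        by (rule Bochner_Integration.integral_cong) auto
      also have "\<dots> = A n l - A n 0"
        by (rule edge_FTC) (use ab A_deriv A'_cont has_real_derivative_iff_has_vector_derivative in auto)
      also have "A n 0 = 0" unfolding A_def using ab \<epsilon>(1)[of n] by (intro smooth_step_0) (simp add: field_simps)
      also have "A n l = 1" unfolding A_def using ab \<epsilon>[of n] by (intro smooth_step_1) (simp add: field_simps)
      finally show ?thesis by simp
    qed
    show "\<bar>x - a\<bar> \<le> 2 * \<epsilon> n" if "A' n x \<noteq> 0" for n x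
    proof -
      from that have "\<not> ((x - a) / \<epsilon> n - 1 \<le> 0 \<or> 1 \<le> (x - a) / \<epsilon> n - 1)"
        unfolding A'_def using smooth_step'_0 by (metis div_0)
      then show ?thesis using \<epsilon>(1)[of n] by (simp add: field_simps)
    qed
    show "(\<lambda>n. 2 * \<epsilon> n) \<longlonglongrightarrow> 0" using tendsto_mult_right_zero[OF \<epsilon>_lim] .
  qed
  have B'_lim: "(\<lambda>n. LINT x|edge_measure l. F x * complex_of_real (B' n x)) \<longlonglongrightarrow> F b"
  proof (rule approximate_identity_tendsto[OF F_cont, where \<delta>="\<lambda>n. 2 * \<epsilon> n"])
    show "b \<in> {0..l}" using ab by simp
    show B'_int: "integrable (edge_measure l) (B' n)" for n
      by (intro edge_continuous_integrable B'_cont)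
    show "0 \<le> B' n x" for n x
      unfolding B'_def using smooth_step'_nonneg \<epsilon>(1)[of n] by simp
    show "(LINT x|edge_measure l. B' n x) = 1" for n
    proof -
      have "- (LINT x|edge_measure l. B' n x) = (LINT x|edge_measure l. indicator {0<..<l} x *\<^sub>R (- B' n x))"
        by (subst Bochner_Integration.integral_minus[symmetric])
           (rule Bochner_Integration.integral_cong, auto)
      also have "\<dots> = B n l - B n 0"
        by (rule edge_FTC) (use ab B_deriv B'_cont has_real_derivative_iff_has_vector_derivative in \<open>auto intro!: continuous_intros\<close>)
      also have "B n l = 0" unfolding B_def using ab \<epsilon>(1)[of n] by (intro smooth_step_0) (simp add: field_simps)
      also have "B n 0 = 1" unfolding B_def using ab \<epsilon>[of n] by (intro smooth_step_1) (simp add: field_simps)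
      finally show ?thesis by simp
    qed
    show "\<bar>x - b\<bar> \<le> 2 * \<epsilon> n" if "B' n x \<noteq> 0" for n x
    proof -
      from that have "\<not> ((b - x) / \<epsilon> n - 1 \<le> 0 \<or> 1 \<le> (b - x) / \<epsilon> n - 1)"
        unfolding B'_def using smooth_step'_0 by (metis div_0)
      then show ?thesis using \<epsilon>(1)[of n] by (simp add: field_simps)
    qed
    show "(\<lambda>n. 2 * \<epsilon> n) \<longlonglongrightarrow> 0" using tendsto_mult_right_zero[OF \<epsilon>_lim] .
  qed
  \<comment> \<open>The weak equation is tested with \<eta> \<psi>; the product rule separates the
    derivative of \<eta>, which falls on F = u \<psi>.\<close>
  have eq: "(LINT x|edge_measure l. complex_of_real (\<eta> n x) * H x) =
     (LINT x|edge_measure l. F x * complex_of_real (B' n x)) - (LINT x|edge_measure l. F x * complex_of_real (A' n x))" for n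
  proof -
    define \<phi> where "\<phi> x = \<eta> n x * \<psi> x" for x
    define \<phi>' where "\<phi>' x = (A' n x - B' n x) * \<psi> x + \<eta> n x * \<psi>' x" for x
    have D\<phi>: "(\<phi> has_real_derivative \<phi>' x) (at x)" for x
    proof -
      have "(\<eta> n has_real_derivative A' n x - B' n x) (at x)"
        using DERIV_diff[OF DERIV_add[OF A_deriv[of n x] B_deriv[of n x]] DERIV_const[of 1]]
        by (simp add: \<eta>_def[abs_def])
      from DERIV_mult[OF this \<psi>] show ?thesis
        by (simp add: \<phi>_def[abs_def] \<phi>'_def algebra_simps)
    qed
    have "closure {x. \<phi> x \<noteq> 0} \<subseteq> {a + \<epsilon> n..b - \<epsilon> n}"
    proof (rule closure_minimal)
      show "{x. \<phi> x \<noteq> 0} \<subseteq> {a + \<epsilon> n..b - \<epsilon> n}"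
      proof
        fix x assume "x \<in> {x. \<phi> x \<noteq> 0}"
        then have "\<eta> n x \<noteq> 0" by (simp add: \<phi>_def)
        then show "x \<in> {a + \<epsilon> n..b - \<epsilon> n}" using \<eta>_0[of x n] by (meson atLeastAtMost_iff linear)
      qed
    qed simp
    also have "\<dots> \<subseteq> {0<..<l}"
      using ab \<epsilon>(1)[of n] by auto
    finally have "closure {x. \<phi> x \<noteq> 0} \<subseteq> {0<..<l}" .
    moreover have "\<phi> C1_differentiable_on UNIV"
      unfolding C1_differentiable_on_def
      by (rule exI[of _ \<phi>'])
         (use D\<phi> in \<open>simp add: has_real_derivative_iff_has_vector_derivative[symmetric] \<phi>'_def[abs_def]
            continuous_on_add continuous_on_mult continuous_on_diff A'_cont B'_cont \<eta>_cont \<psi>_cont \<psi>'\<close>)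
    ultimately have "test_fun l \<phi>" by (simp add: test_fun_def)
    moreover have "deriv \<phi> = \<phi>'" using D\<phi> DERIV_imp_deriv by blast
    ultimately have w: "(LINT x|edge_measure l. u x * complex_of_real (\<phi>' x)) =
        - (LINT x|edge_measure l. g x * complex_of_real (\<phi> x))"
      using weak unfolding is_weak_deriv_def by metis
    have FA: "integrable (edge_measure l) (\<lambda>x. F x * complex_of_real (A' n x))"
      by (intro edge_continuous_integrable continuous_intros F_cont A'_cont)
    have FB: "integrable (edge_measure l) (\<lambda>x. F x * complex_of_real (B' n x))"
      by (intro edge_continuous_integrable continuous_intros F_cont B'_cont)
    have "(LINT x|edge_measure l. u x * complex_of_real (\<phi>' x)) =
       (LINT x|edge_measure l. (F x * complex_of_real (A' n x) - F x * complex_of_real (B' n x))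
          + complex_of_real (\<eta> n x) * (u x * complex_of_real (\<psi>' x)))"
      by (rule Bochner_Integration.integral_cong) (auto simp: \<phi>'_def F_def algebra_simps)
    also have "\<dots> = (LINT x|edge_measure l. F x * complex_of_real (A' n x)) - (LINT x|edge_measure l. F x * complex_of_real (B' n x))
       + (LINT x|edge_measure l. complex_of_real (\<eta> n x) * (u x * complex_of_real (\<psi>' x)))"
      by (subst Bochner_Integration.integral_add)
         (use FA FB \<eta>H_int[OF upsi_int] in auto)
    finally have 1: "(LINT x|edge_measure l. u x * complex_of_real (\<phi>' x)) = \<dots>" .
    have 2: "(LINT x|edge_measure l. g x * complex_of_real (\<phi> x)) =
      (LINT x|edge_measure l. complex_of_real (\<eta> n x) * (g x * complex_of_real (\<psi> x)))"
      by (rule Bochner_Integration.integral_cong) (auto simp: \<phi>_def)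
    have 3: "(LINT x|edge_measure l. complex_of_real (\<eta> n x) * H x) =
      (LINT x|edge_measure l. complex_of_real (\<eta> n x) * (g x * complex_of_real (\<psi> x)))
      + (LINT x|edge_measure l. complex_of_real (\<eta> n x) * (u x * complex_of_real (\<psi>' x)))"
      by (subst Bochner_Integration.integral_add[symmetric])
         (use \<eta>H_int[OF upsi_int] \<eta>H_int[OF gpsi_int] in \<open>auto simp: H_def distrib_left\<close>)
    show ?thesis using 1 2 3 w by (simp add: algebra_simps add_eq_0_iff)
  qed
  have "(\<lambda>n. LINT x|edge_measure l. complex_of_real (\<eta> n x) * H x) \<longlonglongrightarrow> F b - F a"
    unfolding eq by (intro tendsto_diff A'_lim B'_lim)
  with lim1 have "(LINT x|edge_measure l. indicator {a<..<b} x * H x) = F b - F a"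
    by (rule LIMSEQ_unique)
  then show ?thesis by (simp add: H_def F_def)
qed simp

section \<open>Weak derivatives\<close>

lemma edge_integral_lebesgue:
  fixes h :: "real \<Rightarrow> 'a::{banach, second_countable_topology}"
  shows "integral\<^sup>L (edge_measure l) h = (LINT x|lebesgue. indicator {0<..<l} x *\<^sub>R h x)"
  by (rule integral_restrict_space) simp

text \<open>Vanishing tail integrals say that the positive and negative parts of \<open>h\<close>
  define finite measures agreeing on all half-lines, hence equal measures with densities equal
  almost everywhere. One of the two parts is zero at each point, so both are.\<close>

lemma AE_zero_of_interval_integrals_real:
  fixes h :: "real \<Rightarrow> real"
  assumes h: "integrable (edge_measure l) h"
    and zero: "\<And>a. a \<in> {0..l} \<Longrightarrow> (LINT x|edge_measure l. indicator {a<..<l} x * h x) = 0"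
  shows "AE x in edge_measure l. h x = 0"
proof (cases "l \<le> 0")
  case False
  define H where "H x = indicator {0<..<l} x * h x" for x
  have H: "integrable lebesgue H"
    using h integrable_restrict_space[of "{0<..<l}" lebesgue h] by (simp add: H_def[abs_def])
  \<comment> \<open>A Borel representative is taken because half-lines determine measures on the
    Borel sets, not on the completed sigma-algebra.\<close>
  from completion_ex_borel_measurable_real[OF borel_measurable_integrable[OF H]]
  obtain h' where h'[measurable]: "h' \<in> borel_measurable lborel" and eq: "AE x in lborel. H x = h' x"
    by blast
  have eq': "AE x in lebesgue. H x = h' x"
    using eq by (rule AE_completion)
  have h'_meas: "h' \<in> borel_measurable lebesgue"
    using h' by (rule measurable_completion)
  have h'_int: "integrable lborel h'"
    using integrable_cong_AE[OF borel_measurable_integrable[OF H] h'_meas eq'] H integrable_completion[OF h'] by simp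
  have int0: "(LINT x|lborel. indicator {a<..} x * h' x) = 0" for a
  proof -
    \<comment> \<open>The left end of the half-line, clamped to the edge, where the hypothesis
      applies.\<close>
    define b where "b = max 0 (min a l)"
    have m: "(\<lambda>x. indicat_real {a<..} x * f x) \<in> borel_measurable lebesgue"
      if "f \<in> borel_measurable lebesgue" for f
      using that by (intro borel_measurable_times borel_measurable_indicator) auto
    have "(LINT x|lborel. indicator {a<..} x * h' x) = (LINT x|lebesgue. indicator {a<..} x * h' x)"
      by (rule integral_completion[symmetric]) measurable
    also have "\<dots> = (LINT x|lebesgue. indicator {a<..} x * H x)"
      by (rule integral_cong_AE) (use eq' m[OF h'_meas] m[OF borel_measurable_integrable[OF H]] in auto)
    also have "\<dots> = (LINT x|edge_measure l. indicator {b<..<l} x * h x)"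
      unfolding edge_integral_lebesgue
      by (rule Bochner_Integration.integral_cong) (auto simp: H_def b_def indicator_def)
    also have "\<dots> = 0" by (rule zero) (use False in \<open>auto simp: b_def\<close>)
    finally show ?thesis .
  qed
  have "density lborel (\<lambda>x. ennreal (h' x)) = density lborel (\<lambda>x. ennreal (- h' x))"
  proof (rule measure_eqI_lessThan)
    fix a
    have int: "integrable lborel (\<lambda>x. indicator {a<..} x * h' x)"
      using integrable_mult_indicator[of "{a<..}" lborel h'] h'_int by simp
    have fin: "(\<integral>\<^sup>+ x. ennreal (indicator {a<..} x * h' x) \<partial>lborel) < \<infinity>"
      "(\<integral>\<^sup>+ x. ennreal (- (indicator {a<..} x * h' x)) \<partial>lborel) < \<infinity>"
      using int by (auto simp: real_integrable_def top.not_eq_extremum)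
    have em: "emeasure (density lborel (\<lambda>x. ennreal (h' x))) {a<..} = (\<integral>\<^sup>+ x. ennreal (indicator {a<..} x * h' x) \<partial>lborel)"
      "emeasure (density lborel (\<lambda>x. ennreal (- h' x))) {a<..} = (\<integral>\<^sup>+ x. ennreal (- (indicator {a<..} x * h' x)) \<partial>lborel)"
      by (auto simp: emeasure_density intro!: nn_integral_cong split: split_indicator)
    show "emeasure (density lborel (\<lambda>x. ennreal (h' x))) {a<..} < \<infinity>"
      using fin em by simp
    have "enn2real (\<integral>\<^sup>+ x. ennreal (indicator {a<..} x * h' x) \<partial>lborel) =
      enn2real (\<integral>\<^sup>+ x. ennreal (- (indicator {a<..} x * h' x)) \<partial>lborel)"
      using real_lebesgue_integral_def[OF int] int0[of a] by simp
    then have "ennreal (enn2real (\<integral>\<^sup>+ x. ennreal (indicator {a<..} x * h' x) \<partial>lborel)) =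
      ennreal (enn2real (\<integral>\<^sup>+ x. ennreal (- (indicator {a<..} x * h' x)) \<partial>lborel))"
      by simp
    then show "emeasure (density lborel (\<lambda>x. ennreal (h' x))) {a<..} = emeasure (density lborel (\<lambda>x. ennreal (- h' x))) {a<..}"
      unfolding em using fin by (metis ennreal_enn2real infinity_ennreal_def)
  qed simp_all
  then have "AE x in lborel. ennreal (h' x) = ennreal (- h' x)"
    by (rule sigma_finite_measure.density_unique[OF lborel.sigma_finite_measure_axioms, rotated 2]) measurable
  then have "AE x in lborel. h' x = 0"
  proof eventually_elim
    case (elim x)
    then show ?case by (cases "h' x" "0::real" rule: linorder_cases) (auto simp: ennreal_neg)
  qed
  then have "AE x in lebesgue. h' x = 0"
    by (rule AE_completion)
  with eq' have "AE x in lebesgue. x \<in> {0<..<l} \<longrightarrow> h x = 0"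
    by eventually_elim (simp add: H_def indicator_def)
  then show ?thesis
    by (subst AE_restrict_space_iff) auto
qed (auto simp: AE_restrict_space_iff)

lemma AE_zero_of_interval_integrals:
  fixes h :: "real \<Rightarrow> complex"
  assumes h: "integrable (edge_measure l) h"
    and zero: "\<And>a. a \<in> {0..l} \<Longrightarrow> (LINT x|edge_measure l. indicator {a<..<l} x * h x) = 0"
  shows "AE x in edge_measure l. h x = 0"
proof -
  have int: "integrable (edge_measure l) (\<lambda>x. indicator {a<..<l} x * h x)" for a
  proof (rule Bochner_Integration.integrable_bound[OF h])
    show "(\<lambda>x. indicator {a<..<l} x * h x) \<in> borel_measurable (edge_measure l)"
      using indicator_edge_measurable borel_measurable_integrable[OF h] by measurable
  qed (auto simp: indicator_def)
  have "(LINT x|edge_measure l. indicator {a<..<l} x * Re (h x)) = 0"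
       "(LINT x|edge_measure l. indicator {a<..<l} x * Im (h x)) = 0" if "a \<in> {0..l}" for a
  proof -
    have *: "indicator {a<..<l} x * Re (h x) = Re (indicator {a<..<l} x * h x)"
      "indicator {a<..<l} x * Im (h x) = Im (indicator {a<..<l} x * h x)" for x
      by (auto simp: indicator_def)
    show "(LINT x|edge_measure l. indicator {a<..<l} x * Re (h x)) = 0"
      "(LINT x|edge_measure l. indicator {a<..<l} x * Im (h x)) = 0"
      unfolding * using integral_Re[OF int[of a]] integral_Im[OF int[of a]] zero[OF that] by simp_all
  qed
  then have "AE x in edge_measure l. Re (h x) = 0" "AE x in edge_measure l. Im (h x) = 0"
    using h by (auto intro!: AE_zero_of_interval_integrals_real)
  then show ?thesis
    by eventually_elim (simp add: complex_eq_iff)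
qed

lemma edge_indicator_integrable:
  fixes h :: "real \<Rightarrow> complex"
  assumes h: "integrable (edge_measure l) h"
  shows "integrable (edge_measure l) (\<lambda>x. indicator {a<..<b} x * h x)"
proof (rule Bochner_Integration.integrable_bound[OF h])
  show "(\<lambda>x. indicator {a<..<b} x * h x) \<in> borel_measurable (edge_measure l)"
    using indicator_edge_measurable borel_measurable_integrable[OF h] by measurable
qed (auto simp: indicator_def)

lemma weak_deriv_fundamental_theorem:
  assumes "continuous_on {0..l} u" "g \<in> L2 l" "is_weak_deriv l u g" "0 \<le> a" "a \<le> b" "b \<le> l"
  shows "(LINT x|edge_measure l. indicator {a<..<b} x * g x) = u b - u a"
  using weak_deriv_integration_by_parts[OF assms, of "\<lambda>x. 1" "\<lambda>x. 0"] by simp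

text \<open>\<open>weak_deriv\<close> is a choice by \<open>SOME\<close>, so a concrete formula for
  it is available only almost everywhere, through this uniqueness. Both candidates have integral u l
  - u a over (a, l), so their difference has vanishing tail integrals.\<close>

lemma is_weak_deriv_unique:
  assumes u: "continuous_on {0..l} u"
    and g: "g \<in> L2 l" "is_weak_deriv l u g" and g': "g' \<in> L2 l" "is_weak_deriv l u g'"
  shows "AE x in edge_measure l. g x = g' x"
proof -
  have "AE x in edge_measure l. g x - g' x = 0"
  proof (rule AE_zero_of_interval_integrals)
    show "integrable (edge_measure l) (\<lambda>x. g x - g' x)"
      by (intro L2_integrable L2_diff g g')
    show "(LINT x|edge_measure l. indicator {a<..<l} x * (g x - g' x)) = 0" if "a \<in> {0..l}" for a
      unfolding right_diff_distrib
      by (subst Bochner_Integration.integral_diff)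
         (use that edge_indicator_integrable[OF L2_integrable[OF g(1)]]
            edge_indicator_integrable[OF L2_integrable[OF g'(1)]] in \<open>auto simp: weak_deriv_fundamental_theorem[OF u g] weak_deriv_fundamental_theorem[OF u g']\<close>)
  qed
  then show ?thesis by simp
qed

lemma H1_weak_deriv:
  assumes "u \<in> H1_interval l"
  shows "weak_deriv l u \<in> L2 l" "is_weak_deriv l u (weak_deriv l u)"
proof -
  have "\<exists>g. g \<in> L2 l \<and> is_weak_deriv l u g"
    using assms by (auto simp: H1_interval_def)
  from someI_ex[OF this] show "weak_deriv l u \<in> L2 l" "is_weak_deriv l u (weak_deriv l u)"
    by (simp_all add: weak_deriv_def)
qed

lemma H1_intervalI:
  assumes "continuous_on {0..l} u" "g \<in> L2 l" "is_weak_deriv l u g"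
  shows "u \<in> H1_interval l" "AE x in edge_measure l. weak_deriv l u x = g x"
proof -
  show "u \<in> H1_interval l"
    using assms L2_continuous by (auto simp: H1_interval_def)
  then show "AE x in edge_measure l. weak_deriv l u x = g x"
    using assms H1_weak_deriv by (intro is_weak_deriv_unique[of l u]) auto
qed

lemma test_fun_facts:
  assumes "test_fun l \<phi>"
  shows "(\<phi> has_real_derivative deriv \<phi> x) (at x)" "continuous_on S (deriv \<phi>)" "continuous_on S \<phi>"
    "x \<notin> {0<..<l} \<Longrightarrow> \<phi> x = 0"
proof -
  from assms obtain D where D: "\<And>x. (\<phi> has_real_derivative D x) (at x)" "continuous_on UNIV D"
    by (auto simp: test_fun_def C1_differentiable_on_def has_real_derivative_iff_has_vector_derivative)
  then have "deriv \<phi> = D" using DERIV_imp_deriv by blast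
  then show *: "(\<phi> has_real_derivative deriv \<phi> x) (at x)" "continuous_on S (deriv \<phi>)" for x
    using D continuous_on_subset[OF D(2)] by auto
  then show "continuous_on S \<phi>"
    by (meson DERIV_isCont continuous_at_imp_continuous_on)
  show "\<phi> x = 0" if "x \<notin> {0<..<l}"
    using assms that closure_subset[of "{x. \<phi> x \<noteq> 0}"] by (auto simp: test_fun_def)
qed

lemma is_weak_deriv_lincomb:
  assumes u: "u \<in> L2 l" "g \<in> L2 l" "is_weak_deriv l u g"
    and v: "v \<in> L2 l" "h \<in> L2 l" "is_weak_deriv l v h"
  shows "is_weak_deriv l (\<lambda>x. a * u x + b * v x) (\<lambda>x. a * g x + b * h x)"
  unfolding is_weak_deriv_def
proof (intro allI impI)
  fix \<phi> assume t: "test_fun l \<phi>"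
  have c: "(\<lambda>x. complex_of_real (deriv \<phi> x)) \<in> L2 l" "(\<lambda>x. complex_of_real (\<phi> x)) \<in> L2 l"
    by (intro L2_continuous continuous_intros test_fun_facts[OF t])+
  have *: "(LINT x|edge_measure l. (a * f x + b * f' x) * p x) =
      a * (LINT x|edge_measure l. f x * p x) + b * (LINT x|edge_measure l. f' x * p x)"
    if "f \<in> L2 l" "f' \<in> L2 l" "p \<in> L2 l" for f f' p :: "real \<Rightarrow> complex"
  proof -
    have "(LINT x|edge_measure l. (a * f x + b * f' x) * p x) =
       (LINT x|edge_measure l. a * (f x * p x) + b * (f' x * p x))"
      by (simp add: algebra_simps)
    also have "\<dots> = a * (LINT x|edge_measure l. f x * p x) + b * (LINT x|edge_measure l. f' x * p x)"
      by (subst Bochner_Integration.integral_add) (use that L2_mult_integrable in auto)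
    finally show ?thesis .
  qed
  show "(LINT x|edge_measure l. (a * u x + b * v x) * complex_of_real (deriv \<phi> x)) =
    - (LINT x|edge_measure l. (a * g x + b * h x) * complex_of_real (\<phi> x))"
    using u v t by (simp add: * c is_weak_deriv_def)
qed

lemma H1_interval_lincomb:
  assumes u: "u \<in> H1_interval l" "continuous_on {0..l} u" and v: "v \<in> H1_interval l" "continuous_on {0..l} v"
  shows "(\<lambda>x. a * u x + b * v x) \<in> H1_interval l"
    "AE x in edge_measure l. weak_deriv l (\<lambda>x. a * u x + b * v x) x = a * weak_deriv l u x + b * weak_deriv l v x"
proof -
  have *: "continuous_on {0..l} (\<lambda>x. a * u x + b * v x)"
    "(\<lambda>x. a * weak_deriv l u x + b * weak_deriv l v x) \<in> L2 l"
    "is_weak_deriv l (\<lambda>x. a * u x + b * v x) (\<lambda>x. a * weak_deriv l u x + b * weak_deriv l v x)"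
    by (intro continuous_intros is_weak_deriv_lincomb L2_add L2_scale H1_weak_deriv u v L2_continuous)+
  from H1_intervalI[OF *] show "(\<lambda>x. a * u x + b * v x) \<in> H1_interval l"
    "AE x in edge_measure l. weak_deriv l (\<lambda>x. a * u x + b * v x) x = a * weak_deriv l u x + b * weak_deriv l v x" .
qed

text \<open>The function \<open>\<psi>\<close> restricted to \<open>[a, b]\<close> is weakly differentiable if it vanishes at those
  endpoints of \<open>[a, b]\<close> at which it is really cut off.\<close>

lemma H1_interval_piece:
  assumes ab: "0 \<le> a" "a \<le> b" "b \<le> l"
    and \<psi>: "\<And>x. (\<psi> has_real_derivative \<psi>' x) (at x)" and \<psi>': "continuous_on UNIV \<psi>'"
    and ends: "a = 0 \<or> \<psi> a = 0" "b = l \<or> \<psi> b = 0"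
    and u: "\<And>x. x \<in> {0..l} \<Longrightarrow> u x = complex_of_real (if a \<le> x \<and> x \<le> b then \<psi> x else 0)"
  shows "continuous_on {0..l} u" "u \<in> H1_interval l"
    "AE x in edge_measure l. weak_deriv l u x = indicator {a<..<b} x * complex_of_real (\<psi>' x)"
proof -
  let ?g = "\<lambda>x. indicator {a<..<b} x * complex_of_real (\<psi>' x)"
  have \<psi>_cont: "continuous_on S \<psi>" for S
    using \<psi> by (meson DERIV_isCont continuous_at_imp_continuous_on)
  \<comment> \<open>Clamping the argument extends \<psi> by constants beyond [a, b]; at an end that
    is really cut off this constant is 0, so the extension is \<open>u\<close>.\<close>
  have "continuous_on {0..l} (\<lambda>x. complex_of_real (\<psi> (max a (min b x))))"
    by (intro continuous_intros continuous_on_compose2[OF \<psi>_cont[of UNIV]]) auto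
  moreover have "u x = complex_of_real (\<psi> (max a (min b x)))" if "x \<in> {0..l}" for x
    using that u[OF that] ends ab by (auto simp: max_def min_def)
  ultimately show cont: "continuous_on {0..l} u"
    using continuous_on_cong[OF refl, of "{0..l}" u] by simp
  have c: "continuous_on {0..l} (\<lambda>x. complex_of_real (\<psi>' x))"
    by (intro continuous_intros continuous_on_subset[OF \<psi>']) auto
  have g: "?g \<in> L2 l"
    by (rule L2_bounded_mult[where C=1, OF L2_continuous[OF c] indicator_edge_measurable])
       (auto simp: indicator_def)
  have "is_weak_deriv l u ?g"
    unfolding is_weak_deriv_def
  proof (intro allI impI)
    fix \<phi> assume t: "test_fun l \<phi>"
    let ?F = "\<lambda>x. complex_of_real (\<psi> x * \<phi> x)" and ?f = "\<lambda>x. complex_of_real (\<psi>' x * \<phi> x + \<psi> x * deriv \<phi> x)"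
    \<comment> \<open>\<open>u\<close> is cut to the closed interval, its derivative to the open
      one; the two end points form a null set.\<close>
    have AE: "AE x in edge_measure l. x \<noteq> a \<and> x \<noteq> b"
    proof -
      have "AE x in lebesgue. x \<noteq> c" for c :: real
        by (rule AE_I[where N="{c}"]) auto
      then have "AE x in lebesgue. x \<noteq> a \<and> x \<noteq> b" by (auto intro: AE_conjI)
      then show ?thesis by (subst AE_restrict_space_iff) auto
    qed
    have f_cont: "continuous_on {0..l} ?f"
      by (intro continuous_intros \<psi>_cont test_fun_facts[OF t] continuous_on_subset[OF \<psi>']) auto
    have "(LINT x|edge_measure l. u x * complex_of_real (deriv \<phi> x)) =
        (LINT x|edge_measure l. indicator {a<..<b} x *\<^sub>R ?f x - ?g x * complex_of_real (\<phi> x))"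
    proof (rule integral_cong_AE)
      show "AE x in edge_measure l. u x * complex_of_real (deriv \<phi> x) =
         indicator {a<..<b} x *\<^sub>R ?f x - ?g x * complex_of_real (\<phi> x)"
        using AE AE_space
      proof eventually_elim
        case (elim x)
        then have "u x = complex_of_real (if a \<le> x \<and> x \<le> b then \<psi> x else 0)" by (intro u) auto
        then show ?case using elim by (auto simp: indicator_def algebra_simps)
      qed
    qed (use edge_measurable_continuous[OF cont] L2_measurable[OF g] indicator_edge_measurable
          edge_measurable_continuous[of l "\<lambda>x. complex_of_real (deriv \<phi> x)"]
          edge_measurable_continuous[of l "\<lambda>x. complex_of_real (\<phi> x)"] edge_measurable_continuous[OF f_cont]
          test_fun_facts[OF t] \<psi>_cont continuous_on_subset[OF \<psi>', of "{0..l}"] in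
         \<open>auto intro!: borel_measurable_times borel_measurable_diff borel_measurable_scaleR continuous_intros\<close>)
    also have "\<dots> = (LINT x|edge_measure l. indicator {a<..<b} x *\<^sub>R ?f x) - (LINT x|edge_measure l. ?g x * complex_of_real (\<phi> x))"
    proof (rule Bochner_Integration.integral_diff)
      have "integrable (edge_measure l) (\<lambda>x. indicator {a<..<b} x * ?f x)"
        by (intro edge_indicator_integrable edge_continuous_integrable continuous_intros \<psi>_cont test_fun_facts[OF t]
             continuous_on_subset[OF \<psi>']) auto
      then show "integrable (edge_measure l) (\<lambda>x. indicator {a<..<b} x *\<^sub>R ?f x)"
        by (rule Bochner_Integration.integrable_cong[THEN iffD1, rotated 2]) (auto simp: indicator_def)
      show "integrable (edge_measure l) (\<lambda>x. ?g x * complex_of_real (\<phi> x))"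
        by (intro L2_mult_integrable g L2_continuous continuous_intros test_fun_facts[OF t])
    qed
    also have "(LINT x|edge_measure l. indicator {a<..<b} x *\<^sub>R ?f x) = ?F b - ?F a"
    proof (rule edge_FTC[OF ab])
      fix x
      have "((\<lambda>x. \<psi> x * \<phi> x) has_real_derivative \<psi>' x * \<phi> x + \<psi> x * deriv \<phi> x) (at x)"
        using DERIV_mult[OF \<psi> test_fun_facts(1)[OF t]] by (simp add: algebra_simps)
      then show "(?F has_vector_derivative ?f x) (at x)"
        by (rule has_vector_derivative_of_real)
    qed (intro continuous_intros \<psi>_cont test_fun_facts[OF t] continuous_on_subset[OF \<psi>'], auto)
    also have "\<dots> = 0"
      using ends test_fun_facts(4)[OF t, of 0] test_fun_facts(4)[OF t, of l] by auto
    finally show "(LINT x|edge_measure l. u x * complex_of_real (deriv \<phi> x)) =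
       - (LINT x|edge_measure l. ?g x * complex_of_real (\<phi> x))" by simp
  qed
  from H1_intervalI[OF cont g this]
  show "u \<in> H1_interval l" "AE x in edge_measure l. weak_deriv l u x = ?g x" .
qed

section \<open>Sobolev estimates and completeness\<close>

lemma square_le_mult_of_AM_GM:
  fixes a d e :: real
  assumes "0 \<le> a" "0 \<le> d" "0 \<le> e" and AM: "\<And>r. r > 0 \<Longrightarrow> 2 * a \<le> r * d + e / r"
  shows "a\<^sup>2 \<le> d * e"
proof -
  consider "a = 0" | "a > 0" "d = 0" | "a > 0" "d > 0" "e = 0" | "a > 0" "d > 0" "e > 0"
    using assms(1-3) by linarith
  then show ?thesis
  proof cases
    case 1 then show ?thesis using assms by simp
  next
    case 2
    \<comment> \<open>A weight this large makes e / r smaller than \<open>a\<close>, which is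
      contradictory for d = 0. If e = 0 instead, the weight a / d gives 2 a \<le> a.\<close>
    have "2 * a \<le> e / ((e + 1) / a)" using AM[of "(e + 1) / a"] 2 assms by simp
    then have "a * (2 * (e + 1)) \<le> a * e" using 2 assms by (simp add: field_simps)
    then have "2 * (e + 1) \<le> e" using 2 by (simp only: mult_le_cancel_left_pos)
    then show ?thesis using assms by simp
  next
    case 3
    then show ?thesis using AM[of "a / d"] by simp
  next
    case 4
    define r where "r = sqrt (e / d)"
    have r: "r > 0" "r\<^sup>2 = e / d" using 4 by (simp_all add: r_def)
    have "e / r = r * d" using r 4 by (simp add: field_simps power2_eq_square)
    then have "a \<le> r * d" using AM[OF r(1)] by linarith
    then have "a\<^sup>2 \<le> (r * d)\<^sup>2" using assms by (intro power_mono)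
    also have "\<dots> = d * e" using r 4 by (simp add: power_mult_distrib field_simps power2_eq_square)
    finally show ?thesis .
  qed
qed

lemma L2_Cauchy_Schwarz:
  assumes u: "u \<in> L2 l" and v: "v \<in> L2 l"
  shows "(cmod (LINT x|edge_measure l. u x * v x))\<^sup>2
    \<le> (LINT x|edge_measure l. (cmod (u x))\<^sup>2) * (LINT x|edge_measure l. (cmod (v x))\<^sup>2)"
proof (rule square_le_mult_of_AM_GM)
  fix r :: real assume r: "r > 0"
  have "cmod (LINT x|edge_measure l. u x * v x)
     \<le> (LINT x|edge_measure l. (r * (cmod (u x))\<^sup>2 + (cmod (v x))\<^sup>2 / r) / 2)"
  proof (rule Bochner_Integration.integral_norm_bound_integral[OF L2_mult_integrable[OF u v]])
    show "integrable (edge_measure l) (\<lambda>x. (r * (cmod (u x))\<^sup>2 + (cmod (v x))\<^sup>2 / r) / 2)"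
      using L2_square_integrable[OF u] L2_square_integrable[OF v] by simp
    fix x
    have "0 \<le> (r * cmod (u x) - cmod (v x))\<^sup>2 / r" using r by simp
    then show "cmod (u x * v x) \<le> (r * (cmod (u x))\<^sup>2 + (cmod (v x))\<^sup>2 / r) / 2"
      using r by (simp add: norm_mult power2_diff field_simps power2_eq_square)
  qed
  also have "\<dots> = (r * (LINT x|edge_measure l. (cmod (u x))\<^sup>2) + (LINT x|edge_measure l. (cmod (v x))\<^sup>2) / r) / 2"
    using L2_square_integrable[OF u] L2_square_integrable[OF v] by simp
  finally show "2 * cmod (LINT x|edge_measure l. u x * v x)
    \<le> r * (LINT x|edge_measure l. (cmod (u x))\<^sup>2) + (LINT x|edge_measure l. (cmod (v x))\<^sup>2) / r" by simp
qed simp_all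

lemma edge_indicator_integral:
  assumes "0 \<le> a" "a \<le> b" "b \<le> l"
  shows "(LINT x|edge_measure l. indicator {a<..<b} x * c) = (b - a) * (c::real)"
proof -
  have "(LINT x|edge_measure l. indicator {a<..<b} x *\<^sub>R c) = b * c - a * c"
    by (rule edge_FTC[OF assms])
       (auto intro!: derivative_eq_intros simp: has_real_derivative_iff_has_vector_derivative[symmetric])
  then show ?thesis by (simp add: algebra_simps)
qed

text \<open>The increment of \<open>u\<close> is the pairing of \<open>g\<close> with the indicator
  of an interval, so Cauchy-Schwarz applies. This modulus of continuity yields both the sup bound
  and the equicontinuity used for compactness.\<close>

lemma H1_Hoelder:
  assumes u: "continuous_on {0..l} u" and g: "g \<in> L2 l" "is_weak_deriv l u g"
    and xy: "x \<in> {0..l}" "y \<in> {0..l}"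
  shows "(cmod (u x - u y))\<^sup>2 \<le> \<bar>x - y\<bar> * (LINT t|edge_measure l. (cmod (g t))\<^sup>2)"
proof -
  have *: "(cmod (u b - u a))\<^sup>2 \<le> (b - a) * (LINT t|edge_measure l. (cmod (g t))\<^sup>2)"
    if "0 \<le> a" "a \<le> b" "b \<le> l" for a b
  proof -
    have i: "indicator {a<..<b} \<in> L2 l"
      by (rule L2_bounded[where C=1, OF indicator_edge_measurable]) (auto simp: indicator_def)
    have "u b - u a = (LINT x|edge_measure l. indicator {a<..<b} x * g x)"
      using weak_deriv_fundamental_theorem[OF u g that] by simp
    then have "(cmod (u b - u a))\<^sup>2 \<le> (LINT x|edge_measure l. (cmod (indicator {a<..<b} x))\<^sup>2) * (LINT t|edge_measure l. (cmod (g t))\<^sup>2)"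
      using L2_Cauchy_Schwarz[OF i g(1)] by simp
    also have "(LINT x|edge_measure l. (cmod (indicator {a<..<b} x))\<^sup>2) = (LINT x|edge_measure l. indicator {a<..<b} x * 1)"
      by (rule Bochner_Integration.integral_cong) (auto simp: indicator_def)
    also have "\<dots> = b - a" using edge_indicator_integral[OF that, of 1] by simp
    finally show ?thesis .
  qed
  show ?thesis
    using *[of x y] *[of y x] xy by (cases "x \<le> y") (auto simp: norm_minus_commute)
qed

text \<open>The value at \<open>x\<close> is compared with all values in a window of length \<delta>
  and the inequality is averaged over the window. Shrinking \<delta> makes the coefficient of the
  energy small at the expense of the mass term.\<close>

lemma H1_pointwise_bound:
  assumes u: "continuous_on {0..l} u" and g: "g \<in> L2 l" "is_weak_deriv l u g"
    and \<delta>: "0 < \<delta>" "\<delta> \<le> l" and x: "x \<in> {0..l}"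
  shows "(cmod (u x))\<^sup>2 \<le> 2 / \<delta> * (LINT t|edge_measure l. (cmod (u t))\<^sup>2)
     + 2 * \<delta> * (LINT t|edge_measure l. (cmod (g t))\<^sup>2)"
proof -
  define E where "E = (LINT t|edge_measure l. (cmod (g t))\<^sup>2)"
  have E: "E \<ge> 0" unfolding E_def by simp
  \<comment> \<open>Left end of the window: it starts at \<open>x\<close>, pushed back where
    necessary to stay inside the edge.\<close>
  define a where "a = min x (l - \<delta>)"
  have a: "0 \<le> a" "a + \<delta> \<le> l" "a \<le> x" "x \<le> a + \<delta>" using x \<delta> by (auto simp: a_def)
  have bound: "(cmod (u x))\<^sup>2 \<le> 2 * (cmod (u y))\<^sup>2 + 2 * \<delta> * E" if "y \<in> {a<..<a + \<delta>}" for y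
  proof -
    have "(cmod (u x - u y))\<^sup>2 \<le> \<bar>x - y\<bar> * E"
      unfolding E_def using a x that by (intro H1_Hoelder[OF u g]) auto
    also have "\<dots> \<le> \<delta> * E" using that a E by (intro mult_right_mono) auto
    finally have 1: "(cmod (u x - u y))\<^sup>2 \<le> \<delta> * E" .
    have "(cmod (u x))\<^sup>2 \<le> (cmod (u x - u y) + cmod (u y))\<^sup>2"
      by (intro power_mono) (use norm_triangle_ineq[of "u x - u y" "u y"] in simp_all)
    also have "\<dots> \<le> 2 * (cmod (u x - u y))\<^sup>2 + 2 * (cmod (u y))\<^sup>2"
      using sum_squares_bound[of "cmod (u x - u y)" "cmod (u y)"] by (simp add: power2_sum)
    finally show ?thesis using 1 by simp
  qed
  have u2: "integrable (edge_measure l) (\<lambda>t. (cmod (u t))\<^sup>2)"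
    using L2_square_integrable[OF L2_continuous[OF u]] .
  have ind: "integrable (edge_measure l) (\<lambda>t. indicator {a<..<a + \<delta>} t * (c::real))" for c
    by (rule edge_bounded_integrable[where C="\<bar>c\<bar>"])
       (intro borel_measurable_times indicator_edge_measurable, auto simp: indicator_def)
  have "\<delta> * (cmod (u x))\<^sup>2 = (LINT t|edge_measure l. indicator {a<..<a + \<delta>} t * (cmod (u x))\<^sup>2)"
    by (subst edge_indicator_integral) (use a \<delta> in auto)
  also have "\<dots> \<le> (LINT t|edge_measure l. 2 * (cmod (u t))\<^sup>2 + indicator {a<..<a + \<delta>} t * (2 * \<delta> * E))"
  proof (rule integral_mono)
    show "integrable (edge_measure l) (\<lambda>t. 2 * (cmod (u t))\<^sup>2 + indicator {a<..<a + \<delta>} t * (2 * \<delta> * E))"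
      by (intro Bochner_Integration.integrable_add ind integrable_mult_right u2)
  qed (use bound ind in \<open>auto simp: indicator_def\<close>)
  also have "\<dots> = 2 * (LINT t|edge_measure l. (cmod (u t))\<^sup>2) + \<delta> * (2 * \<delta> * E)"
    by (subst Bochner_Integration.integral_add[OF integrable_mult_right[OF u2] ind], subst edge_indicator_integral)
       (use a \<delta> in auto)
  finally show ?thesis
    using \<delta> unfolding E_def[symmetric] by (simp add: field_simps power2_eq_square)
qed

lemma measure_edge_measure: "measure (edge_measure l) {0<..<l} \<le> \<bar>l\<bar>"
  by (cases "0 \<le> l") (simp_all add: measure_restrict_space)

text \<open>Riesz-Fischer: a rapidly Cauchy subsequence telescopes into a series converging almost
  everywhere, and Fatou's lemma carries the Cauchy estimate over to the limit.\<close>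

lemma L2_Cauchy_imp_convergent:
  assumes g: "\<And>n. g n \<in> L2 l"
    and Cauchy: "\<And>\<epsilon>. \<epsilon> > 0 \<Longrightarrow> \<exists>N. \<forall>m\<ge>N. \<forall>n\<ge>N. (LINT x|edge_measure l. (cmod (g m x - g n x))\<^sup>2) \<le> \<epsilon>"
  obtains G where "G \<in> L2 l" "(\<lambda>n. LINT x|edge_measure l. (cmod (G x - g n x))\<^sup>2) \<longlonglongrightarrow> 0"
proof -
  \<comment> \<open>The bound 4^-k is on the squared norm, so increments of the subsequence have
    norm at most 2^-k.\<close>
  have "\<exists>r::nat \<Rightarrow> nat. \<forall>k. (\<forall>m\<ge>r k. \<forall>n\<ge>r k. (LINT x|edge_measure l. (cmod (g m x - g n x))\<^sup>2) \<le> (1/4)^k) \<and> r k < r (Suc k)"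
  proof (rule dependent_nat_choice)
    show "\<exists>N. \<forall>m\<ge>N. \<forall>n\<ge>N. (LINT x|edge_measure l. (cmod (g m x - g n x))\<^sup>2) \<le> (1/4)^0"
      using Cauchy[of 1] by simp
    fix N and k :: nat
    obtain N' where "\<forall>m\<ge>N'. \<forall>n\<ge>N'. (LINT x|edge_measure l. (cmod (g m x - g n x))\<^sup>2) \<le> (1/4)^Suc k"
      using Cauchy[of "(1/4)^Suc k"] by auto
    then show "\<exists>M. (\<forall>m\<ge>M. \<forall>n\<ge>M. (LINT x|edge_measure l. (cmod (g m x - g n x))\<^sup>2) \<le> (1/4)^Suc k) \<and> N < M"
      by (intro exI[of _ "max N' (Suc N)"]) auto
  qed
  then obtain r :: "nat \<Rightarrow> nat" where r: "\<And>k m n. m \<ge> r k \<Longrightarrow> n \<ge> r k \<Longrightarrow> (LINT x|edge_measure l. (cmod (g m x - g n x))\<^sup>2) \<le> (1/4)^k"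
    and r_mono: "strict_mono r"
    by (auto simp: strict_mono_Suc_iff)
  define d where "d k x = g (r (Suc k)) x - g (r k) x" for k x
  have d: "d k \<in> L2 l" for k unfolding d_def by (intro L2_diff g)
  have d_norm: "(LINT x|edge_measure l. cmod (d k x)) \<le> (\<bar>l\<bar> + 1) * (1/2)^k" for k
  proof -
    have d2: "(LINT x|edge_measure l. (cmod (d k x))\<^sup>2) \<le> (1/4)^k"
      unfolding d_def using r_mono by (intro r) (auto simp: strict_mono_less_eq)
    \<comment> \<open>Weighted AM-GM with weight 2^k bounds the L^1 norm of the increment: both
      resulting terms are of order 2^-k because 2^k 4^-k = 2^-k.\<close>
    have int: "integrable (edge_measure l) (\<lambda>x. (1/2)^k + 2^k * (cmod (d k x))\<^sup>2)"
      by (intro Bochner_Integration.integrable_add integrable_mult_right L2_square_integrable d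
          finite_measure.integrable_const[OF finite_edge_measure])
    have "(LINT x|edge_measure l. cmod (d k x)) \<le> (LINT x|edge_measure l. (1/2)^k + 2^k * (cmod (d k x))\<^sup>2)"
    proof (rule integral_mono[OF _ int])
      show "integrable (edge_measure l) (\<lambda>x. cmod (d k x))" using L2_integrable[OF d] by simp
      fix x
      let ?c = "cmod (d k x)"
      have "2 * ((1/2)^k * ?c) \<le> ((1/2)^k)\<^sup>2 + ?c\<^sup>2"
        using sum_squares_bound[of "(1/2)^k" ?c] by (simp add: mult.assoc)
      then have "2^k * (2 * ((1/2)^k * ?c)) \<le> 2^k * (((1/2)^k)\<^sup>2 + ?c\<^sup>2)" by (rule mult_left_mono) simp
      moreover have "2^k * (1/2)^k = (1::real)" by (simp add: power_mult_distrib[symmetric])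
      moreover have "2^k * (2 * ((1/2)^k * ?c)) = 2 * ?c * (2^k * (1/2)^k)"
        "2^k * (((1/2)^k)\<^sup>2 + ?c\<^sup>2) = (1/2)^k * (2^k * (1/2)^k) + 2^k * ?c\<^sup>2"
        by (simp_all only: distrib_left power2_eq_square mult_ac)
      ultimately have "2 * ?c \<le> (1/2)^k + 2^k * ?c\<^sup>2" by (simp only: mult_1_right)
      then show "?c \<le> (1/2)^k + 2^k * ?c\<^sup>2" using norm_ge_zero[of "d k x"] by linarith
    qed
    also have "\<dots> = (1/2)^k * measure (edge_measure l) {0<..<l} + 2^k * (LINT x|edge_measure l. (cmod (d k x))\<^sup>2)"
      by (subst Bochner_Integration.integral_add[OF finite_measure.integrable_const[OF finite_edge_measure]
            integrable_mult_right[OF L2_square_integrable[OF d]]]) simp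
    also have "\<dots> \<le> (1/2)^k * \<bar>l\<bar> + 2^k * (1/4)^k"
      using d2 measure_edge_measure by (intro add_mono mult_left_mono) auto
    also have "2^k * (1/4)^k = (1/2::real)^k" by (simp add: power_mult_distrib[symmetric])
    finally show ?thesis by (simp add: algebra_simps)
  qed
  have summ: "summable (\<lambda>k. LINT x|edge_measure l. norm (d k x))"
    by (rule summable_comparison_test'[of "\<lambda>k. (\<bar>l\<bar> + 1) * (1/2)^k" 0])
       (use d_norm in \<open>auto intro!: summable_mult summable_geometric\<close>)
  have AE_summ: "AE x in edge_measure l. summable (\<lambda>k. norm (d k x))"
  proof -
    have [measurable]: "d k \<in> borel_measurable (edge_measure l)" for k by (rule L2_measurable[OF d])
    have "(\<integral>\<^sup>+x. (\<Sum>k. ennreal (norm (d k x))) \<partial>edge_measure l) = (\<Sum>k. \<integral>\<^sup>+x. ennreal (norm (d k x)) \<partial>edge_measure l)"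
      by (rule nn_integral_suminf) measurable
    also have "\<dots> = (\<Sum>k. ennreal (LINT x|edge_measure l. norm (d k x)))"
      using L2_integrable[OF d] by (subst nn_integral_eq_integral) auto
    also have "\<dots> \<noteq> \<infinity>"
      unfolding infinity_ennreal_def by (rule ennreal_suminf_neq_top[OF summ]) simp
    finally have "AE x in edge_measure l. (\<Sum>k. ennreal (norm (d k x))) \<noteq> \<infinity>"
      by (intro nn_integral_PInf_AE) auto
    then show ?thesis
      by eventually_elim (auto intro: summable_suminf_not_top)
  qed
  define G where "G x = g (r 0) x + (\<Sum>k. d k x)" for x
  have G_lim: "AE x in edge_measure l. (\<lambda>k. g (r k) x) \<longlonglongrightarrow> G x"
    using AE_summ
  proof eventually_elim
    case (elim x)
    then have "(\<lambda>k. d k x) sums (\<Sum>k. d k x)" by (rule summable_sums[OF summable_norm_cancel])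
    then have "(\<lambda>n. \<Sum>k<n. d k x) \<longlonglongrightarrow> (\<Sum>k. d k x)" by (simp add: sums_def)
    moreover have "(\<Sum>k<n. d k x) = g (r n) x - g (r 0) x" for n
      unfolding d_def by (rule sum_lessThan_telescope)
    ultimately have "(\<lambda>n. g (r n) x - g (r 0) x + g (r 0) x) \<longlonglongrightarrow> (\<Sum>k. d k x) + g (r 0) x"
      by (intro tendsto_intros) simp
    then show ?case by (simp add: G_def add.commute)
  qed
  have G_meas: "G \<in> borel_measurable (edge_measure l)"
    unfolding G_def[abs_def]
    using L2_measurable[OF g] integrable_suminf[OF L2_integrable[OF d] AE_summ summ]
    by (intro borel_measurable_add) auto
  \<comment> \<open>Only the first index runs along the subsequence; \<open>n\<close> is arbitrary,
    so the whole sequence converges and not merely the subsequence.\<close>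
  have Fatou: "(\<integral>\<^sup>+x. ennreal ((cmod (G x - g n x))\<^sup>2) \<partial>edge_measure l) \<le> ennreal \<epsilon>"
    if N: "\<forall>m\<ge>N. \<forall>n\<ge>N. (LINT x|edge_measure l. (cmod (g m x - g n x))\<^sup>2) \<le> \<epsilon>" and n: "n \<ge> N" for n N \<epsilon>
  proof -
    have [measurable]: "g k \<in> borel_measurable (edge_measure l)" for k by (rule L2_measurable[OF g])
    have "(\<integral>\<^sup>+x. ennreal ((cmod (G x - g n x))\<^sup>2) \<partial>edge_measure l) =
        (\<integral>\<^sup>+x. liminf (\<lambda>k. ennreal ((cmod (g (r k) x - g n x))\<^sup>2)) \<partial>edge_measure l)"
    proof (rule nn_integral_cong_AE)
      show "AE x in edge_measure l. ennreal ((cmod (G x - g n x))\<^sup>2) = liminf (\<lambda>k. ennreal ((cmod (g (r k) x - g n x))\<^sup>2))"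
        using G_lim
      proof eventually_elim
        case (elim x)
        then have "(\<lambda>k. ennreal ((cmod (g (r k) x - g n x))\<^sup>2)) \<longlonglongrightarrow> ennreal ((cmod (G x - g n x))\<^sup>2)"
          by (intro tendsto_ennrealI tendsto_power tendsto_norm tendsto_diff tendsto_const)
        from lim_imp_Liminf[OF trivial_limit_sequentially this] show ?case by (rule sym)
      qed
    qed
    also have "\<dots> \<le> liminf (\<lambda>k. \<integral>\<^sup>+x. ennreal ((cmod (g (r k) x - g n x))\<^sup>2) \<partial>edge_measure l)"
      by (rule nn_integral_liminf) measurable
    also have "\<dots> \<le> liminf (\<lambda>k. ennreal \<epsilon>)"
    proof (rule Liminf_mono)
      show "\<forall>\<^sub>F k in sequentially. (\<integral>\<^sup>+x. ennreal ((cmod (g (r k) x - g n x))\<^sup>2) \<partial>edge_measure l) \<le> ennreal \<epsilon>"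
        using eventually_ge_at_top[of N]
      proof eventually_elim
        case (elim k)
        then have "r k \<ge> N" using r_mono by (meson le_trans strict_mono_imp_increasing)
        then have "(LINT x|edge_measure l. (cmod (g (r k) x - g n x))\<^sup>2) \<le> \<epsilon>" using N n by blast
        then show ?case
          using L2_square_integrable[OF L2_diff[OF g g]] by (subst nn_integral_eq_integral) (auto intro: ennreal_leI)
      qed
    qed
    also have "\<dots> = ennreal \<epsilon>" by (simp add: Liminf_const)
    finally show ?thesis .
  qed
  have G_diff: "integrable (edge_measure l) (\<lambda>x. (cmod (G x - g n x))\<^sup>2)
      \<and> (LINT x|edge_measure l. (cmod (G x - g n x))\<^sup>2) \<le> \<epsilon>"
    if N: "\<forall>m\<ge>N. \<forall>n\<ge>N. (LINT x|edge_measure l. (cmod (g m x - g n x))\<^sup>2) \<le> \<epsilon>" and n: "n \<ge> N" and "\<epsilon> > 0" for n N \<epsilon>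
  proof -
    have m: "(\<lambda>x. (cmod (G x - g n x))\<^sup>2) \<in> borel_measurable (edge_measure l)"
      using G_meas L2_measurable[OF g] by measurable
    have "integrable (edge_measure l) (\<lambda>x. (cmod (G x - g n x))\<^sup>2)"
    proof (rule integrableI_bounded[OF m])
      show "(\<integral>\<^sup>+x. ennreal (norm ((cmod (G x - g n x))\<^sup>2)) \<partial>edge_measure l) < \<infinity>"
        using Fatou[OF N n] by (simp add: le_less_trans)
    qed
    then show ?thesis
      using Fatou[OF N n] \<open>\<epsilon> > 0\<close> by (subst (asm) nn_integral_eq_integral) auto
  qed
  have "G \<in> L2 l"
  proof -
    obtain N where N: "\<forall>m\<ge>N. \<forall>n\<ge>N. (LINT x|edge_measure l. (cmod (g m x - g n x))\<^sup>2) \<le> 1"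
      using Cauchy[of 1] by auto
    have "(\<lambda>x. G x - g N x) \<in> L2 l"
      using G_diff[OF N, of N] G_meas L2_measurable[OF g] by (auto simp: L2_def)
    from L2_add[OF this g[of N]] show ?thesis by simp
  qed
  moreover have "(\<lambda>n. LINT x|edge_measure l. (cmod (G x - g n x))\<^sup>2) \<longlonglongrightarrow> 0"
  proof (rule LIMSEQ_I)
    fix \<epsilon> :: real assume "\<epsilon> > 0"
    then obtain N where N: "\<forall>m\<ge>N. \<forall>n\<ge>N. (LINT x|edge_measure l. (cmod (g m x - g n x))\<^sup>2) \<le> \<epsilon>/2"
      using Cauchy[of "\<epsilon>/2"] by auto
    have "norm ((LINT x|edge_measure l. (cmod (G x - g n x))\<^sup>2) - 0) < \<epsilon>" if "n \<ge> N" for n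
      using G_diff[OF N that] \<open>\<epsilon> > 0\<close> by simp
    then show "\<exists>N. \<forall>n\<ge>N. norm ((LINT x|edge_measure l. (cmod (G x - g n x))\<^sup>2) - 0) < \<epsilon>" by blast
  qed
  ultimately show thesis by (rule that)
qed

lemma L2_tendsto_integral_mult:
  assumes "v \<in> L2 l" "\<And>n. h n \<in> L2 l" "(\<lambda>n. LINT x|edge_measure l. (cmod (h n x))\<^sup>2) \<longlonglongrightarrow> 0"
  shows "(\<lambda>n. LINT x|edge_measure l. h n x * v x) \<longlonglongrightarrow> 0"
proof -
  have "(\<lambda>n. (LINT x|edge_measure l. (cmod (h n x))\<^sup>2) * (LINT x|edge_measure l. (cmod (v x))\<^sup>2)) \<longlonglongrightarrow> 0"
    using tendsto_mult_left_zero[OF assms(3)] .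
  then have "(\<lambda>n. (cmod (LINT x|edge_measure l. h n x * v x))\<^sup>2) \<longlonglongrightarrow> 0"
    by (rule tendsto_sandwich[OF _ _ tendsto_const, rotated 2])
       (use L2_Cauchy_Schwarz[OF assms(2,1)] in auto)
  then have "(\<lambda>n. sqrt ((cmod (LINT x|edge_measure l. h n x * v x))\<^sup>2)) \<longlonglongrightarrow> sqrt 0"
    by (rule tendsto_real_sqrt)
  then show ?thesis by (simp add: tendsto_norm_zero_iff)
qed

text \<open>The derivatives have an L^2 limit by completeness, and the identity defining a weak
  derivative is continuous under L^2 convergence of both sides, so that limit is the weak derivative
  of the uniform limit.\<close>

lemma H1_limit:
  assumes u: "\<And>n. continuous_on {0..l} (u n)" "\<And>n. u n \<in> H1_interval l"
    and lim: "uniform_limit {0..l} u v sequentially"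
    and Cauchy: "\<And>\<epsilon>. \<epsilon> > 0 \<Longrightarrow> \<exists>N. \<forall>m\<ge>N. \<forall>n\<ge>N.
      (LINT x|edge_measure l. (cmod (weak_deriv l (u m) x - weak_deriv l (u n) x))\<^sup>2) \<le> \<epsilon>"
  shows "continuous_on {0..l} v" "v \<in> H1_interval l"
    "(\<lambda>n. LINT x|edge_measure l. (cmod (weak_deriv l v x - weak_deriv l (u n) x))\<^sup>2) \<longlonglongrightarrow> 0"
    "(\<lambda>n. LINT x|edge_measure l. (cmod (v x - u n x))\<^sup>2) \<longlonglongrightarrow> 0"
proof -
  show v: "continuous_on {0..l} v"
    by (rule uniform_limit_theorem[OF _ lim]) (use u in auto)
  obtain G where G: "G \<in> L2 l" "(\<lambda>n. LINT x|edge_measure l. (cmod (G x - weak_deriv l (u n) x))\<^sup>2) \<longlonglongrightarrow> 0"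
    by (rule L2_Cauchy_imp_convergent[OF H1_weak_deriv(1)[OF u(2)] Cauchy])
  have diff: "(\<lambda>x. v x - u n x) \<in> L2 l" for n by (intro L2_diff L2_continuous v u)
  show vu: "(\<lambda>n. LINT x|edge_measure l. (cmod (v x - u n x))\<^sup>2) \<longlonglongrightarrow> 0"
  proof (rule LIMSEQ_I)
    fix \<epsilon> :: real assume \<epsilon>: "\<epsilon> > 0"
    \<comment> \<open>Adding 1 to the length makes the final estimate strict.\<close>
    define \<delta> where "\<delta> = sqrt (\<epsilon> / (\<bar>l\<bar> + 1))"
    have \<delta>: "\<delta> > 0" "\<delta>\<^sup>2 * (\<bar>l\<bar> + 1) = \<epsilon>" using \<epsilon> by (simp_all add: \<delta>_def)
    from uniform_limitD[OF lim \<delta>(1)] obtain N where "\<forall>n\<ge>N. \<forall>x\<in>{0..l}. dist (u n x) (v x) < \<delta>"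
      unfolding eventually_sequentially by blast
    then have N: "\<And>n x. n \<ge> N \<Longrightarrow> x \<in> {0..l} \<Longrightarrow> dist (u n x) (v x) < \<delta>" by blast
    have "norm ((LINT x|edge_measure l. (cmod (v x - u n x))\<^sup>2) - 0) < \<epsilon>" if n: "n \<ge> N" for n
    proof -
      have "(LINT x|edge_measure l. (cmod (v x - u n x))\<^sup>2) \<le> (LINT x|edge_measure l. \<delta>\<^sup>2)"
      proof (rule integral_mono)
        show "integrable (edge_measure l) (\<lambda>x. (cmod (v x - u n x))\<^sup>2)"
          by (rule L2_square_integrable[OF diff])
        show "integrable (edge_measure l) (\<lambda>x. \<delta>\<^sup>2)" by (intro finite_measure.integrable_const finite_edge_measure)
        fix x assume "x \<in> space (edge_measure l)"
        then have "cmod (v x - u n x) \<le> \<delta>" using N[OF n, of x] by (simp add: dist_norm norm_minus_commute)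
        then show "(cmod (v x - u n x))\<^sup>2 \<le> \<delta>\<^sup>2" by (simp add: power_mono)
      qed
      also have "\<dots> \<le> \<delta>\<^sup>2 * \<bar>l\<bar>"
        using mult_left_mono[OF measure_edge_measure[of l], of "\<delta>\<^sup>2"] by (simp add: mult.commute)
      also have "\<dots> < \<epsilon>" using \<delta> by (simp add: distrib_left flip: \<delta>(2))
      finally show ?thesis by simp
    qed
    then show "\<exists>N. \<forall>n\<ge>N. norm ((LINT x|edge_measure l. (cmod (v x - u n x))\<^sup>2) - 0) < \<epsilon>" by blast
  qed
  have "is_weak_deriv l v G"
    unfolding is_weak_deriv_def
  proof (intro allI impI)
    fix \<phi> assume t: "test_fun l \<phi>"
    have c: "(\<lambda>x. complex_of_real (deriv \<phi> x)) \<in> L2 l" "(\<lambda>x. complex_of_real (\<phi> x)) \<in> L2 l"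
      by (intro L2_continuous continuous_intros test_fun_facts[OF t])+
    have 1: "(\<lambda>n. LINT x|edge_measure l. (v x - u n x) * complex_of_real (deriv \<phi> x)) \<longlonglongrightarrow> 0"
      by (rule L2_tendsto_integral_mult[OF c(1) diff vu])
    have 2: "(\<lambda>n. LINT x|edge_measure l. (G x - weak_deriv l (u n) x) * complex_of_real (\<phi> x)) \<longlonglongrightarrow> 0"
      by (rule L2_tendsto_integral_mult[OF c(2) _ G(2)]) (intro L2_diff G H1_weak_deriv u)
    have split: "(LINT x|edge_measure l. (a x - b x) * p x) = (LINT x|edge_measure l. a x * p x) - (LINT x|edge_measure l. b x * p x)"
      if "a \<in> L2 l" "b \<in> L2 l" "p \<in> L2 l" for a b p
      unfolding left_diff_distrib by (rule Bochner_Integration.integral_diff; rule L2_mult_integrable) (use that in auto)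
    have "(LINT x|edge_measure l. (v x - u n x) * complex_of_real (deriv \<phi> x)) +
       (LINT x|edge_measure l. (G x - weak_deriv l (u n) x) * complex_of_real (\<phi> x)) =
       (LINT x|edge_measure l. v x * complex_of_real (deriv \<phi> x)) + (LINT x|edge_measure l. G x * complex_of_real (\<phi> x))" for n
      using H1_weak_deriv[OF u(2), of n] t
      by (simp add: split c G L2_continuous u v is_weak_deriv_def)
    with tendsto_add[OF 1 2] have "(LINT x|edge_measure l. v x * complex_of_real (deriv \<phi> x)) + (LINT x|edge_measure l. G x * complex_of_real (\<phi> x)) = 0"
      by (simp add: LIMSEQ_const_iff)
    then show "(LINT x|edge_measure l. v x * complex_of_real (deriv \<phi> x)) = - (LINT x|edge_measure l. G x * complex_of_real (\<phi> x))"
      by (simp add: add_eq_0_iff2)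
  qed
  note weak = this
  show H1: "v \<in> H1_interval l" by (rule H1_intervalI(1)[OF v G(1) weak])
  have AE: "AE x in edge_measure l. weak_deriv l v x = G x" by (rule H1_intervalI(2)[OF v G(1) weak])
  have "(LINT x|edge_measure l. (cmod (weak_deriv l v x - weak_deriv l (u n) x))\<^sup>2) =
    (LINT x|edge_measure l. (cmod (G x - weak_deriv l (u n) x))\<^sup>2)" for n
    by (rule integral_cong_AE)
       (use AE L2_measurable[OF H1_weak_deriv(1)[OF H1]] L2_measurable[OF H1_weak_deriv(1)[OF u(2), of n]] L2_measurable[OF G(1)] in auto)
  then show "(\<lambda>n. LINT x|edge_measure l. (cmod (weak_deriv l v x - weak_deriv l (u n) x))\<^sup>2) \<longlonglongrightarrow> 0"
    using G(2) by simp
qed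

section \<open>The form on the graph\<close>

lemma L2_cnj: "u \<in> L2 l \<Longrightarrow> (\<lambda>x. cnj (u x)) \<in> L2 l"
  unfolding L2_def
  by (auto intro: measurable_compose[OF _ borel_measurable_continuous_onI[OF continuous_on_cnj[OF continuous_on_id]]])

text \<open>The assumption excludes an isolated vertex, at which every number would satisfy the
  description in \<open>vertex_value\<close>.\<close>

locale covered_metric_graph = metric_graph +
  assumes incident: "v \<in> verts G \<Longrightarrow> \<exists>e\<in>arcs G. tail G e = v \<or> head G e = v"
begin

definition lincomb :: "complex \<Rightarrow> 'b graph_fun \<Rightarrow> complex \<Rightarrow> 'b graph_fun \<Rightarrow> 'b graph_fun" where
  "lincomb a f b g = (\<lambda>e x. a * f e x + b * g e x)"

definition energy :: "'b graph_fun \<Rightarrow> real" where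
  "energy f = (\<Sum>e\<in>arcs G. LINT x|edge_measure (len e). (cmod (weak_deriv (len e) (f e) x))\<^sup>2)"

definition mass :: "'b graph_fun \<Rightarrow> real" where
  "mass f = (\<Sum>e\<in>arcs G. LINT x|edge_measure (len e). (cmod (f e x))\<^sup>2)"

abbreviation "H1 \<equiv> H1_graph G len"
abbreviation "vval \<equiv> vertex_value G len"
abbreviation "form \<equiv> schroedinger_form G len"

section \<open>Membership in H^1 of the graph and vertex values\<close>

lemma H1D:
  assumes "f \<in> H1" "e \<in> arcs G"
  shows "continuous_on {0..len e} (f e)" "f e \<in> H1_interval (len e)"
    "weak_deriv (len e) (f e) \<in> L2 (len e)" "is_weak_deriv (len e) (f e) (weak_deriv (len e) (f e))"
    "f e \<in> L2 (len e)"
proof -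
  show *: "continuous_on {0..len e} (f e)" "f e \<in> H1_interval (len e)"
    using assms by (auto simp: H1_graph_def C_graph_def)
  then show "weak_deriv (len e) (f e) \<in> L2 (len e)" "is_weak_deriv (len e) (f e) (weak_deriv (len e) (f e))"
    "f e \<in> L2 (len e)"
    by (auto intro: H1_weak_deriv L2_continuous)
qed

lemma energy_nonneg: "0 \<le> energy f" and mass_nonneg: "0 \<le> mass f"
  by (auto simp: energy_def mass_def intro: sum_nonneg)

lemma vertex_value_eqI:
  assumes "v \<in> verts G"
    and "\<And>e. e \<in> arcs G \<Longrightarrow> tail G e = v \<Longrightarrow> f e 0 = c" "\<And>e. e \<in> arcs G \<Longrightarrow> head G e = v \<Longrightarrow> f e (len e) = c"
  shows "vval f v = c"
  unfolding vertex_value_def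
proof (rule the_equality)
  show "\<forall>e\<in>arcs G. (tail G e = v \<longrightarrow> f e 0 = c) \<and> (head G e = v \<longrightarrow> f e (len e) = c)"
    using assms by auto
  fix c' assume "\<forall>e\<in>arcs G. (tail G e = v \<longrightarrow> f e 0 = c') \<and> (head G e = v \<longrightarrow> f e (len e) = c')"
  then show "c' = c" using incident[OF assms(1)] assms(2,3) by metis
qed

lemma vertex_value:
  assumes "f \<in> H1" "e \<in> arcs G"
  shows "f e 0 = vval f (tail G e)" "f e (len e) = vval f (head G e)"
proof -
  obtain F where F: "\<forall>e\<in>arcs G. f e 0 = F (tail G e) \<and> f e (len e) = F (head G e)"
    using assms by (auto simp: H1_graph_def C_graph_def)
  have "vval f v = F v" if "v \<in> verts G" for v
    using that F by (intro vertex_value_eqI) auto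
  then show "f e 0 = vval f (tail G e)" "f e (len e) = vval f (head G e)"
    using F assms(2) by auto
qed

lemma H1I:
  assumes "\<And>e. e \<in> arcs G \<Longrightarrow> continuous_on {0..len e} (f e)"
    "\<And>e. e \<in> arcs G \<Longrightarrow> f e \<in> H1_interval (len e)"
    "\<And>e. e \<in> arcs G \<Longrightarrow> f e 0 = F (tail G e)" "\<And>e. e \<in> arcs G \<Longrightarrow> f e (len e) = F (head G e)"
    "\<And>e x. e \<notin> arcs G \<or> x \<notin> {0..len e} \<Longrightarrow> f e x = 0"
  shows "f \<in> H1" "v \<in> verts G \<Longrightarrow> vval f v = F v"
proof -
  have "\<exists>F. \<forall>e\<in>arcs G. f e 0 = F (tail G e) \<and> f e (len e) = F (head G e)"
    using assms(3,4) by blast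
  then show "f \<in> H1" using assms(1,2,5) unfolding H1_graph_def C_graph_def by blast
  show "vval f v = F v" if "v \<in> verts G" using that assms(3,4) by (intro vertex_value_eqI) auto
qed

lemma H1_lincomb:
  assumes "f \<in> H1" "g \<in> H1"
  shows "lincomb a f b g \<in> H1"
    "v \<in> verts G \<Longrightarrow> vval (lincomb a f b g) v = a * vval f v + b * vval g v"
    "e \<in> arcs G \<Longrightarrow> AE x in edge_measure (len e). weak_deriv (len e) (lincomb a f b g e) x =
       a * weak_deriv (len e) (f e) x + b * weak_deriv (len e) (g e) x"
proof -
  have *: "continuous_on {0..len e} (lincomb a f b g e)" "lincomb a f b g e \<in> H1_interval (len e)"
     "AE x in edge_measure (len e). weak_deriv (len e) (lincomb a f b g e) x =
       a * weak_deriv (len e) (f e) x + b * weak_deriv (len e) (g e) x" if "e \<in> arcs G" for e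
    using H1D[OF assms(1) that] H1D[OF assms(2) that] H1_interval_lincomb
    by (auto simp: lincomb_def intro!: continuous_intros)
  have **: "lincomb a f b g e x = 0" if "e \<notin> arcs G \<or> x \<notin> {0..len e}" for e x
  proof -
    have "f e x = 0" "g e x = 0" using assms that unfolding H1_graph_def C_graph_def by blast+
    then show ?thesis by (simp add: lincomb_def)
  qed
  show "lincomb a f b g \<in> H1"
    "v \<in> verts G \<Longrightarrow> vval (lincomb a f b g) v = a * vval f v + b * vval g v"
    using H1I[of "lincomb a f b g" "\<lambda>v. a * vval f v + b * vval g v", OF *(1,2) _ _ **]
    by (auto simp: lincomb_def vertex_value[OF assms(1)] vertex_value[OF assms(2)])
  show "e \<in> arcs G \<Longrightarrow> AE x in edge_measure (len e). weak_deriv (len e) (lincomb a f b g e) x =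
       a * weak_deriv (len e) (f e) x + b * weak_deriv (len e) (g e) x" by (rule *(3))
qed

section \<open>Sesquilinearity of the form and its eigenspaces\<close>

definition bounded_potential :: "('b \<Rightarrow> real \<Rightarrow> real) \<Rightarrow> bool" where
  "bounded_potential q \<longleftrightarrow> (\<forall>e\<in>arcs G. q e \<in> Linfty (len e))"

lemma bounded_potential_mult_L2:
  assumes "bounded_potential q" "e \<in> arcs G" "u \<in> L2 (len e)"
  shows "(\<lambda>x. complex_of_real (q e x) * u x) \<in> L2 (len e)"
proof -
  obtain C where "q e \<in> borel_measurable (edge_measure (len e))" "AE x in edge_measure (len e). \<bar>q e x\<bar> \<le> C"
    using assms by (auto simp: bounded_potential_def Linfty_def)
  then show ?thesis
    by (intro L2_bounded_mult[where C=C] assms(3)) auto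
qed

lemma bounded_potential_shift:
  assumes "bounded_potential q" shows "bounded_potential (\<lambda>e x. q e x - \<mu>)"
  unfolding bounded_potential_def
proof
  fix e assume "e \<in> arcs G"
  then obtain C where C: "q e \<in> borel_measurable (edge_measure (len e))" "AE x in edge_measure (len e). \<bar>q e x\<bar> \<le> C"
    using assms by (auto simp: bounded_potential_def Linfty_def)
  have "AE x in edge_measure (len e). \<bar>q e x - \<mu>\<bar> \<le> C + \<bar>\<mu>\<bar>"
    using C(2) by eventually_elim linarith
  with C(1) show "(\<lambda>x. q e x - \<mu>) \<in> Linfty (len e)" by (auto simp: Linfty_def)
qed

lemma form_lincomb:
  assumes q: "bounded_potential q" and f: "f \<in> H1" and g: "g \<in> H1" and h: "h \<in> H1"
  shows "form q \<sigma> (lincomb a f b g) h = a * form q \<sigma> f h + b * form q \<sigma> g h"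
proof -
  have 1: "(LINT x|edge_measure (len e). weak_deriv (len e) (lincomb a f b g e) x * cnj (weak_deriv (len e) (h e) x)) =
      a * (LINT x|edge_measure (len e). weak_deriv (len e) (f e) x * cnj (weak_deriv (len e) (h e) x)) +
      b * (LINT x|edge_measure (len e). weak_deriv (len e) (g e) x * cnj (weak_deriv (len e) (h e) x))"
    if e: "e \<in> arcs G" for e
  proof -
    note m = H1D(3)[OF f e] H1D(3)[OF g e] H1D(3)[OF H1_lincomb(1)[OF f g, of a b] e] L2_cnj[OF H1D(3)[OF h e]]
    note [measurable] = m[THEN L2_measurable]
    have "(LINT x|edge_measure (len e). weak_deriv (len e) (lincomb a f b g e) x * cnj (weak_deriv (len e) (h e) x)) =
      (LINT x|edge_measure (len e). a * (weak_deriv (len e) (f e) x * cnj (weak_deriv (len e) (h e) x)) +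
         b * (weak_deriv (len e) (g e) x * cnj (weak_deriv (len e) (h e) x)))"
    proof (rule integral_cong_AE)
      show "AE x in edge_measure (len e). weak_deriv (len e) (lincomb a f b g e) x * cnj (weak_deriv (len e) (h e) x) =
         a * (weak_deriv (len e) (f e) x * cnj (weak_deriv (len e) (h e) x)) +
         b * (weak_deriv (len e) (g e) x * cnj (weak_deriv (len e) (h e) x))"
        using H1_lincomb(3)[OF f g e, of a b] by eventually_elim (simp add: algebra_simps)
    qed measurable
    also have "\<dots> = a * (LINT x|edge_measure (len e). weak_deriv (len e) (f e) x * cnj (weak_deriv (len e) (h e) x)) +
      b * (LINT x|edge_measure (len e). weak_deriv (len e) (g e) x * cnj (weak_deriv (len e) (h e) x))"
      by (subst Bochner_Integration.integral_add[OF integrable_mult_right[OF L2_mult_integrable[OF m(1,4)]]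
           integrable_mult_right[OF L2_mult_integrable[OF m(2,4)]]]) simp
    finally show ?thesis .
  qed
  have 2: "(LINT x|edge_measure (len e). complex_of_real (q e x) * lincomb a f b g e x * cnj (h e x)) =
     a * (LINT x|edge_measure (len e). complex_of_real (q e x) * f e x * cnj (h e x)) +
     b * (LINT x|edge_measure (len e). complex_of_real (q e x) * g e x * cnj (h e x))" if e: "e \<in> arcs G" for e
  proof -
    note m = bounded_potential_mult_L2[OF q e H1D(5)[OF f e]] bounded_potential_mult_L2[OF q e H1D(5)[OF g e]]
      L2_cnj[OF H1D(5)[OF h e]]
    have "(LINT x|edge_measure (len e). complex_of_real (q e x) * lincomb a f b g e x * cnj (h e x)) =
      (LINT x|edge_measure (len e). a * (complex_of_real (q e x) * f e x * cnj (h e x)) +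
       b * (complex_of_real (q e x) * g e x * cnj (h e x)))"
      by (simp add: lincomb_def algebra_simps)
    also have "\<dots> = a * (LINT x|edge_measure (len e). complex_of_real (q e x) * f e x * cnj (h e x)) +
     b * (LINT x|edge_measure (len e). complex_of_real (q e x) * g e x * cnj (h e x))"
      by (subst Bochner_Integration.integral_add[OF integrable_mult_right[OF L2_mult_integrable[OF m(1,3)]]
           integrable_mult_right[OF L2_mult_integrable[OF m(2,3)]]]) simp
    finally show ?thesis .
  qed
  have 3: "(\<Sum>v\<in>verts G. complex_of_real (\<sigma> v) * vval (lincomb a f b g) v * cnj (vval h v)) =
     (\<Sum>v\<in>verts G. a * (complex_of_real (\<sigma> v) * vval f v * cnj (vval h v)) +
        b * (complex_of_real (\<sigma> v) * vval g v * cnj (vval h v)))"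
    by (rule sum.cong) (auto simp: H1_lincomb(2)[OF f g] algebra_simps)
  show ?thesis
    unfolding schroedinger_form_def 3
    by (simp add: 1 2 sum.distrib sum_distrib_left[symmetric] distrib_left)
qed

lemma form_hermitian: "form q \<sigma> g f = cnj (form q \<sigma> f g)"
proof -
  have 1: "cnj (LINT x|edge_measure (len e). weak_deriv (len e) (f e) x * cnj (weak_deriv (len e) (g e) x)) =
     (LINT x|edge_measure (len e). weak_deriv (len e) (g e) x * cnj (weak_deriv (len e) (f e) x))" for e
    by (subst Bochner_Integration.integral_cnj[symmetric]) (simp add: mult.commute)
  have 2: "cnj (LINT x|edge_measure (len e). complex_of_real (q e x) * f e x * cnj (g e x)) =
     (LINT x|edge_measure (len e). complex_of_real (q e x) * g e x * cnj (f e x))" for e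
    by (subst Bochner_Integration.integral_cnj[symmetric]) (simp add: mult_ac)
  show ?thesis
    unfolding schroedinger_form_def complex_cnj_add cnj_sum 1 2 by (simp add: mult_ac)
qed

lemma form_lincomb_right:
  assumes "bounded_potential q" "f \<in> H1" "g \<in> H1" "h \<in> H1"
  shows "form q \<sigma> h (lincomb a f b g) = cnj a * form q \<sigma> h f + cnj b * form q \<sigma> h g"
proof -
  have "form q \<sigma> h (lincomb a f b g) = cnj (form q \<sigma> (lincomb a f b g) h)"
    by (rule form_hermitian)
  also have "\<dots> = cnj a * cnj (form q \<sigma> f h) + cnj b * cnj (form q \<sigma> g h)"
    by (simp add: form_lincomb[OF assms])
  finally show ?thesis by (simp only: form_hermitian[symmetric])
qed

lemma form_shift:
  assumes q: "bounded_potential q" and f: "f \<in> H1" and g: "g \<in> H1"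
  shows "form (\<lambda>e x. q e x - \<mu>) \<sigma> f g = form q \<sigma> f g - complex_of_real \<mu> * L2_inner G len f g"
proof -
  have "(LINT x|edge_measure (len e). complex_of_real (q e x - \<mu>) * f e x * cnj (g e x)) =
     (LINT x|edge_measure (len e). complex_of_real (q e x) * f e x * cnj (g e x)) -
     complex_of_real \<mu> * (LINT x|edge_measure (len e). f e x * cnj (g e x))" if e: "e \<in> arcs G" for e
  proof -
    note m = bounded_potential_mult_L2[OF q e H1D(5)[OF f e]] H1D(5)[OF f e] L2_cnj[OF H1D(5)[OF g e]]
    have "(LINT x|edge_measure (len e). complex_of_real (q e x - \<mu>) * f e x * cnj (g e x)) =
      (LINT x|edge_measure (len e). complex_of_real (q e x) * f e x * cnj (g e x) - complex_of_real \<mu> * (f e x * cnj (g e x)))"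
      by (simp add: algebra_simps)
    then show ?thesis
      using Bochner_Integration.integral_diff[OF L2_mult_integrable[OF m(1,3)]
          integrable_mult_right[OF L2_mult_integrable[OF m(2,3)], of "complex_of_real \<mu>"]] by simp
  qed
  then show ?thesis
    unfolding schroedinger_form_def L2_inner_def by (simp add: sum_subtractf sum_distrib_left)
qed

text \<open>Moving \<mu> into the potential turns eigenfunctions into the kernel of a form, which is
  how a minimiser presents itself later.\<close>

lemma eigenspace_iff:
  assumes q: "bounded_potential q"
  shows "f \<in> eigenspace G len q \<sigma> \<mu> \<longleftrightarrow> f \<in> H1 \<and> (\<forall>\<phi>\<in>H1. form (\<lambda>e x. q e x - \<mu>) \<sigma> f \<phi> = 0)"
proof -
  have "gscale (complex_of_real \<mu>) f \<in> L2_graph G len" if "f \<in> H1"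
    using that H1D(5) by (auto simp: L2_graph_def gscale_def intro: L2_scale)
  moreover have "L2_inner G len (gscale (complex_of_real \<mu>) f) \<phi> = complex_of_real \<mu> * L2_inner G len f \<phi>" for \<phi>
    by (simp add: L2_inner_def gscale_def sum_distrib_left mult.assoc)
  ultimately show ?thesis
    unfolding eigenspace_def schroedinger_op_def by (auto simp: form_shift[OF q])
qed

section \<open>The quadratic form and its control by energy and mass\<close>

definition qform :: "('b \<Rightarrow> real \<Rightarrow> real) \<Rightarrow> ('a \<Rightarrow> real) \<Rightarrow> 'b graph_fun \<Rightarrow> real" where
  "qform q \<sigma> f = Re (form q \<sigma> f f)"

lemma form_self: "form q \<sigma> f f = complex_of_real (qform q \<sigma> f)"
  using form_hermitian[of q \<sigma> f f] by (simp add: qform_def complex_eq_iff)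

lemma qform_lincomb:
  assumes q: "bounded_potential q" and f: "f \<in> H1" and g: "g \<in> H1"
  shows "qform q \<sigma> (lincomb a f b g) =
    (cmod a)\<^sup>2 * qform q \<sigma> f + (cmod b)\<^sup>2 * qform q \<sigma> g + 2 * Re (a * cnj b * form q \<sigma> f g)"
proof -
  have "form q \<sigma> (lincomb a f b g) (lincomb a f b g) =
    a * cnj a * form q \<sigma> f f + b * cnj b * form q \<sigma> g g + (a * cnj b * form q \<sigma> f g + cnj (a * cnj b * form q \<sigma> f g))"
    using form_hermitian[of q \<sigma> g f]
    by (simp add: form_lincomb[OF q f g H1_lincomb(1)[OF f g]] form_lincomb_right[OF q f g] f g algebra_simps)
  also have "a * cnj a = complex_of_real ((cmod a)\<^sup>2)" by (rule complex_norm_square[symmetric])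
  also have "b * cnj b = complex_of_real ((cmod b)\<^sup>2)" by (rule complex_norm_square[symmetric])
  finally have "Re (form q \<sigma> (lincomb a f b g) (lincomb a f b g)) =
    Re (complex_of_real ((cmod a)\<^sup>2) * form q \<sigma> f f + complex_of_real ((cmod b)\<^sup>2) * form q \<sigma> g g +
      (a * cnj b * form q \<sigma> f g + cnj (a * cnj b * form q \<sigma> f g)))" by (rule arg_cong)
  then show ?thesis
    unfolding form_self complex_add_cnj of_real_mult[symmetric] of_real_add[symmetric] Re_complex_of_real .
qed

text \<open>From the parallelogram identity, one of the two summands is discarded by
  nonnegativity.\<close>

lemma qform_parallelogram:
  assumes q: "bounded_potential q" and nonneg: "\<And>h. h \<in> H1 \<Longrightarrow> 0 \<le> qform q \<sigma> h"
    and f: "f \<in> H1" and g: "g \<in> H1"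
  shows "qform q \<sigma> (lincomb 1 f 1 g) \<le> 2 * qform q \<sigma> f + 2 * qform q \<sigma> g"
    "qform q \<sigma> (lincomb 1 f (-1) g) \<le> 2 * qform q \<sigma> f + 2 * qform q \<sigma> g"
  using nonneg[OF H1_lincomb(1)[OF f g, of 1 "-1"]] nonneg[OF H1_lincomb(1)[OF f g, of 1 1]]
  by (simp_all add: qform_lincomb[OF q f g])

text \<open>Moving from \<open>g\<close> in a multiple of the direction \<open>f\<close> costs
  nothing to second order, so a nonzero pairing would give an unbounded linear decrease and violate
  nonnegativity.\<close>

lemma qform_zero_imp_kernel:
  assumes q: "bounded_potential q" and nonneg: "\<And>h. h \<in> H1 \<Longrightarrow> 0 \<le> qform q \<sigma> h"
    and f: "f \<in> H1" "qform q \<sigma> f \<le> 0" and g: "g \<in> H1"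
  shows "form q \<sigma> f g = 0"
proof (rule ccontr)
  define z where "z = form q \<sigma> f g"
  assume "form q \<sigma> f g \<noteq> 0"
  then have z: "(cmod z)\<^sup>2 > 0" by (simp add: z_def)
  \<comment> \<open>Chosen so that the value qform g - 2 t |z|^2 reached below is exactly
    -1.\<close>
  define t where "t = (qform q \<sigma> g + 1) / (2 * (cmod z)\<^sup>2)"
  have zz: "cnj z * z = complex_of_real ((cmod z)\<^sup>2)"
    by (simp only: mult.commute[of "cnj z"] complex_norm_square)
  have "0 \<le> qform q \<sigma> (lincomb (- complex_of_real t * cnj z) f 1 g)"
    by (intro nonneg H1_lincomb f g)
  also have "\<dots> = (cmod (- complex_of_real t * cnj z))\<^sup>2 * qform q \<sigma> f + qform q \<sigma> g + 2 * Re (- complex_of_real t * (cnj z * z))"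
    by (simp add: qform_lincomb[OF q f(1) g] z_def mult.assoc)
  also have "\<dots> \<le> qform q \<sigma> g - 2 * (t * (cmod z)\<^sup>2)"
    using f(2) unfolding zz by (simp add: mult_nonneg_nonpos del: of_real_power)
  also have "t * (cmod z)\<^sup>2 = (qform q \<sigma> g + 1) / 2" using z by (simp add: t_def)
  finally show False by (simp add: field_simps)
qed

lemma qform_eq:
  assumes q: "bounded_potential q" and f: "f \<in> H1"
  shows "qform q \<sigma> f = energy f + (\<Sum>e\<in>arcs G. LINT x|edge_measure (len e). q e x * (cmod (f e x))\<^sup>2)
     + (\<Sum>v\<in>verts G. \<sigma> v * (cmod (vval f v))\<^sup>2)"
proof -
  have sq: "a * cnj a = complex_of_real ((cmod a)\<^sup>2)" for a by (rule complex_norm_square[symmetric])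
  have "form q \<sigma> f f = complex_of_real (energy f + (\<Sum>e\<in>arcs G. LINT x|edge_measure (len e). q e x * (cmod (f e x))\<^sup>2)
     + (\<Sum>v\<in>verts G. \<sigma> v * (cmod (vval f v))\<^sup>2))"
    unfolding schroedinger_form_def energy_def mult.assoc sq of_real_mult[symmetric] of_real_sum of_real_add integral_complex_of_real
    by simp
  then show ?thesis by (simp add: qform_def)
qed

lemma min_length:
  obtains \<delta> where "\<delta> > 0" "\<And>e. e \<in> arcs G \<Longrightarrow> \<delta> \<le> len e"
proof
  \<comment> \<open>Inserting 1 keeps the set nonempty even for an empty arc set.\<close>
  show "Min (insert 1 (len ` arcs G)) > 0" using len_pos by (subst Min_gr_iff) auto
  show "\<And>e. e \<in> arcs G \<Longrightarrow> Min (insert 1 (len ` arcs G)) \<le> len e" by (intro Min_le) auto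
qed

lemma H1_sup_bound:
  assumes f: "f \<in> H1" and \<delta>: "\<delta> > 0" "\<And>e. e \<in> arcs G \<Longrightarrow> \<delta> \<le> len e"
    and x: "e \<in> arcs G" "x \<in> {0..len e}"
  shows "(cmod (f e x))\<^sup>2 \<le> 2 / \<delta> * mass f + 2 * \<delta> * energy f"
proof -
  have "(cmod (f e x))\<^sup>2 \<le> 2 / \<delta> * (LINT t|edge_measure (len e). (cmod (f e t))\<^sup>2)
     + 2 * \<delta> * (LINT t|edge_measure (len e). (cmod (weak_deriv (len e) (f e) t))\<^sup>2)"
    using H1D[OF f x(1)] \<delta> x by (intro H1_pointwise_bound) auto
  also have "\<dots> \<le> 2 / \<delta> * mass f + 2 * \<delta> * energy f"
    unfolding mass_def energy_def using \<delta>(1) x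
    by (intro add_mono mult_left_mono member_le_sum) auto
  finally show ?thesis .
qed

lemma H1_vertex_bound:
  assumes f: "f \<in> H1" and \<delta>: "\<delta> > 0" "\<And>e. e \<in> arcs G \<Longrightarrow> \<delta> \<le> len e" and v: "v \<in> verts G"
  shows "(cmod (vval f v))\<^sup>2 \<le> 2 / \<delta> * mass f + 2 * \<delta> * energy f"
proof -
  obtain e where e: "e \<in> arcs G" "tail G e = v \<or> head G e = v" using incident[OF v] by auto
  then show ?thesis
    using H1_sup_bound[OF f \<delta> e(1), of 0] H1_sup_bound[OF f \<delta> e(1), of "len e"] len_pos[OF e(1)]
      vertex_value[OF f e(1)] by auto
qed

text \<open>Coercivity up to mass. The potential is controlled by the mass alone; the vertex terms
  need the pointwise bound, where a short window lets half of the energy absorb them.\<close>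

lemma qform_bounds:
  assumes q: "bounded_potential q"
  obtains C where "C \<ge> 0" "\<And>f. f \<in> H1 \<Longrightarrow> energy f / 2 - C * mass f \<le> qform q \<sigma> f"
    "\<And>f. f \<in> H1 \<Longrightarrow> qform q \<sigma> f \<le> C * (energy f + mass f)"
proof -
  have "\<exists>C. \<forall>e\<in>arcs G. AE x in edge_measure (len e). \<bar>q e x\<bar> \<le> C e"
    using q by (intro bchoice) (auto simp: bounded_potential_def Linfty_def)
  then obtain c where c: "\<And>e. e \<in> arcs G \<Longrightarrow> AE x in edge_measure (len e). \<bar>q e x\<bar> \<le> c e" by auto
  define A where "A = (\<Sum>e\<in>arcs G. \<bar>c e\<bar>)"
  have A: "A \<ge> 0" by (simp add: A_def sum_nonneg)
  have cA: "AE x in edge_measure (len e). \<bar>q e x\<bar> \<le> A" if e: "e \<in> arcs G" for e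
  proof -
    have "\<bar>c e\<bar> \<le> A" unfolding A_def using e by (intro member_le_sum) auto
    with c[OF e] show ?thesis by (auto elim: eventually_mono)
  qed
  define S where "S = (\<Sum>v\<in>verts G. \<bar>\<sigma> v\<bar>)"
  have S: "S \<ge> 0" by (simp add: S_def sum_nonneg)
  obtain \<delta>0 where \<delta>0: "\<delta>0 > 0" "\<And>e. e \<in> arcs G \<Longrightarrow> \<delta>0 \<le> len e" by (rule min_length) blast
  \<comment> \<open>The second entry makes the total energy coefficient of the vertex terms, 2
    \<delta> S, at most 1/2; S + 1 avoids division by zero.\<close>
  define \<delta> where "\<delta> = min \<delta>0 (1 / (4 * (S + 1)))"
  have \<delta>: "\<delta> > 0" "\<And>e. e \<in> arcs G \<Longrightarrow> \<delta> \<le> len e" using \<delta>0 S by (auto simp: \<delta>_def min_le_iff_disj)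
  have \<delta>S: "S * (2 * \<delta>) \<le> 1/2"
  proof -
    have "(S + 1) * \<delta> \<le> (S + 1) * (1 / (4 * (S + 1)))"
      using S by (intro mult_left_mono) (auto simp: \<delta>_def)
    also have "\<dots> = 1/4" using S by simp
    finally show ?thesis using \<delta>(1) by (simp add: algebra_simps)
  qed
  have qb: "\<bar>\<Sum>e\<in>arcs G. LINT x|edge_measure (len e). q e x * (cmod (f e x))\<^sup>2\<bar> \<le> A * mass f" if f: "f \<in> H1" for f
  proof -
    have "\<bar>LINT x|edge_measure (len e). q e x * (cmod (f e x))\<^sup>2\<bar> \<le> A * (LINT x|edge_measure (len e). (cmod (f e x))\<^sup>2)"
      if e: "e \<in> arcs G" for e
    proof -
      have "norm (LINT x|edge_measure (len e). q e x * (cmod (f e x))\<^sup>2) \<le> (LINT x|edge_measure (len e). norm (q e x * (cmod (f e x))\<^sup>2))"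
        by (rule integral_norm_bound)
      also have "\<dots> \<le> (LINT x|edge_measure (len e). A * (cmod (f e x))\<^sup>2)"
      proof (rule integral_mono_AE')
        show "integrable (edge_measure (len e)) (\<lambda>x. A * (cmod (f e x))\<^sup>2)"
          by (intro integrable_mult_right L2_square_integrable H1D(5)[OF f e])
        show "AE x in edge_measure (len e). norm (q e x * (cmod (f e x))\<^sup>2) \<le> A * (cmod (f e x))\<^sup>2"
          using cA[OF e] by eventually_elim (simp add: abs_mult mult_right_mono)
      qed (use A in auto)
      finally show ?thesis by simp
    qed
    then have "(\<Sum>e\<in>arcs G. \<bar>LINT x|edge_measure (len e). q e x * (cmod (f e x))\<^sup>2\<bar>) \<le> A * mass f"
      unfolding mass_def sum_distrib_left by (rule sum_mono)
    then show ?thesis by (rule order_trans[OF sum_abs])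
  qed
  have vb: "\<bar>\<Sum>v\<in>verts G. \<sigma> v * (cmod (vval f v))\<^sup>2\<bar> \<le> S * (2 / \<delta>) * mass f + energy f / 2" if f: "f \<in> H1" for f
  proof -
    have "\<bar>\<Sum>v\<in>verts G. \<sigma> v * (cmod (vval f v))\<^sup>2\<bar> \<le> (\<Sum>v\<in>verts G. \<bar>\<sigma> v * (cmod (vval f v))\<^sup>2\<bar>)"
      by (rule sum_abs)
    also have "\<dots> \<le> (\<Sum>v\<in>verts G. \<bar>\<sigma> v\<bar> * (2 / \<delta> * mass f + 2 * \<delta> * energy f))"
    proof (rule sum_mono)
      fix v assume "v \<in> verts G"
      from mult_left_mono[OF H1_vertex_bound[OF f \<delta> this], of "\<bar>\<sigma> v\<bar>"]
      show "\<bar>\<sigma> v * (cmod (vval f v))\<^sup>2\<bar> \<le> \<bar>\<sigma> v\<bar> * (2 / \<delta> * mass f + 2 * \<delta> * energy f)"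
        by (simp add: abs_mult)
    qed
    also have "\<dots> = S * (2 / \<delta> * mass f + 2 * \<delta> * energy f)"
      by (simp only: S_def sum_distrib_right)
    also have "\<dots> = S * (2 / \<delta>) * mass f + S * (2 * \<delta>) * energy f"
      by (simp add: algebra_simps)
    also have "S * (2 * \<delta>) * energy f \<le> 1/2 * energy f"
      by (rule mult_right_mono[OF \<delta>S energy_nonneg])
    finally show ?thesis by simp
  qed
  \<comment> \<open>The summand 2 serves the upper bound, in which the energy occurs with the factor
    3/2.\<close>
  define C where "C = A + S * (2 / \<delta>) + 2"
  have "0 \<le> S * (2 / \<delta>)" using S \<delta> by simp
  then have C: "C \<ge> 0" "(A + S * (2 / \<delta>)) * m \<le> C * m" "2 * m \<le> C * m" if "m \<ge> 0" for m
    using A that by (auto simp: C_def intro!: mult_right_mono)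
  show thesis
  proof (rule that[of C])
    show "C \<ge> 0" using C[of 0] by simp
    fix f assume f: "f \<in> H1"
    show "energy f / 2 - C * mass f \<le> qform q \<sigma> f"
      using qb[OF f] vb[OF f] C(2)[OF mass_nonneg[of f]] unfolding qform_eq[OF q f] by (simp add: distrib_right)
    show "qform q \<sigma> f \<le> C * (energy f + mass f)"
      using qb[OF f] vb[OF f] C(2)[OF mass_nonneg[of f]] C(3)[OF energy_nonneg[of f]] energy_nonneg[of f] mass_nonneg[of f]
      unfolding qform_eq[OF q f] by (simp add: distrib_right distrib_left)
  qed
qed

end

section \<open>A negative form value forces a negative eigenvalue\<close>

text \<open>There are finitely many arcs, so subsequences are extracted one arc after another;
  stability of \<open>P\<close> under further extraction preserves what was already
  achieved.\<close>

lemma common_subsequence: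
  assumes "finite E"
    and ex: "\<And>e r. e \<in> E \<Longrightarrow> strict_mono (r :: nat \<Rightarrow> nat) \<Longrightarrow> \<exists>s. strict_mono (s :: nat \<Rightarrow> nat) \<and> P e (r \<circ> s)"
    and sub: "\<And>e r s. P e r \<Longrightarrow> strict_mono (r :: nat \<Rightarrow> nat) \<Longrightarrow> strict_mono (s :: nat \<Rightarrow> nat) \<Longrightarrow> P e (r \<circ> s)"
  shows "\<exists>r. strict_mono r \<and> (\<forall>e\<in>E. P e r)"
  using assms(1) ex
proof (induction E)
  case empty
  then show ?case by (intro exI[of _ id]) (auto simp: strict_mono_def)
next
  case (insert e E)
  then obtain r where r: "strict_mono r" "\<forall>e\<in>E. P e r" by auto
  obtain s where s: "strict_mono s" "P e (r \<circ> s)" using insert.prems[of e r] r(1) by blast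
  have "\<forall>e'\<in>E. P e' (r \<circ> s)" using r s sub by blast
  then show ?case using strict_mono_o[OF r(1) s(1)] s(2) by blast
qed

context covered_metric_graph
begin

lemma mass_scale: "mass (lincomb a f 0 g) = (cmod a)\<^sup>2 * mass f"
  by (simp add: mass_def lincomb_def norm_mult power_mult_distrib sum_distrib_left)

lemma mass_diff_le:
  assumes f: "f \<in> H1" and g: "g \<in> H1"
    and le: "\<And>e x. e \<in> arcs G \<Longrightarrow> x \<in> {0..len e} \<Longrightarrow> cmod (f e x - g e x) \<le> c"
  shows "mass (lincomb 1 f (-1) g) \<le> c\<^sup>2 * (\<Sum>e\<in>arcs G. len e)"
  unfolding mass_def sum_distrib_left
proof (rule sum_mono)
  fix e assume e: "e \<in> arcs G"
  have "(LINT x|edge_measure (len e). (cmod (lincomb 1 f (-1) g e x))\<^sup>2) \<le> (LINT x|edge_measure (len e). c\<^sup>2)"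
  proof (rule integral_mono)
    show "integrable (edge_measure (len e)) (\<lambda>x. (cmod (lincomb 1 f (-1) g e x))\<^sup>2)"
      by (intro L2_square_integrable H1D(5)[OF H1_lincomb(1)[OF f g] e])
    show "integrable (edge_measure (len e)) (\<lambda>x. c\<^sup>2)"
      by (intro finite_measure.integrable_const finite_edge_measure)
    fix x assume "x \<in> space (edge_measure (len e))"
    then show "(cmod (lincomb 1 f (-1) g e x))\<^sup>2 \<le> c\<^sup>2"
      using le[OF e, of x] by (simp add: lincomb_def power_mono)
  qed
  also have "\<dots> \<le> c\<^sup>2 * len e"
    using mult_left_mono[OF measure_edge_measure[of "len e"], of "c\<^sup>2"] len_pos[OF e] by (simp add: mult.commute)
  finally show "(LINT x|edge_measure (len e). (cmod (lincomb 1 f (-1) g e x))\<^sup>2) \<le> c\<^sup>2 * len e" .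
qed

text \<open>With \<open>f\<close> of mass zero this bounds the distance to any \<open>g\<close> from
  below, which later shows that the minimiser is not zero.\<close>

lemma mass_le_diff:
  assumes f: "f \<in> H1" and g: "g \<in> H1"
  shows "mass g \<le> 2 * mass f + 2 * mass (lincomb 1 f (-1) g)"
  unfolding mass_def sum_distrib_left sum.distrib[symmetric]
proof (rule sum_mono)
  fix e assume e: "e \<in> arcs G"
  note int = L2_square_integrable[OF H1D(5)[OF f e]] L2_square_integrable[OF H1D(5)[OF g e]]
    L2_square_integrable[OF H1D(5)[OF H1_lincomb(1)[OF f g, of 1 "-1"] e]]
  have "(LINT x|edge_measure (len e). (cmod (g e x))\<^sup>2) \<le>
    (LINT x|edge_measure (len e). 2 * (cmod (f e x))\<^sup>2 + 2 * (cmod (lincomb 1 f (-1) g e x))\<^sup>2)"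
  proof (rule integral_mono)
    fix x
    have "cmod (g e x) \<le> cmod (f e x) + cmod (lincomb 1 f (-1) g e x)"
      unfolding lincomb_def using norm_triangle_ineq4[of "f e x" "f e x - g e x"] by simp
    then have "(cmod (g e x))\<^sup>2 \<le> (cmod (f e x) + cmod (lincomb 1 f (-1) g e x))\<^sup>2"
      by (intro power_mono) auto
    also have "\<dots> \<le> 2 * (cmod (f e x))\<^sup>2 + 2 * (cmod (lincomb 1 f (-1) g e x))\<^sup>2"
      using sum_squares_bound[of "cmod (f e x)" "cmod (lincomb 1 f (-1) g e x)"] by (simp add: power2_sum)
    finally show "(cmod (g e x))\<^sup>2 \<le> 2 * (cmod (f e x))\<^sup>2 + 2 * (cmod (lincomb 1 f (-1) g e x))\<^sup>2" .
  qed (use int in auto)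
  also have "\<dots> = 2 * (LINT x|edge_measure (len e). (cmod (f e x))\<^sup>2) + 2 * (LINT x|edge_measure (len e). (cmod (lincomb 1 f (-1) g e x))\<^sup>2)"
    by (subst Bochner_Integration.integral_add) (use int in auto)
  finally show "(LINT x|edge_measure (len e). (cmod (g e x))\<^sup>2) \<le>
    2 * (LINT x|edge_measure (len e). (cmod (f e x))\<^sup>2) + 2 * (LINT x|edge_measure (len e). (cmod (lincomb 1 f (-1) g e x))\<^sup>2)" .
qed

lemma energy_diff_edge:
  assumes f: "f \<in> H1" and g: "g \<in> H1" and e: "e \<in> arcs G"
  shows "(LINT x|edge_measure (len e). (cmod (weak_deriv (len e) (lincomb 1 f (-1) g e) x))\<^sup>2) =
    (LINT x|edge_measure (len e). (cmod (weak_deriv (len e) (f e) x - weak_deriv (len e) (g e) x))\<^sup>2)"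
proof (rule integral_cong_AE)
  note [measurable] = H1D(3)[OF f e, THEN L2_measurable] H1D(3)[OF g e, THEN L2_measurable]
    H1D(3)[OF H1_lincomb(1)[OF f g, of 1 "-1"] e, THEN L2_measurable]
  show "(\<lambda>x. (cmod (weak_deriv (len e) (lincomb 1 f (-1) g e) x))\<^sup>2) \<in> borel_measurable (edge_measure (len e))"
    "(\<lambda>x. (cmod (weak_deriv (len e) (f e) x - weak_deriv (len e) (g e) x))\<^sup>2) \<in> borel_measurable (edge_measure (len e))"
    by measurable
  show "AE x in edge_measure (len e). (cmod (weak_deriv (len e) (lincomb 1 f (-1) g e) x))\<^sup>2 =
      (cmod (weak_deriv (len e) (f e) x - weak_deriv (len e) (g e) x))\<^sup>2"
    using H1_lincomb(3)[OF f g e, of 1 "-1"] by eventually_elim simp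
qed

lemma energy_diff_edge_le:
  assumes f: "f \<in> H1" and g: "g \<in> H1" and e: "e \<in> arcs G"
  shows "(LINT x|edge_measure (len e). (cmod (weak_deriv (len e) (f e) x - weak_deriv (len e) (g e) x))\<^sup>2)
    \<le> energy (lincomb 1 f (-1) g)"
  unfolding energy_diff_edge[OF f g e, symmetric] energy_def by (rule member_le_sum) (use e in auto)

text \<open>Compactness of the embedding of H^1 into continuous functions: the bounds give a common
  sup bound and a common Hoelder modulus on each edge, so Arzela-Ascoli applies edgewise.\<close>

lemma H1_compactness:
  assumes f: "\<And>n. f n \<in> H1" and bound: "\<And>n. energy (f n) \<le> K" "\<And>n. mass (f n) \<le> K"
  obtains r v where "strict_mono (r :: nat \<Rightarrow> nat)"
    "\<And>e. e \<in> arcs G \<Longrightarrow> uniform_limit {0..len e} (\<lambda>n. f (r n) e) (v e) sequentially"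
proof -
  obtain \<delta> where \<delta>: "\<delta> > 0" "\<And>e. e \<in> arcs G \<Longrightarrow> \<delta> \<le> len e" by (rule min_length) blast
  define M where "M = sqrt (2 / \<delta> * K + 2 * \<delta> * K)"
  have K: "K \<ge> 0" using mass_nonneg[of "f 0"] bound(2)[of 0] by linarith
  have M: "cmod (f n e x) \<le> M" if "e \<in> arcs G" "x \<in> {0..len e}" for n e x
  proof -
    have "(cmod (f n e x))\<^sup>2 \<le> 2 / \<delta> * mass (f n) + 2 * \<delta> * energy (f n)"
      by (rule H1_sup_bound[OF f \<delta> that])
    also have "\<dots> \<le> 2 / \<delta> * K + 2 * \<delta> * K"
      using \<delta>(1) bound by (intro add_mono mult_left_mono) auto
    finally show ?thesis unfolding M_def by (rule real_le_rsqrt)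
  qed
  have Hoelder: "(cmod (f n e x - f n e y))\<^sup>2 \<le> \<bar>x - y\<bar> * K"
    if e: "e \<in> arcs G" and "x \<in> {0..len e}" "y \<in> {0..len e}" for n e x y
  proof -
    have "(cmod (f n e x - f n e y))\<^sup>2 \<le> \<bar>x - y\<bar> *
        (LINT t|edge_measure (len e). (cmod (weak_deriv (len e) (f n e) t))\<^sup>2)"
      using H1D[OF f[of n] e] that by (intro H1_Hoelder) auto
    also have "\<dots> \<le> \<bar>x - y\<bar> * energy (f n)"
      unfolding energy_def using e by (intro mult_left_mono member_le_sum) auto
    also have "\<dots> \<le> \<bar>x - y\<bar> * K" by (intro mult_left_mono bound) simp
    finally show ?thesis .
  qed
  define P where "P e r \<longleftrightarrow> (\<exists>v. uniform_limit {0..len e} (\<lambda>n. f (r n) e) v sequentially)" for e and r :: "nat \<Rightarrow> nat"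
  have "\<exists>r. strict_mono r \<and> (\<forall>e\<in>arcs G. P e r)"
  proof (rule common_subsequence[OF finite_arcs])
    fix e and r :: "nat \<Rightarrow> nat" assume e: "e \<in> arcs G"
    have equicont: "\<exists>d>0. \<forall>n y. y \<in> {0..len e} \<and> norm (x - y) < d \<longrightarrow> norm (f (r n) e x - f (r n) e y) < \<epsilon>"
      if x: "x \<in> {0..len e}" and \<epsilon>: "0 < \<epsilon>" for x \<epsilon>
    proof (intro exI conjI allI impI)
      \<comment> \<open>The radius comes from solving d K < \<epsilon>^2 in the Hoelder bound; K + 1
        covers K = 0.\<close>
      show "0 < \<epsilon>\<^sup>2 / (K + 1)" using K \<epsilon> by simp
      fix n y assume y: "y \<in> {0..len e} \<and> norm (x - y) < \<epsilon>\<^sup>2 / (K + 1)"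
      have "(cmod (f (r n) e x - f (r n) e y))\<^sup>2 \<le> \<bar>x - y\<bar> * K" using x y e by (intro Hoelder) auto
      also have "\<dots> \<le> \<bar>x - y\<bar> * (K + 1)" by (intro mult_left_mono) auto
      also have "\<dots> < \<epsilon>\<^sup>2" using y K by (simp add: field_simps)
      finally show "norm (f (r n) e x - f (r n) e y) < \<epsilon>"
        using \<epsilon> by (simp add: power_less_imp_less_base)
    qed
    show "\<exists>s. strict_mono s \<and> P e (r \<circ> s)"
    proof (rule Arzela_Ascoli[of "{0..len e}" "\<lambda>n. f (r n) e" M])
      show "norm (f (r n) e x) \<le> M" if "x \<in> {0..len e}" for n x using M e that by blast
      fix v s
      assume s: "strict_mono (s :: nat \<Rightarrow> nat)"
        "\<And>\<epsilon>. 0 < \<epsilon> \<Longrightarrow> \<exists>N. \<forall>n x. N \<le> n \<and> x \<in> {0..len e} \<longrightarrow> norm (f (r (s n)) e x - v x) < \<epsilon>"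
      have "uniform_limit {0..len e} (\<lambda>n. f (r (s n)) e) v sequentially"
        unfolding uniform_limit_iff eventually_sequentially dist_norm using s(2) by blast
      then show ?thesis using s(1) unfolding P_def o_def by blast
    qed (use equicont in simp_all)
  next
    fix e and r s :: "nat \<Rightarrow> nat" assume "P e r" "strict_mono s"
    then obtain v where "uniform_limit {0..len e} (\<lambda>n. f (r n) e) v sequentially" unfolding P_def by auto
    from filterlim_compose[OF this filterlim_subseq[OF \<open>strict_mono s\<close>]]
    show "P e (r \<circ> s)" unfolding P_def by (auto simp: o_def)
  qed
  then obtain r where r: "strict_mono r" "\<forall>e\<in>arcs G. P e r" by auto
  then have "\<exists>v. \<forall>e\<in>arcs G. uniform_limit {0..len e} (\<lambda>n. f (r n) e) (v e) sequentially"
    unfolding P_def by (intro bchoice)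
  with r that show thesis by blast
qed

lemma H1_closed:
  assumes f: "\<And>n. f n \<in> H1"
    and lim: "\<And>e. e \<in> arcs G \<Longrightarrow> uniform_limit {0..len e} (\<lambda>n. f n e) (v e) sequentially"
    and Cauchy: "\<And>\<epsilon>. \<epsilon> > 0 \<Longrightarrow> \<exists>N. \<forall>m\<ge>N. \<forall>n\<ge>N. energy (lincomb 1 (f m) (-1) (f n)) \<le> \<epsilon>"
  obtains F where "F \<in> H1" "(\<lambda>n. energy (lincomb 1 F (-1) (f n))) \<longlonglongrightarrow> 0" "(\<lambda>n. mass (lincomb 1 F (-1) (f n))) \<longlonglongrightarrow> 0"
proof -
  \<comment> \<open>The limit is fixed only on the closed edges; outside, \<open>C_graph\<close>
    demands the value zero.\<close>
  define F where "F e x = (if e \<in> arcs G \<and> x \<in> {0..len e} then v e x else 0)" for e x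
  have limF: "uniform_limit {0..len e} (\<lambda>n. f n e) (F e) sequentially" if e: "e \<in> arcs G" for e
    using lim[OF e] by (rule uniform_limit_cong'[THEN iffD1, rotated 2]) (use e in \<open>auto simp: F_def\<close>)
  have C: "\<exists>N. \<forall>m\<ge>N. \<forall>n\<ge>N. (LINT x|edge_measure (len e).
     (cmod (weak_deriv (len e) (f m e) x - weak_deriv (len e) (f n e) x))\<^sup>2) \<le> \<epsilon>" if e: "e \<in> arcs G" and "\<epsilon> > 0" for e \<epsilon>
  proof -
    obtain N where "\<forall>m\<ge>N. \<forall>n\<ge>N. energy (lincomb 1 (f m) (-1) (f n)) \<le> \<epsilon>" using Cauchy[OF \<open>\<epsilon> > 0\<close>] by auto
    then show ?thesis using energy_diff_edge_le[OF f f e] by (meson order_trans)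
  qed
  note L = H1_limit[OF H1D(1)[OF f] H1D(2)[OF f] limF C]
  have pt: "(\<lambda>n. f n e x) \<longlonglongrightarrow> F e x" if "e \<in> arcs G" "x \<in> {0..len e}" for e x
    using tendsto_uniform_limitI[OF limF[OF that(1)] that(2)] .
  \<comment> \<open>Edges meeting at a vertex share the same sequence of vertex values, hence its
    limit; this is the continuity of \<open>F\<close> across vertices.\<close>
  define V where "V w = lim (\<lambda>n. vval (f n) w)" for w
  have ends: "F e 0 = V (tail G e)" "F e (len e) = V (head G e)" if e: "e \<in> arcs G" for e
    unfolding V_def using pt[OF e, of 0] pt[OF e, of "len e"] len_pos[OF e]
    by (auto simp: vertex_value[OF f e] limI[symmetric])
  have F: "F \<in> H1"
    by (rule H1I(1)[of F V]) (use L ends in \<open>auto simp: F_def\<close>)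
  moreover have "(\<lambda>n. energy (lincomb 1 F (-1) (f n))) \<longlonglongrightarrow> 0"
  proof -
    have "(\<lambda>n. \<Sum>e\<in>arcs G. LINT x|edge_measure (len e). (cmod (weak_deriv (len e) (F e) x - weak_deriv (len e) (f n e) x))\<^sup>2)
        \<longlonglongrightarrow> (\<Sum>e\<in>arcs G. 0)"
      by (intro tendsto_sum L(3))
    then show ?thesis unfolding energy_def by (simp add: energy_diff_edge[OF F f])
  qed
  moreover have "(\<lambda>n. mass (lincomb 1 F (-1) (f n))) \<longlonglongrightarrow> 0"
  proof -
    have "(\<lambda>n. \<Sum>e\<in>arcs G. LINT x|edge_measure (len e). (cmod (F e x - f n e x))\<^sup>2) \<longlonglongrightarrow> (\<Sum>e\<in>arcs G. 0)"
      by (intro tendsto_sum L(4))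
    then show ?thesis unfolding mass_def by (simp add: lincomb_def)
  qed
  ultimately show thesis by (rule that)
qed

text \<open>Direct method: the infimum of the form over functions of mass one is attained, and the
  minimiser solves the weak eigenvalue equation with that infimum as eigenvalue.\<close>

lemma negative_form_imp_negative_eigenvalue:
  assumes q: "bounded_potential q" and f0: "f0 \<in> H1" "qform q \<sigma> f0 < 0"
  obtains \<mu> f where "\<mu> < 0" "f \<in> eigenspace G len q \<sigma> \<mu>" "mass f > 0"
proof -
  obtain C where C: "C \<ge> 0" "\<And>f. f \<in> H1 \<Longrightarrow> energy f / 2 - C * mass f \<le> qform q \<sigma> f"
    by (rule qform_bounds[OF q]) blast
  \<comment> \<open>A function with negative form value has positive mass and can therefore be
    normalised.\<close>
  have mass0: "qform q \<sigma> f \<ge> 0" if "f \<in> H1" "mass f = 0" for f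
    using C(2)[OF that(1)] energy_nonneg[of f] that(2) by simp
  define S where "S = qform q \<sigma> ` {f \<in> H1. mass f = 1}"
  define \<mu> where "\<mu> = Inf S"
  have normalize: "(1 / mass f) * qform q \<sigma> f \<in> S" if f: "f \<in> H1" and m: "mass f > 0" for f
  proof -
    define a where "a = complex_of_real (1 / sqrt (mass f))"
    have a: "(cmod a)\<^sup>2 = 1 / mass f"
      using m by (simp add: a_def norm_divide power_divide)
    have "lincomb a f 0 f \<in> H1" "mass (lincomb a f 0 f) = 1" "qform q \<sigma> (lincomb a f 0 f) = (1 / mass f) * qform q \<sigma> f"
      using H1_lincomb(1)[OF f f] m by (simp_all add: mass_scale qform_lincomb[OF q f f] a)
    then show ?thesis unfolding S_def by (metis (mono_tags, lifting) image_eqI mem_Collect_eq)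
  qed
  have bdd: "bdd_below S"
  proof (rule bdd_belowI)
    fix s assume "s \<in> S"
    then obtain f where "f \<in> H1" "mass f = 1" "s = qform q \<sigma> f" by (auto simp: S_def)
    then show "- C \<le> s" using C(2)[of f] energy_nonneg[of f] by simp
  qed
  have m0: "mass f0 > 0"
    using mass0[OF f0(1)] f0(2) mass_nonneg[of f0] by (cases "mass f0 = 0") auto
  have "\<mu> \<le> (1 / mass f0) * qform q \<sigma> f0"
    unfolding \<mu>_def by (rule cInf_lower[OF normalize[OF f0(1) m0] bdd])
  also have "\<dots> < 0" using m0 f0(2) by (simp add: divide_neg_pos)
  finally have \<mu>: "\<mu> < 0" .
  \<comment> \<open>After this shift the form is nonnegative with infimum zero, so a minimiser is a
    zero of it and lies in its kernel.\<close>
  define q' where "q' = (\<lambda>e x. q e x - \<mu>)"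
  have q': "bounded_potential q'" unfolding q'_def by (rule bounded_potential_shift[OF q])
  have mass_inner: "L2_inner G len f f = complex_of_real (mass f)" for f
  proof -
    have sq: "a * cnj a = complex_of_real ((cmod a)\<^sup>2)" for a by (rule complex_norm_square[symmetric])
    show ?thesis unfolding L2_inner_def mass_def sq integral_complex_of_real by simp
  qed
  have qform': "qform q' \<sigma> f = qform q \<sigma> f - \<mu> * mass f" if "f \<in> H1" for f
    using form_shift[OF q that that, of \<mu> \<sigma>] unfolding qform_def q'_def by (simp add: mass_inner)
  have nonneg: "0 \<le> qform q' \<sigma> f" if f: "f \<in> H1" for f
  proof (cases "mass f = 0")
    case True
    then show ?thesis using mass0[OF f True] qform'[OF f] by simp
  next
    case False
    then have m: "mass f > 0" using mass_nonneg[of f] by simp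
    have "\<mu> \<le> (1 / mass f) * qform q \<sigma> f"
      unfolding \<mu>_def by (rule cInf_lower[OF normalize[OF f m] bdd])
    then show ?thesis using m qform'[OF f] by (simp add: field_simps)
  qed
  have "\<exists>f. f \<in> H1 \<and> mass f = 1 \<and> qform q \<sigma> f < \<mu> + 1 / real (Suc n)" for n
  proof -
    have "S \<noteq> {}" using normalize[OF f0(1) m0] by auto
    moreover have "Inf S < \<mu> + 1 / real (Suc n)" by (simp add: \<mu>_def)
    ultimately obtain s where "s \<in> S" "s < \<mu> + 1 / real (Suc n)" using cInf_lessD by blast
    then show ?thesis by (auto simp: S_def)
  qed
  then obtain f where f: "\<And>n. f n \<in> H1" "\<And>n. mass (f n) = 1" "\<And>n. qform q \<sigma> (f n) < \<mu> + 1 / real (Suc n)" by metis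
  have small: "qform q' \<sigma> (f n) < 1 / real (Suc n)" for n using f(3)[of n] qform'[OF f(1)] f(2) by simp
  have energy_bound: "energy (f n) \<le> 2 * (1 + C) + 1" for n
  proof -
    have "qform q \<sigma> (f n) < \<mu> + 1"
      by (rule less_le_trans[OF f(3)]) simp
    moreover have "energy (f n) / 2 - C \<le> qform q \<sigma> (f n)" using C(2)[OF f(1), of n] f(2)[of n] by simp
    ultimately show ?thesis using \<mu> by (simp | argo | (simp add: field_simps))
  qed
  obtain r v where r: "strict_mono (r :: nat \<Rightarrow> nat)"
    and v: "\<And>e. e \<in> arcs G \<Longrightarrow> uniform_limit {0..len e} (\<lambda>n. f (r n) e) (v e) sequentially"
    by (rule H1_compactness[of f "2 * (1 + C) + 1"]) (use f energy_bound C(1) in auto)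
  obtain C' where C': "C' \<ge> 0" "\<And>f. f \<in> H1 \<Longrightarrow> energy f / 2 - C' * mass f \<le> qform q' \<sigma> f"
    "\<And>f. f \<in> H1 \<Longrightarrow> qform q' \<sigma> f \<le> C' * (energy f + mass f)"
    by (rule qform_bounds[OF q']) blast
  define L where "L = (\<Sum>e\<in>arcs G. len e)"
  have L: "L \<ge> 0" unfolding L_def using len_pos by (intro sum_nonneg) (auto simp: less_imp_le)
  have small_r: "qform q' \<sigma> (f (r n)) < 1 / real (Suc n)" for n
  proof -
    have "1 / real (Suc (r n)) \<le> 1 / real (Suc n)"
      using strict_mono_imp_increasing[OF r, of n] by (intro divide_left_mono) auto
    then show ?thesis using small[of "r n"] by linarith
  qed
  \<comment> \<open>Uniform convergence makes the mass of differences small and the parallelogram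
    inequality makes their form value small; coercivity then makes their energy small.\<close>
  have Cauchy: "\<exists>N. \<forall>m\<ge>N. \<forall>n\<ge>N. energy (lincomb 1 (f (r m)) (-1) (f (r n))) \<le> \<epsilon>" if \<epsilon>: "\<epsilon> > 0" for \<epsilon>
  proof -
    \<comment> \<open>The budget: \<open>C'\<close> times the mass is at most \<epsilon>/4, and two
      form values below \<epsilon>/16 bound that of the difference by \<epsilon>/4, so half of the
      energy is at most \<epsilon>/2.\<close>
    define \<eta> where "\<eta> = sqrt (\<epsilon> / (4 * (C' * L + 1)))"
    have CL: "C' * L \<ge> 0" using C'(1) L by simp
    have \<eta>: "\<eta> > 0" "\<eta>\<^sup>2 * (4 * (C' * L + 1)) = \<epsilon>" using CL \<epsilon> by (simp_all add: \<eta>_def)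
    have "\<forall>\<^sub>F n in sequentially. \<forall>e\<in>arcs G. \<forall>x\<in>{0..len e}. dist (f (r n) e x) (v e x) < \<eta> / 2"
      using \<eta>(1) by (intro eventually_ball_finite) (auto dest!: v uniform_limitD[where e="\<eta>/2"])
    then obtain N1 where N1: "\<And>n e x. n \<ge> N1 \<Longrightarrow> e \<in> arcs G \<Longrightarrow> x \<in> {0..len e} \<Longrightarrow> dist (f (r n) e x) (v e x) < \<eta> / 2"
      unfolding eventually_sequentially by blast
    obtain N2 where N2: "1 / real (Suc N2) < \<epsilon> / 16"
      using \<epsilon> by (metis inverse_eq_divide reals_Archimedean zero_less_divide_iff zero_less_numeral)
    have "energy (lincomb 1 (f (r m)) (-1) (f (r n))) \<le> \<epsilon>" if m: "m \<ge> max N1 N2" and n: "n \<ge> max N1 N2" for m n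
    proof -
      have "mass (lincomb 1 (f (r m)) (-1) (f (r n))) \<le> \<eta>\<^sup>2 * L"
        unfolding L_def
      proof (rule mass_diff_le[OF f(1) f(1)])
        fix e x assume ex: "e \<in> arcs G" "x \<in> {0..len e}"
        have "m \<ge> N1" "n \<ge> N1" using m n by simp_all
        then have "dist (f (r m) e x) (f (r n) e x) < \<eta>"
          by (intro dist_triangle_half_l[OF N1[OF _ ex] N1[OF _ ex]])
        then show "cmod (f (r m) e x - f (r n) e x) \<le> \<eta>" by (simp add: dist_norm)
      qed
      then have 1: "C' * mass (lincomb 1 (f (r m)) (-1) (f (r n))) \<le> C' * (\<eta>\<^sup>2 * L)"
        by (rule mult_left_mono[OF _ C'(1)])
      have s: "qform q' \<sigma> (f (r k)) < \<epsilon> / 16" if "k \<ge> max N1 N2" for k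
      proof -
        have "1 / real (Suc k) \<le> 1 / real (Suc N2)" using that by (intro divide_left_mono) auto
        then show ?thesis using small_r[of k] N2 by linarith
      qed
      have 2: "qform q' \<sigma> (lincomb 1 (f (r m)) (-1) (f (r n))) \<le> \<epsilon> / 4"
        using qform_parallelogram(2)[OF q' nonneg f(1) f(1), of "r m" "r n"] s[OF m] s[OF n] by simp
      have "4 * (C' * (\<eta>\<^sup>2 * L)) \<le> \<epsilon>"
        using zero_le_power2[of \<eta>] unfolding \<eta>(2)[symmetric] by (simp add: algebra_simps)
      then show ?thesis
        using C'(2)[OF H1_lincomb(1)[OF f(1) f(1)], of 1 "r m" "-1" "r n"] 1 2 by simp
    qed
    then show ?thesis by blast
  qed
  obtain F where F: "F \<in> H1" "(\<lambda>n. energy (lincomb 1 F (-1) (f (r n)))) \<longlonglongrightarrow> 0"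
    "(\<lambda>n. mass (lincomb 1 F (-1) (f (r n)))) \<longlonglongrightarrow> 0"
    by (rule H1_closed[of "\<lambda>n. f (r n)" v]) (use f(1) v Cauchy in auto)
  have D: "lincomb 1 F (-1) (f (r n)) \<in> H1" for n by (rule H1_lincomb(1)[OF F(1) f(1)])
  \<comment> \<open>\<open>F\<close> is an almost minimising function plus a small remainder; the
    parallelogram inequality bounds its form value by quantities tending to zero.\<close>
  have split: "F = lincomb 1 (f (r n)) 1 (lincomb 1 F (-1) (f (r n)))" for n
    by (auto simp: lincomb_def fun_eq_iff)
  have "qform q' \<sigma> F \<le> 0"
  proof (rule LIMSEQ_le_const)
    have "(\<lambda>n. 2 * inverse (real (Suc n)) + 2 * (C' * (energy (lincomb 1 F (-1) (f (r n))) + mass (lincomb 1 F (-1) (f (r n))))))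
       \<longlonglongrightarrow> 2 * 0 + 2 * (C' * (0 + 0))"
      by (intro tendsto_add tendsto_mult tendsto_const F LIMSEQ_inverse_real_of_nat)
    then show "(\<lambda>n. 2 * inverse (real (Suc n)) + 2 * (C' * (energy (lincomb 1 F (-1) (f (r n))) + mass (lincomb 1 F (-1) (f (r n))))))
       \<longlonglongrightarrow> 0" by simp
    have "qform q' \<sigma> F \<le> 2 * inverse (real (Suc n)) + 2 * (C' * (energy (lincomb 1 F (-1) (f (r n))) + mass (lincomb 1 F (-1) (f (r n)))))" for n
      using qform_parallelogram(1)[OF q' nonneg f(1)[of "r n"] D[of n]] split[of n] small_r[of n] C'(3)[OF D[of n]]
      by (simp add: inverse_eq_divide)
    then show "\<exists>N. \<forall>n\<ge>N. qform q' \<sigma> F \<le> 2 * inverse (real (Suc n)) + 2 * (C' * (energy (lincomb 1 F (-1) (f (r n))) + mass (lincomb 1 F (-1) (f (r n)))))"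
      by blast
  qed
  then have "F \<in> eigenspace G len q \<sigma> \<mu>"
    unfolding eigenspace_iff[OF q] using qform_zero_imp_kernel[OF q' nonneg F(1)] F(1) by (simp add: q'_def)
  moreover have "mass F > 0"
  proof (rule ccontr)
    assume "\<not> mass F > 0"
    then have "mass F = 0" using mass_nonneg[of F] by simp
    then have le: "1 \<le> 2 * mass (lincomb 1 F (-1) (f (r n)))" for n
      using mass_le_diff[OF F(1) f(1)[of "r n"]] f(2)[of "r n"] by simp
    have "(\<lambda>n. 2 * mass (lincomb 1 F (-1) (f (r n)))) \<longlonglongrightarrow> 2 * 0"
      by (intro tendsto_mult tendsto_const F)
    then have "(1::real) \<le> 2 * 0" by (rule LIMSEQ_le_const) (use le in blast)
    then show False by simp
  qed
  ultimately show thesis using \<mu> that by blast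
qed

end

section \<open>Consequences of isospectrality\<close>

text \<open>Isospectrality level by level, through finite bases of eigenspaces. Comparing dimensions
  at a given \<mu> needs no bookkeeping of positions in the sequences.\<close>

definition isospectral_to_free ::
  "('v, 'e) pre_digraph \<Rightarrow> ('e \<Rightarrow> real) \<Rightarrow> ('e \<Rightarrow> real \<Rightarrow> real) \<Rightarrow> ('v \<Rightarrow> real) \<Rightarrow> bool" where
  "isospectral_to_free G len q \<sigma> \<longleftrightarrow> (\<forall>\<mu>. \<exists>B B0. finite B \<and> finite B0 \<and> card B = card B0 \<and>
     gfun.independent B \<and> gfun.span B = eigenspace G len q \<sigma> \<mu> \<and>
     gfun.independent B0 \<and> gfun.span B0 = eigenspace G len (\<lambda>e x. 0) (\<lambda>v. 0) \<mu>)"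

lemma isospectral_to_freeI:
  assumes "eigenvalue_sequence G len q \<sigma> lam" "eigenvalue_sequence G len (\<lambda>e x. 0) (\<lambda>v. 0) lam0"
    "\<forall>n. lam n = lam0 n"
  shows "isospectral_to_free G len q \<sigma>"
  unfolding isospectral_to_free_def
proof
  fix \<mu>
  have "lam = lam0" using assms(3) by auto
  with assms(1,2) obtain B B0 where "finite B" "gfun.independent B" "gfun.span B = eigenspace G len q \<sigma> \<mu>"
    "card B = card {n. lam n = \<mu>}" "finite B0" "gfun.independent B0"
    "gfun.span B0 = eigenspace G len (\<lambda>e x. 0) (\<lambda>v. 0) \<mu>" "card B0 = card {n. lam n = \<mu>}"
    unfolding eigenvalue_sequence_def by meson
  then show "\<exists>B B0. finite B \<and> finite B0 \<and> card B = card B0 \<and>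
     gfun.independent B \<and> gfun.span B = eigenspace G len q \<sigma> \<mu> \<and>
     gfun.independent B0 \<and> gfun.span B0 = eigenspace G len (\<lambda>e x. 0) (\<lambda>v. 0) \<mu>"
    by (intro exI[of _ B] exI[of _ B0]) simp
qed

lemma isospectral_to_free_nonzero:
  assumes "isospectral_to_free G len q \<sigma>"
  shows "(\<exists>f\<in>eigenspace G len q \<sigma> \<mu>. f \<noteq> 0) \<longleftrightarrow> (\<exists>f\<in>eigenspace G len (\<lambda>e x. 0) (\<lambda>v. 0) \<mu>. f \<noteq> 0)"
proof -
  have *: "(\<exists>f\<in>gfun.span B. f \<noteq> 0) \<longleftrightarrow> card B > 0" if "finite B" "gfun.independent B" for B :: "'b graph_fun set"
  proof
    assume "\<exists>f\<in>gfun.span B. f \<noteq> 0"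
    then have "B \<noteq> {}" by (auto simp: gfun.span_empty)
    then show "card B > 0" using that by (simp add: card_gt_0_iff)
  next
    assume "card B > 0"
    then obtain b where "b \<in> B" by (auto simp: card_gt_0_iff)
    moreover have "b \<noteq> 0" using that(2) \<open>b \<in> B\<close> gfun.dependent_zero by blast
    ultimately show "\<exists>f\<in>gfun.span B. f \<noteq> 0" using gfun.span_base by blast
  qed
  obtain B B0 where "finite B" "finite B0" "card B = card B0"
     "gfun.independent B" "gfun.span B = eigenspace G len q \<sigma> \<mu>"
     "gfun.independent B0" "gfun.span B0 = eigenspace G len (\<lambda>e x. 0) (\<lambda>v. 0) \<mu>"
    using assms unfolding isospectral_to_free_def by metis
  then show ?thesis using *[of B] *[of B0] by simp
qed

context covered_metric_graph
begin

section \<open>Sign of the form under isospectrality\<close>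

lemma bounded_potential_zero: "bounded_potential (\<lambda>e x. 0)"
  by (auto simp: bounded_potential_def Linfty_def)

lemma free_qform: "f \<in> H1 \<Longrightarrow> qform (\<lambda>e x. 0 - \<mu>) (\<lambda>v. 0) f = energy f - \<mu> * mass f"
  using qform_eq[OF bounded_potential_shift[OF bounded_potential_zero], of f \<mu> "\<lambda>v. 0"]
  by (simp add: mass_def sum_distrib_left sum_negf)

text \<open>Tested with itself, an eigenfunction gives energy = \<mu> mass. For negative \<mu> both
  sides vanish, and the sup bound turns vanishing energy and mass into \<open>f = 0\<close> at every
  point.\<close>

lemma free_eigenvalue_nonneg:
  assumes "f \<in> eigenspace G len (\<lambda>e x. 0) (\<lambda>v. 0) \<mu>" "f \<noteq> 0"
  shows "0 \<le> \<mu>"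
proof (rule ccontr)
  assume "\<not> 0 \<le> \<mu>"
  have f: "f \<in> H1" "form (\<lambda>e x. 0 - \<mu>) (\<lambda>v. 0) f f = 0"
    using assms(1) unfolding eigenspace_iff[OF bounded_potential_zero] by blast+
  have "energy f - \<mu> * mass f = 0"
    using free_qform[OF f(1), of \<mu>] f(2) by (simp add: qform_def)
  moreover have "0 \<le> - \<mu> * mass f" using \<open>\<not> 0 \<le> \<mu>\<close> mass_nonneg[of f] by (simp add: mult_nonpos_nonneg)
  ultimately have "energy f = 0" "\<mu> * mass f = 0" using energy_nonneg[of f] by auto
  then have "energy f = 0" "mass f = 0" using \<open>\<not> 0 \<le> \<mu>\<close> by auto
  obtain \<delta> where \<delta>: "\<delta> > 0" "\<And>e. e \<in> arcs G \<Longrightarrow> \<delta> \<le> len e" by (rule min_length) blast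
  have "f e x = 0" for e x
  proof (cases "e \<in> arcs G \<and> x \<in> {0..len e}")
    case True
    then show ?thesis
      using H1_sup_bound[OF f(1) \<delta>, of e x] \<open>energy f = 0\<close> \<open>mass f = 0\<close> by simp
  next
    case False
    then show ?thesis using f(1) unfolding H1_graph_def C_graph_def by blast
  qed
  then have "f = 0" by (simp add: fun_eq_iff)
  with assms(2) show False by simp
qed

lemma isospectral_imp_qform_nonneg:
  assumes q: "bounded_potential q" and iso: "isospectral_to_free G len q \<sigma>" and f: "f \<in> H1"
  shows "0 \<le> qform q \<sigma> f"
proof (rule ccontr)
  assume "\<not> 0 \<le> qform q \<sigma> f"
  then have "qform q \<sigma> f < 0" by simp
  from negative_form_imp_negative_eigenvalue[OF q f this] obtain \<mu> g where
    g: "\<mu> < 0" "g \<in> eigenspace G len q \<sigma> \<mu>" "mass g > 0" .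
  have "g \<noteq> 0" using g(3) by (auto simp: mass_def)
  then obtain h where "h \<in> eigenspace G len (\<lambda>e x. 0) (\<lambda>v. 0) \<mu>" "h \<noteq> 0"
    using isospectral_to_free_nonzero[OF iso] g(2) by blast
  then have "0 \<le> \<mu>" by (rule free_eigenvalue_nonneg)
  with g(1) show False by simp
qed

lemma eigenfunctions_perturbation_zero:
  assumes q: "bounded_potential q"
    and f: "f \<in> eigenspace G len q \<sigma> \<mu>" and w: "w \<in> eigenspace G len (\<lambda>e x. 0) (\<lambda>v. 0) \<mu>"
  shows "(\<Sum>e\<in>arcs G. LINT x|edge_measure (len e). complex_of_real (q e x) * f e x * cnj (w e x)) +
     (\<Sum>v\<in>verts G. complex_of_real (\<sigma> v) * vval f v * cnj (vval w v)) = 0"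
proof -
  have f': "f \<in> H1" "\<And>\<phi>. \<phi> \<in> H1 \<Longrightarrow> form (\<lambda>e x. q e x - \<mu>) \<sigma> f \<phi> = 0"
    using f unfolding eigenspace_iff[OF q] by auto
  have w': "w \<in> H1" "\<And>\<phi>. \<phi> \<in> H1 \<Longrightarrow> form (\<lambda>e x. 0 - \<mu>) (\<lambda>v. 0) w \<phi> = 0"
    using w unfolding eigenspace_iff[OF bounded_potential_zero] by auto
  have "form q \<sigma> f w = complex_of_real \<mu> * L2_inner G len f w"
    using f'(2)[OF w'(1)] by (simp add: form_shift[OF q f'(1) w'(1)])
  \<comment> \<open>The equation for \<open>w\<close> has \<open>w\<close> in the first argument;
    hermitian symmetry moves it to the second one.\<close>
  moreover have "form (\<lambda>e x. 0) (\<lambda>v. 0) f w = complex_of_real \<mu> * L2_inner G len f w"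
  proof -
    have "form (\<lambda>e x. 0 - \<mu>) (\<lambda>v. 0) f w = cnj (form (\<lambda>e x. 0 - \<mu>) (\<lambda>v. 0) w f)"
      by (rule form_hermitian)
    also have "\<dots> = 0" using w'(2)[OF f'(1)] by simp
    finally show ?thesis
      by (simp only: form_shift[OF bounded_potential_zero f'(1) w'(1)] right_minus_eq)
  qed
  ultimately show ?thesis unfolding schroedinger_form_def by simp
qed

section \<open>The constant function as an element of the kernel\<close>

definition one_fun :: "'b graph_fun" where
  "one_fun e x = (if e \<in> arcs G \<and> x \<in> {0..len e} then 1 else 0)"

lemma one_fun:
  shows "one_fun \<in> H1" "v \<in> verts G \<Longrightarrow> vval one_fun v = 1"
    "e \<in> arcs G \<Longrightarrow> AE x in edge_measure (len e). weak_deriv (len e) (one_fun e) x = 0"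
proof -
  have *: "continuous_on {0..len e} (one_fun e)" "one_fun e \<in> H1_interval (len e)"
    "AE x in edge_measure (len e). weak_deriv (len e) (one_fun e) x = 0" if e: "e \<in> arcs G" for e
    using H1_interval_piece[of 0 "len e" "len e" "\<lambda>x. 1" "\<lambda>x. 0" "one_fun e"] e len_pos[OF e]
    by (auto simp: one_fun_def)
  show "one_fun \<in> H1" "v \<in> verts G \<Longrightarrow> vval one_fun v = 1"
    using H1I[of one_fun "\<lambda>v. 1", OF *(1,2)] len_pos by (auto simp: one_fun_def less_imp_le)
  show "e \<in> arcs G \<Longrightarrow> AE x in edge_measure (len e). weak_deriv (len e) (one_fun e) x = 0" by (rule *(3))
qed

lemma form_one_fun:
  assumes "\<phi> \<in> H1"
  shows "form q \<sigma> one_fun \<phi> = (\<Sum>e\<in>arcs G. LINT x|edge_measure (len e). complex_of_real (q e x) * cnj (\<phi> e x))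
     + (\<Sum>v\<in>verts G. complex_of_real (\<sigma> v) * cnj (vval \<phi> v))"
proof -
  have 1: "(LINT x|edge_measure (len e). weak_deriv (len e) (one_fun e) x * cnj (weak_deriv (len e) (\<phi> e) x)) = 0"
    if e: "e \<in> arcs G" for e
  proof (rule integral_eq_zero_AE)
    show "AE x in edge_measure (len e). weak_deriv (len e) (one_fun e) x * cnj (weak_deriv (len e) (\<phi> e) x) = 0"
      using one_fun(3)[OF e] by eventually_elim simp
  qed
  have 2: "(LINT x|edge_measure (len e). complex_of_real (q e x) * one_fun e x * cnj (\<phi> e x)) =
      (LINT x|edge_measure (len e). complex_of_real (q e x) * cnj (\<phi> e x))" if "e \<in> arcs G" for e
    by (rule Bochner_Integration.integral_cong) (use that in \<open>auto simp: one_fun_def\<close>)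
  show ?thesis unfolding schroedinger_form_def by (simp add: 1 2 one_fun(2))
qed

text \<open>The left side of \<open>total\<close> is the form value of the constant function, which
  therefore lies in the kernel. Functions vanishing at all vertices then detect \<open>q\<close>,
  and once \<open>q\<close> is gone, interpolated vertex indicators detect \<sigma>.\<close>

lemma total_potential_nonpos_imp_zero:
  assumes q: "potential G len q" and nonneg: "\<And>f. f \<in> H1 \<Longrightarrow> 0 \<le> qform q \<sigma> f"
    and total: "(\<Sum>e\<in>arcs G. LINT x|edge_measure (len e). q e x) + (\<Sum>v\<in>verts G. \<sigma> v) \<le> 0"
  shows "(\<forall>e\<in>arcs G. \<forall>x\<in>{0<..<len e}. q e x = 0) \<and> (\<forall>v\<in>verts G. \<sigma> v = 0)"
proof -
  have qb: "bounded_potential q" using q by (auto simp: potential_def bounded_potential_def)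
  have "form q \<sigma> one_fun one_fun = complex_of_real ((\<Sum>e\<in>arcs G. LINT x|edge_measure (len e). q e x) + (\<Sum>v\<in>verts G. \<sigma> v))"
  proof -
    have "(LINT x|edge_measure (len e). complex_of_real (q e x) * cnj (one_fun e x)) = complex_of_real (LINT x|edge_measure (len e). q e x)"
      if "e \<in> arcs G" for e
      unfolding integral_complex_of_real[symmetric]
      by (rule Bochner_Integration.integral_cong) (use that in \<open>auto simp: one_fun_def\<close>)
    then show ?thesis unfolding form_one_fun[OF one_fun(1)] by (simp add: one_fun(2))
  qed
  then have "qform q \<sigma> one_fun \<le> 0" using total by (simp add: qform_def)
  note kernel = qform_zero_imp_kernel[OF qb nonneg one_fun(1) this]
  have zero: "(\<Sum>e\<in>arcs G. LINT x|edge_measure (len e). complex_of_real (q e x) * cnj (\<phi> e x))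
     + (\<Sum>v\<in>verts G. complex_of_real (\<sigma> v) * cnj (vval \<phi> v)) = 0" if "\<phi> \<in> H1" for \<phi>
    unfolding form_one_fun[OF that, symmetric] by (rule kernel[OF _ that])
  have q0: "q e x = 0" if e: "e \<in> arcs G" and x: "x \<in> {0<..<len e}" for e x
  proof -
    have L2: "(\<lambda>x. complex_of_real (q e x)) \<in> L2 (len e)"
      using bounded_potential_mult_L2[OF qb e L2_continuous[of "len e" "\<lambda>x. 1"]] by simp
    \<comment> \<open>For functions supported inside one edge the kernel equation says precisely
      that \<open>q e\<close> is a weak derivative of zero, so uniqueness makes it vanish almost
      everywhere.\<close>
    have "is_weak_deriv (len e) (\<lambda>x. 0) (\<lambda>x. complex_of_real (q e x))"
      unfolding is_weak_deriv_def
    proof (intro allI impI)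
      fix \<phi> assume t: "test_fun (len e) \<phi>"
      define \<Phi> where "\<Phi> e' x = (if e' = e \<and> x \<in> {0..len e} then complex_of_real (\<phi> x) else 0)" for e' x
      have \<Phi>: "continuous_on {0..len e'} (\<Phi> e')" "\<Phi> e' \<in> H1_interval (len e')" if e': "e' \<in> arcs G" for e'
        using H1_interval_piece[of 0 "len e'" "len e'" "if e' = e then \<phi> else (\<lambda>x. 0)" "if e' = e then deriv \<phi> else (\<lambda>x. 0)" "\<Phi> e'"]
          len_pos[OF e'] test_fun_facts[OF t] by (auto simp: \<Phi>_def)
      have \<phi>0: "\<phi> 0 = 0" "\<phi> (len e) = 0" using test_fun_facts(4)[OF t] by auto
      have H: "\<Phi> \<in> H1" "\<And>v. v \<in> verts G \<Longrightarrow> vval \<Phi> v = 0"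
      proof -
        have ends: "\<Phi> e' 0 = 0" "\<Phi> e' (len e') = 0" if "e' \<in> arcs G" for e'
          using \<phi>0 by (auto simp: \<Phi>_def)
        have out: "\<Phi> e' x = 0" if "e' \<notin> arcs G \<or> x \<notin> {0..len e'}" for e' x using that e by (auto simp: \<Phi>_def)
        show "\<Phi> \<in> H1" "\<And>v. v \<in> verts G \<Longrightarrow> vval \<Phi> v = 0"
          using H1I[of \<Phi> "\<lambda>v. 0", OF \<Phi> ends out] by blast+
      qed
      have "(\<Sum>e'\<in>arcs G. LINT x|edge_measure (len e'). complex_of_real (q e' x) * cnj (\<Phi> e' x)) =
         (\<Sum>e'\<in>arcs G. if e' = e then LINT x|edge_measure (len e). complex_of_real (q e x) * complex_of_real (\<phi> x) else 0)"
        by (rule sum.cong) (auto simp: \<Phi>_def intro!: Bochner_Integration.integral_cong)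
      also have "\<dots> = (LINT x|edge_measure (len e). complex_of_real (q e x) * complex_of_real (\<phi> x))"
        using e by simp
      finally show "(LINT x|edge_measure (len e). 0 * complex_of_real (deriv \<phi> x)) =
          - (LINT x|edge_measure (len e). complex_of_real (q e x) * complex_of_real (\<phi> x))"
        using zero[OF H(1)] by (simp add: H(2))
    qed
    moreover have "is_weak_deriv (len e) (\<lambda>x. 0) (\<lambda>x. 0)" by (simp add: is_weak_deriv_def)
    ultimately have "AE x in edge_measure (len e). complex_of_real (q e x) = 0"
      by (intro is_weak_deriv_unique[of "len e" "\<lambda>x. 0"] L2 L2_continuous) auto
    then have AE: "AE x in lebesgue. x \<in> {0<..<len e} \<longrightarrow> q e x = 0"
      by (subst (asm) AE_restrict_space_iff) auto
    have "(deriv ^^ 0) (q e) differentiable (at x)" if "x \<in> {0<..<len e}" for x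
      using q e that unfolding potential_def Cinfty_def by blast
    then have cont: "continuous_on {0<..<len e} (q e)"
      by (intro differentiable_imp_continuous_on) (auto simp: differentiable_on_def intro: differentiable_at_withinI)
    have "open (q e -` (- {0}) \<inter> {0<..<len e})"
      using cont unfolding continuous_on_open_vimage[OF open_greaterThanLessThan] by blast
    then have op: "open ({0<..<len e} \<inter> q e -` (- {0}))" by (simp add: Int_commute)
    show "q e x = 0"
    proof (rule ccontr)
      assume "q e x \<noteq> 0"
      then have "x \<in> {0<..<len e} \<inter> q e -` (- {0})" using x by auto
      \<comment> \<open>Continuity makes the set where \<open>q e\<close> is nonzero open; being
        null it must be empty, here as containment in the empty closed set.\<close>
      then have "x \<in> {}"
        by (rule mem_closed_if_AE_lebesgue_open[OF op, rotated 2])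
           (use AE in \<open>auto elim: eventually_mono\<close>)
      then show False by simp
    qed
  qed
  have "\<sigma> v0 = 0" if v0: "v0 \<in> verts G" for v0
  proof -
    define a where "a v = (if v = v0 then 1 else 0 :: real)" for v
    \<comment> \<open>Affine interpolation along each edge of the indicator of
      \<open>v0\<close>.\<close>
    define \<psi> where "\<psi> e x = a (tail G e) + (a (head G e) - a (tail G e)) * (1 / len e) * x" for e x
    define \<Phi> where "\<Phi> e x = (if e \<in> arcs G \<and> x \<in> {0..len e} then complex_of_real (\<psi> e x) else 0)" for e x
    have \<psi>: "(\<psi> e has_real_derivative (a (head G e) - a (tail G e)) * (1 / len e)) (at x)" for e x
      unfolding \<psi>_def by (rule DERIV_cong[OF DERIV_add[OF DERIV_const DERIV_cmult_Id]]) simp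
    have \<Phi>: "continuous_on {0..len e} (\<Phi> e)" "\<Phi> e \<in> H1_interval (len e)" if e: "e \<in> arcs G" for e
      using H1_interval_piece[of 0 "len e" "len e" "\<psi> e" "\<lambda>x. (a (head G e) - a (tail G e)) * (1 / len e)" "\<Phi> e"]
        len_pos[OF e] e \<psi> by (auto simp: \<Phi>_def)
    have H: "\<Phi> \<in> H1" "\<And>v. v \<in> verts G \<Longrightarrow> vval \<Phi> v = complex_of_real (a v)"
    proof -
      have ends: "\<Phi> e 0 = complex_of_real (a (tail G e))" "\<Phi> e (len e) = complex_of_real (a (head G e))"
        if "e \<in> arcs G" for e
        using len_pos[OF that] that by (auto simp: \<Phi>_def \<psi>_def)
      have out: "\<Phi> e x = 0" if "e \<notin> arcs G \<or> x \<notin> {0..len e}" for e x using that by (auto simp: \<Phi>_def)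
      show "\<Phi> \<in> H1" "\<And>v. v \<in> verts G \<Longrightarrow> vval \<Phi> v = complex_of_real (a v)"
        using H1I[of \<Phi> "\<lambda>v. complex_of_real (a v)", OF \<Phi> ends out] by blast+
    qed
    have "(LINT x|edge_measure (len e). complex_of_real (q e x) * cnj (\<Phi> e x)) = 0" if e: "e \<in> arcs G" for e
    proof -
      have "(LINT x|edge_measure (len e). complex_of_real (q e x) * cnj (\<Phi> e x)) = (LINT x|edge_measure (len e). 0)"
        by (rule Bochner_Integration.integral_cong) (use q0[OF e] in auto)
      then show ?thesis by simp
    qed
    then have "(\<Sum>v\<in>verts G. complex_of_real (\<sigma> v) * complex_of_real (a v)) = 0"
      using zero[OF H(1)] by (simp add: H(2))
    moreover have "(\<Sum>v\<in>verts G. complex_of_real (\<sigma> v) * complex_of_real (a v)) = (\<Sum>v\<in>verts G. if v = v0 then complex_of_real (\<sigma> v) else 0)"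
      by (rule sum.cong) (auto simp: a_def)
    ultimately show ?thesis using v0 by simp
  qed
  with q0 show ?thesis by blast
qed

end

section \<open>Eigenfunctions at high energy\<close>

lemma edge_AE_neq: "AE x in edge_measure l. x \<noteq> c"
proof -
  have "AE x in lebesgue. x \<noteq> c" by (rule AE_I[where N="{c}"]) auto
  then show ?thesis by (subst AE_restrict_space_iff) auto
qed

text \<open>Green's identity: since \<psi> solves the free equation, the shifted form integrates to
  boundary terms. No derivative falls on the weak derivative of \<open>f\<close>, so H^1 regularity
  of \<open>f\<close> suffices.\<close>

lemma edge_piece_form:
  fixes \<psi> \<psi>' \<psi>'' :: "real \<Rightarrow> real"
  assumes ab: "0 \<le> a" "a \<le> b" "b \<le> l"
    and \<psi>: "\<And>x. (\<psi> has_real_derivative \<psi>' x) (at x)" "\<And>x. (\<psi>' has_real_derivative \<psi>'' x) (at x)"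
    and \<psi>'': "\<And>x. \<psi>'' x = - k\<^sup>2 * \<psi> x"
    and ends: "a = 0 \<or> \<psi> a = 0" "b = l \<or> \<psi> b = 0"
    and u: "\<And>t. t \<in> {0..l} \<Longrightarrow> u t = complex_of_real (if a \<le> t \<and> t \<le> b then \<psi> t else 0)"
  shows "continuous_on {0..l} u" "u \<in> H1_interval l"
    "continuous_on {0..l} f \<Longrightarrow> f \<in> H1_interval l \<Longrightarrow>
       (LINT x|edge_measure l. weak_deriv l f x * weak_deriv l u x) - complex_of_real (k\<^sup>2) * (LINT x|edge_measure l. f x * u x) =
       f b * complex_of_real (\<psi>' b) - f a * complex_of_real (\<psi>' a)"
proof -
  have \<psi>'_cont: "continuous_on UNIV \<psi>'" and \<psi>_cont: "continuous_on UNIV \<psi>"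
    using \<psi> by (meson DERIV_isCont continuous_at_imp_continuous_on)+
  have \<psi>''_cont: "continuous_on UNIV \<psi>''"
    unfolding \<psi>''[abs_def] by (intro continuous_intros \<psi>_cont)
  note piece = H1_interval_piece[OF ab \<psi>(1) \<psi>'_cont ends u]
  have AEu: "AE x in edge_measure l. weak_deriv l u x = indicator {a<..<b} x * complex_of_real (\<psi>' x)"
    by (rule piece(3))
  show cu: "continuous_on {0..l} u" by (rule piece(1))
  show Hu: "u \<in> H1_interval l" by (rule piece(2))
  assume f: "continuous_on {0..l} f" "f \<in> H1_interval l"
  note wf = H1_weak_deriv[OF f(2)] and wu = H1_weak_deriv[OF Hu]
  note fL2 = L2_continuous[OF f(1)] and uL2 = L2_continuous[OF cu]
  note [measurable] = L2_measurable[OF wf(1)] L2_measurable[OF wu(1)] L2_measurable[OF fL2] L2_measurable[OF uL2]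
  have c: "(\<lambda>x. complex_of_real (\<psi>' x)) \<in> L2 l" "(\<lambda>x. complex_of_real (\<psi>'' x)) \<in> L2 l"
    by (intro L2_continuous continuous_intros continuous_on_subset[OF \<psi>'_cont] continuous_on_subset[OF \<psi>''_cont]; simp)+
  have "(LINT x|edge_measure l. weak_deriv l f x * weak_deriv l u x) - complex_of_real (k\<^sup>2) * (LINT x|edge_measure l. f x * u x) =
    (LINT x|edge_measure l. weak_deriv l f x * weak_deriv l u x - complex_of_real (k\<^sup>2) * (f x * u x))"
    by (subst Bochner_Integration.integral_diff[OF L2_mult_integrable[OF wf(1) wu(1)] integrable_mult_right[OF L2_mult_integrable[OF fL2 uL2]]])
       simp
  also have "\<dots> = (LINT x|edge_measure l. indicator {a<..<b} x * (weak_deriv l f x * complex_of_real (\<psi>' x) + f x * complex_of_real (\<psi>'' x)))"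
  proof (rule integral_cong_AE)
    have "integrable (edge_measure l) (\<lambda>x. weak_deriv l f x * complex_of_real (\<psi>' x) + f x * complex_of_real (\<psi>'' x))"
      by (intro Bochner_Integration.integrable_add L2_mult_integrable wf fL2 c)
    then show "(\<lambda>x. indicator {a<..<b} x * (weak_deriv l f x * complex_of_real (\<psi>' x) + f x * complex_of_real (\<psi>'' x))) \<in> borel_measurable (edge_measure l)"
      by (intro borel_measurable_integrable edge_indicator_integrable)
    show "AE x in edge_measure l. weak_deriv l f x * weak_deriv l u x - complex_of_real (k\<^sup>2) * (f x * u x) =
       indicator {a<..<b} x * (weak_deriv l f x * complex_of_real (\<psi>' x) + f x * complex_of_real (\<psi>'' x))"
      using AEu edge_AE_neq[of a l] edge_AE_neq[of b l] AE_space
    proof eventually_elim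
      case (elim x)
      have "u x = complex_of_real (if a \<le> x \<and> x \<le> b then \<psi> x else 0)" using elim by (intro u) auto
      then have ux: "u x = indicator {a<..<b} x * complex_of_real (\<psi> x)" using elim by (auto simp: indicator_def)
      show ?case
        unfolding ux elim(1) \<psi>'' by (simp add: algebra_simps)
    qed
  qed measurable
  also have "\<dots> = f b * complex_of_real (\<psi>' b) - f a * complex_of_real (\<psi>' a)"
    by (rule weak_deriv_integration_by_parts[OF f(1) wf ab \<psi>(2) \<psi>''_cont])
  finally show "(LINT x|edge_measure l. weak_deriv l f x * weak_deriv l u x) - complex_of_real (k\<^sup>2) * (LINT x|edge_measure l. f x * u x) =
       f b * complex_of_real (\<psi>' b) - f a * complex_of_real (\<psi>' a)" .
qed

section \<open>Edges placed on a line\<close>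

definition edge_coord :: "bool \<Rightarrow> real \<Rightarrow> real \<Rightarrow> real \<Rightarrow> real" where
  "edge_coord fwd p l t = (if fwd then p + t else p + l - t)"

text \<open>Inverse of \<open>edge_coord\<close> in the last argument; for a reversed edge both are
  the same reflection.\<close>

definition edge_param :: "bool \<Rightarrow> real \<Rightarrow> real \<Rightarrow> real \<Rightarrow> real" where
  "edge_param fwd p l t = (if fwd then t - p else p + l - t)"

text \<open>Reversing an edge changes the sign of \<Psi>' and exchanges the two ends, so the
  boundary terms look the same for both orientations in line coordinates. The cut point
  \<open>y\<close> may lie before, on or beyond the edge.\<close>

lemma oriented_edge_piece:
  fixes \<Psi> \<Psi>' :: "real \<Rightarrow> real"
  assumes l: "l > 0"
    and D1: "\<And>x. (\<Psi> has_real_derivative \<Psi>' x) (at x)"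
    and D2: "\<And>x. (\<Psi>' has_real_derivative - k\<^sup>2 * \<Psi> x) (at x)"
    and y: "p + l \<le> y \<or> \<Psi> y = 0"
    and u: "\<And>t. t \<in> {0..l} \<Longrightarrow> u t = complex_of_real (if edge_coord fwd p l t \<le> y then \<Psi> (edge_coord fwd p l t) else 0)"
  shows "continuous_on {0..l} u" "u \<in> H1_interval l"
    "continuous_on {0..l} f \<Longrightarrow> f \<in> H1_interval l \<Longrightarrow>
       (LINT x|edge_measure l. weak_deriv l f x * weak_deriv l u x) - complex_of_real (k\<^sup>2) * (LINT x|edge_measure l. f x * u x) =
       (if y \<le> p then 0 else
         f (edge_param fwd p l (min y (p + l))) * complex_of_real (\<Psi>' (min y (p + l))) -
         f (edge_param fwd p l p) * complex_of_real (\<Psi>' p))"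
proof -
  let ?B = "\<lambda>f. if y \<le> p then 0 else
         f (edge_param fwd p l (min y (p + l))) * complex_of_real (\<Psi>' (min y (p + l))) -
         f (edge_param fwd p l p) * complex_of_real (\<Psi>' p)"
  have "continuous_on {0..l} u \<and> u \<in> H1_interval l \<and> (continuous_on {0..l} f \<longrightarrow> f \<in> H1_interval l \<longrightarrow>
       (LINT x|edge_measure l. weak_deriv l f x * weak_deriv l u x) - complex_of_real (k\<^sup>2) * (LINT x|edge_measure l. f x * u x) = ?B f)"
  proof (cases "y \<le> p")
    \<comment> \<open>With the cut before the edge, only the point with coordinate y = p could still
      carry a value, and there \<Psi> vanishes.\<close>
    case True
    then have "\<Psi> y = 0" using y l by auto
    have u0: "u t = complex_of_real (if 0 \<le> t \<and> t \<le> l then 0 else 0)" if t: "t \<in> {0..l}" for t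
    proof (cases "edge_coord fwd p l t \<le> y")
      case le: True
      then have "edge_coord fwd p l t = y" using True t by (auto simp: edge_coord_def split: if_splits)
      then show ?thesis using u[OF t] \<open>\<Psi> y = 0\<close> by simp
    qed (use u[OF t] in simp)
    have P: "continuous_on {0..l} u" "u \<in> H1_interval l" "continuous_on {0..l} f \<Longrightarrow> f \<in> H1_interval l \<Longrightarrow>
         (LINT x|edge_measure l. weak_deriv l f x * weak_deriv l u x) - complex_of_real (k\<^sup>2) * (LINT x|edge_measure l. f x * u x) = 0"
      using edge_piece_form[of 0 l l "\<lambda>x. 0" "\<lambda>x. 0" "\<lambda>x. 0" k u] l u0 by auto
    show ?thesis using P True by simp
  next
    case False
    show ?thesis
    proof (cases fwd)
      case fwd: True
      define b where "b = min l (y - p)"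
      have d: "((\<lambda>t. \<Psi> (p + t)) has_real_derivative \<Psi>' (p + x)) (at x)"
           "((\<lambda>t. \<Psi>' (p + t)) has_real_derivative - k\<^sup>2 * \<Psi> (p + x)) (at x)" for x
        using DERIV_shift[of \<Psi> "\<Psi>' (p + x)" x p] DERIV_shift[of \<Psi>' "- k\<^sup>2 * \<Psi> (p + x)" x p] D1[of "x + p"] D2[of "x + p"]
        by (simp_all add: add.commute)
      have b: "0 \<le> b" "b \<le> l" using False l by (auto simp: b_def)
      have "b = l \<or> \<Psi> (p + b) = 0" using y by (auto simp: b_def min_def)
      moreover have "u t = complex_of_real (if 0 \<le> t \<and> t \<le> b then \<Psi> (p + t) else 0)" if "t \<in> {0..l}" for t
        using u[OF that] that fwd by (auto simp: edge_coord_def b_def)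
      ultimately have P: "continuous_on {0..l} u" "u \<in> H1_interval l" "continuous_on {0..l} f \<Longrightarrow> f \<in> H1_interval l \<Longrightarrow>
         (LINT x|edge_measure l. weak_deriv l f x * weak_deriv l u x) - complex_of_real (k\<^sup>2) * (LINT x|edge_measure l. f x * u x) =
          f b * complex_of_real (\<Psi>' (p + b)) - f 0 * complex_of_real (\<Psi>' (p + 0))"
        using edge_piece_form(1)[of 0 b l "\<lambda>t. \<Psi> (p + t)" "\<lambda>t. \<Psi>' (p + t)" "\<lambda>t. - k\<^sup>2 * \<Psi> (p + t)" k u] edge_piece_form(2)[of 0 b l "\<lambda>t. \<Psi> (p + t)" "\<lambda>t. \<Psi>' (p + t)" "\<lambda>t. - k\<^sup>2 * \<Psi> (p + t)" k u]
          edge_piece_form(3)[of 0 b l "\<lambda>t. \<Psi> (p + t)" "\<lambda>t. \<Psi>' (p + t)" "\<lambda>t. - k\<^sup>2 * \<Psi> (p + t)" k u f] b d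
        by blast+
      have "p + b = min y (p + l)" "edge_param fwd p l (min y (p + l)) = b" "edge_param fwd p l p = 0"
        using fwd by (auto simp: b_def edge_param_def min_def)
      then show ?thesis using P False by simp
    next
      case bwd: False
      define a where "a = max 0 (p + l - y)"
      have 1: "((\<lambda>t. p + l - t) has_real_derivative -1) (at x)" for x
        by (auto intro!: derivative_eq_intros)
      have 2: "((\<lambda>t. \<Psi> (p + l - t)) has_real_derivative - \<Psi>' (p + l - x)) (at x)" for x
        using DERIV_chain'[OF 1 D1, of x] by simp
      have 3: "((\<lambda>t. - \<Psi>' (p + l - t)) has_real_derivative - k\<^sup>2 * \<Psi> (p + l - x)) (at x)" for x
        using DERIV_minus[OF DERIV_chain'[OF 1 D2, of x]] by simp
      have a: "0 \<le> a" "a \<le> l" using False l by (auto simp: a_def)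
      have "a = 0 \<or> \<Psi> (p + l - a) = 0" using y by (auto simp: a_def max_def)
      moreover have "u t = complex_of_real (if a \<le> t \<and> t \<le> l then \<Psi> (p + l - t) else 0)" if "t \<in> {0..l}" for t
        using u[OF that] that bwd by (auto simp: edge_coord_def a_def)
      ultimately have P: "continuous_on {0..l} u" "u \<in> H1_interval l" "continuous_on {0..l} f \<Longrightarrow> f \<in> H1_interval l \<Longrightarrow>
         (LINT x|edge_measure l. weak_deriv l f x * weak_deriv l u x) - complex_of_real (k\<^sup>2) * (LINT x|edge_measure l. f x * u x) =
          f l * complex_of_real (- \<Psi>' (p + l - l)) - f a * complex_of_real (- \<Psi>' (p + l - a))"
        using edge_piece_form(1)[of a l l "\<lambda>t. \<Psi> (p + l - t)" "\<lambda>t. - \<Psi>' (p + l - t)" "\<lambda>t. - k\<^sup>2 * \<Psi> (p + l - t)" k u] edge_piece_form(2)[of a l l "\<lambda>t. \<Psi> (p + l - t)" "\<lambda>t. - \<Psi>' (p + l - t)" "\<lambda>t. - k\<^sup>2 * \<Psi> (p + l - t)" k u]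
          edge_piece_form(3)[of a l l "\<lambda>t. \<Psi> (p + l - t)" "\<lambda>t. - \<Psi>' (p + l - t)" "\<lambda>t. - k\<^sup>2 * \<Psi> (p + l - t)" k u f] a 2 3
        by blast+
      have "p + l - a = min y (p + l)" "edge_param fwd p l (min y (p + l)) = a" "edge_param fwd p l p = l"
        using bwd by (auto simp: a_def edge_param_def min_def max_def)
      then show ?thesis using P False by simp
    qed
  qed
  then show "continuous_on {0..l} u" "u \<in> H1_interval l"
    "continuous_on {0..l} f \<Longrightarrow> f \<in> H1_interval l \<Longrightarrow>
       (LINT x|edge_measure l. weak_deriv l f x * weak_deriv l u x) - complex_of_real (k\<^sup>2) * (LINT x|edge_measure l. f x * u x) = ?B f"
    by blast+
qed

lemma is_weak_deriv_cnj:
  assumes "is_weak_deriv l u g"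
  shows "is_weak_deriv l (\<lambda>x. cnj (u x)) (\<lambda>x. cnj (g x))"
  unfolding is_weak_deriv_def
proof (intro allI impI)
  fix \<phi> assume "test_fun l \<phi>"
  then have "cnj (LINT x|edge_measure l. u x * complex_of_real (deriv \<phi> x)) = cnj (- (LINT x|edge_measure l. g x * complex_of_real (\<phi> x)))"
    using assms by (simp add: is_weak_deriv_def)
  then show "(LINT x|edge_measure l. cnj (u x) * complex_of_real (deriv \<phi> x)) = - (LINT x|edge_measure l. cnj (g x) * complex_of_real (\<phi> x))"
    by (simp flip: Bochner_Integration.integral_cnj)
qed

text \<open>The representative chosen by \<open>SOME\<close> need not be real everywhere, but its
  conjugate is a weak derivative of the same function. This allows the conjugate to be dropped in
  \<open>free_form_real\<close>.\<close>

lemma weak_deriv_real: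
  assumes u: "continuous_on {0..l} u" "u \<in> H1_interval l" and real: "\<And>x. cnj (u x) = u x"
  shows "AE x in edge_measure l. cnj (weak_deriv l u x) = weak_deriv l u x"
proof (rule is_weak_deriv_unique[OF u(1)])
  show "is_weak_deriv l u (\<lambda>x. cnj (weak_deriv l u x))"
    using is_weak_deriv_cnj[OF H1_weak_deriv(2)[OF u(2)]] by (simp add: real)
qed (intro L2_cnj H1_weak_deriv u)+

context covered_metric_graph
begin

section \<open>Estimates for the perturbation\<close>

definition pert :: "('b \<Rightarrow> real \<Rightarrow> real) \<Rightarrow> ('a \<Rightarrow> real) \<Rightarrow> 'b graph_fun \<Rightarrow> 'b graph_fun \<Rightarrow> complex" where
  "pert q \<sigma> f g = (\<Sum>e\<in>arcs G. LINT x|edge_measure (len e). complex_of_real (q e x) * f e x * cnj (g e x)) +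
     (\<Sum>v\<in>verts G. complex_of_real (\<sigma> v) * vval f v * cnj (vval g v))"

definition pert_norm :: "('b \<Rightarrow> real \<Rightarrow> real) \<Rightarrow> ('a \<Rightarrow> real) \<Rightarrow> real" where
  "pert_norm q \<sigma> = (\<Sum>e\<in>arcs G. LINT x|edge_measure (len e). \<bar>q e x\<bar>) + (\<Sum>v\<in>verts G. \<bar>\<sigma> v\<bar>)"

lemma form_split: "form q \<sigma> f g = form (\<lambda>e x. 0) (\<lambda>v. 0) f g + pert q \<sigma> f g"
  by (simp add: schroedinger_form_def pert_def)

lemma pert_lincomb:
  assumes "bounded_potential q" "f \<in> H1" "g \<in> H1" "h \<in> H1"
  shows "pert q \<sigma> (lincomb a f b g) h = a * pert q \<sigma> f h + b * pert q \<sigma> g h"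
proof -
  have *: "pert q \<sigma> f g = form q \<sigma> f g - form (\<lambda>e x. 0) (\<lambda>v. 0) f g" for f g
    by (subst form_split) (rule add_diff_cancel_left'[symmetric])
  show ?thesis
    unfolding * form_lincomb[OF assms] form_lincomb[OF bounded_potential_zero assms(2-)] by (simp add: algebra_simps)
qed

lemma bounded_potential_integrable:
  assumes "bounded_potential q" "e \<in> arcs G"
  shows "integrable (edge_measure (len e)) (q e)"
proof -
  obtain C where "q e \<in> borel_measurable (edge_measure (len e))" "AE x in edge_measure (len e). \<bar>q e x\<bar> \<le> C"
    using assms by (auto simp: bounded_potential_def Linfty_def)
  then show ?thesis by (intro edge_AE_bounded_integrable[of "q e" _ C]) simp_all
qed

lemma pert_norm_nonneg: "0 \<le> pert_norm q \<sigma>"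
  unfolding pert_norm_def by (intro add_nonneg_nonneg sum_nonneg) auto

lemma vertex_le:
  assumes f: "f \<in> H1" and le: "\<And>e x. e \<in> arcs G \<Longrightarrow> x \<in> {0..len e} \<Longrightarrow> cmod (f e x) \<le> F" and v: "v \<in> verts G"
  shows "cmod (vval f v) \<le> F"
proof -
  obtain e where "e \<in> arcs G" "tail G e = v \<or> head G e = v" using incident[OF v] by auto
  then show ?thesis
    using le[of e 0] le[of e "len e"] len_pos[of e] vertex_value[OF f, of e] by (auto simp: less_imp_le)
qed

lemma pert_bound:
  assumes q: "bounded_potential q" and f: "f \<in> H1" and g: "g \<in> H1"
    and F: "\<And>e x. e \<in> arcs G \<Longrightarrow> x \<in> {0..len e} \<Longrightarrow> cmod (f e x) \<le> F" "0 \<le> F"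
    and P: "\<And>e x. e \<in> arcs G \<Longrightarrow> x \<in> {0..len e} \<Longrightarrow> cmod (g e x) \<le> P" "0 \<le> P"
  shows "cmod (pert q \<sigma> f g) \<le> pert_norm q \<sigma> * (F * P)"
proof -
  have "cmod (\<Sum>e\<in>arcs G. LINT x|edge_measure (len e). complex_of_real (q e x) * f e x * cnj (g e x))
     \<le> (\<Sum>e\<in>arcs G. (LINT x|edge_measure (len e). \<bar>q e x\<bar>) * (F * P))"
  proof (rule sum_norm_le)
    fix e assume e: "e \<in> arcs G"
    have "cmod (LINT x|edge_measure (len e). complex_of_real (q e x) * f e x * cnj (g e x)) \<le> (LINT x|edge_measure (len e). \<bar>q e x\<bar> * (F * P))"
    proof (rule Bochner_Integration.integral_norm_bound_integral)
      show "integrable (edge_measure (len e)) (\<lambda>x. complex_of_real (q e x) * f e x * cnj (g e x))"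
        by (intro L2_mult_integrable bounded_potential_mult_L2[OF q e] L2_cnj H1D(5)[OF f e] H1D(5)[OF g e])
      show "integrable (edge_measure (len e)) (\<lambda>x. \<bar>q e x\<bar> * (F * P))"
        using bounded_potential_integrable[OF q e] by simp
      fix x assume "x \<in> space (edge_measure (len e))"
      then have x: "x \<in> {0..len e}" by simp
      have "cmod (f e x) * cmod (g e x) \<le> F * P"
        by (intro mult_mono F(1)[OF e x] P(1)[OF e x] F(2)) simp
      then show "cmod (complex_of_real (q e x) * f e x * cnj (g e x)) \<le> \<bar>q e x\<bar> * (F * P)"
        by (simp add: norm_mult mult.assoc mult_left_mono)
    qed
    then show "cmod (LINT x|edge_measure (len e). complex_of_real (q e x) * f e x * cnj (g e x)) \<le> (LINT x|edge_measure (len e). \<bar>q e x\<bar>) * (F * P)"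
      by simp
  qed
  moreover have "cmod (\<Sum>v\<in>verts G. complex_of_real (\<sigma> v) * vval f v * cnj (vval g v)) \<le> (\<Sum>v\<in>verts G. \<bar>\<sigma> v\<bar> * (F * P))"
  proof (rule sum_norm_le)
    fix v assume v: "v \<in> verts G"
    have "cmod (vval f v) * cmod (vval g v) \<le> F * P"
      by (intro mult_mono vertex_le[OF f F(1) v] vertex_le[OF g P(1) v] F(2)) simp_all
    then show "cmod (complex_of_real (\<sigma> v) * vval f v * cnj (vval g v)) \<le> \<bar>\<sigma> v\<bar> * (F * P)"
      by (simp add: norm_mult mult.assoc mult_left_mono)
  qed
  ultimately show ?thesis
    unfolding pert_def pert_norm_def distrib_right sum_distrib_right
    by (rule norm_triangle_mono)
qed

text \<open>No complex conjugate occurs because the second argument will be real-valued.\<close>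

definition edge_form :: "real \<Rightarrow> real \<Rightarrow> (real \<Rightarrow> complex) \<Rightarrow> (real \<Rightarrow> complex) \<Rightarrow> complex" where
  "edge_form k l f u = (LINT x|edge_measure l. weak_deriv l f x * weak_deriv l u x)
     - complex_of_real (k\<^sup>2) * (LINT x|edge_measure l. f x * u x)"

lemma edge_form_lincomb:
  assumes f: "continuous_on {0..l} f" "f \<in> H1_interval l"
    and u: "continuous_on {0..l} u" "u \<in> H1_interval l" and v: "continuous_on {0..l} v" "v \<in> H1_interval l"
  shows "edge_form k l f (\<lambda>x. a * u x + b * v x) = a * edge_form k l f u + b * edge_form k l f v"
proof -
  note L = H1_weak_deriv(1)[OF f(2)] H1_weak_deriv(1)[OF u(2)] H1_weak_deriv(1)[OF v(2)]
    H1_weak_deriv(1)[OF H1_interval_lincomb(1)[OF u(2,1) v(2,1), of a b]]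
  note C = L2_continuous[OF f(1)] L2_continuous[OF u(1)] L2_continuous[OF v(1)]
  note [measurable] = L[THEN L2_measurable]
  have "(LINT x|edge_measure l. weak_deriv l f x * weak_deriv l (\<lambda>x. a * u x + b * v x) x) =
    (LINT x|edge_measure l. a * (weak_deriv l f x * weak_deriv l u x) + b * (weak_deriv l f x * weak_deriv l v x))"
  proof (rule integral_cong_AE)
    show "AE x in edge_measure l. weak_deriv l f x * weak_deriv l (\<lambda>x. a * u x + b * v x) x =
      a * (weak_deriv l f x * weak_deriv l u x) + b * (weak_deriv l f x * weak_deriv l v x)"
      using H1_interval_lincomb(2)[OF u(2,1) v(2,1), of a b] by eventually_elim (simp add: algebra_simps)
  qed measurable
  also have "\<dots> = a * (LINT x|edge_measure l. weak_deriv l f x * weak_deriv l u x) + b * (LINT x|edge_measure l. weak_deriv l f x * weak_deriv l v x)"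
    by (subst Bochner_Integration.integral_add[OF integrable_mult_right[OF L2_mult_integrable[OF L(1,2)]]
        integrable_mult_right[OF L2_mult_integrable[OF L(1,3)]]]) simp
  finally have 1: "(LINT x|edge_measure l. weak_deriv l f x * weak_deriv l (\<lambda>x. a * u x + b * v x) x) = \<dots>" .
  have "(LINT x|edge_measure l. f x * (a * u x + b * v x)) = (LINT x|edge_measure l. a * (f x * u x) + b * (f x * v x))"
    by (simp add: algebra_simps)
  also have "\<dots> = a * (LINT x|edge_measure l. f x * u x) + b * (LINT x|edge_measure l. f x * v x)"
    by (subst Bochner_Integration.integral_add[OF integrable_mult_right[OF L2_mult_integrable[OF C(1,2)]]
        integrable_mult_right[OF L2_mult_integrable[OF C(1,3)]]]) simp
  finally have 2: "(LINT x|edge_measure l. f x * (a * u x + b * v x)) = \<dots>" .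
  show ?thesis unfolding edge_form_def 1 2 by (simp add: algebra_simps)
qed

lemma free_form_real:
  assumes f: "f \<in> H1" and \<phi>: "\<phi> \<in> H1" and real: "\<And>e x. cnj (\<phi> e x) = \<phi> e x"
  shows "form (\<lambda>e x. 0 - k\<^sup>2) (\<lambda>v. 0) f \<phi> = (\<Sum>e\<in>arcs G. edge_form k (len e) (f e) (\<phi> e))"
proof -
  have "(LINT x|edge_measure (len e). weak_deriv (len e) (f e) x * cnj (weak_deriv (len e) (\<phi> e) x)) =
    (LINT x|edge_measure (len e). weak_deriv (len e) (f e) x * weak_deriv (len e) (\<phi> e) x)" if e: "e \<in> arcs G" for e
  proof (rule integral_cong_AE)
    note [measurable] = H1D(3)[OF f e, THEN L2_measurable] H1D(3)[OF \<phi> e, THEN L2_measurable]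
      L2_cnj[OF H1D(3)[OF \<phi> e], THEN L2_measurable]
    show "(\<lambda>x. weak_deriv (len e) (f e) x * cnj (weak_deriv (len e) (\<phi> e) x)) \<in> borel_measurable (edge_measure (len e))"
      "(\<lambda>x. weak_deriv (len e) (f e) x * weak_deriv (len e) (\<phi> e) x) \<in> borel_measurable (edge_measure (len e))"
      by measurable
    show "AE x in edge_measure (len e). weak_deriv (len e) (f e) x * cnj (weak_deriv (len e) (\<phi> e) x) =
      weak_deriv (len e) (f e) x * weak_deriv (len e) (\<phi> e) x"
      using weak_deriv_real[OF H1D(1,2)[OF \<phi> e] real] by eventually_elim simp
  qed
  then show ?thesis
    unfolding form_shift[OF bounded_potential_zero f \<phi>]
    by (simp add: schroedinger_form_def L2_inner_def edge_form_def real sum_subtractf sum_distrib_left)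
qed

lemma pert_small:
  assumes q: "bounded_potential q" and k: "k > 0" "4 * pert_norm q \<sigma> \<le> k" and arcs: "arcs G \<noteq> {}"
    and f: "f \<in> eigenspace G len q \<sigma> \<mu>" "f \<noteq> 0"
    and w: "w \<in> eigenspace G len (\<lambda>e x. 0) (\<lambda>v. 0) \<mu>" "\<And>e x. e \<in> arcs G \<Longrightarrow> x \<in> {0..len e} \<Longrightarrow> cmod (w e x) \<le> 1"
    and close: "\<And>M e x. (\<And>e x. e \<in> arcs G \<Longrightarrow> x \<in> {0..len e} \<Longrightarrow> cmod (f e x) \<le> M) \<Longrightarrow>
      e \<in> arcs G \<Longrightarrow> x \<in> {0..len e} \<Longrightarrow> cmod (f e x - c * w e x) \<le> pert_norm q \<sigma> * (M * (2 / k))"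
  shows "cmod (pert q \<sigma> w w) \<le> 4 * (pert_norm q \<sigma>)\<^sup>2 / k"
proof -
  have fH: "f \<in> H1" using f(1) unfolding eigenspace_iff[OF q] by simp
  have wH: "w \<in> H1" using w(1) unfolding eigenspace_iff[OF bounded_potential_zero] by simp
  define S where "S = {cmod (f e x) | e x. e \<in> arcs G \<and> x \<in> {0..len e}}"
  obtain \<delta> where \<delta>: "\<delta> > 0" "\<And>e. e \<in> arcs G \<Longrightarrow> \<delta> \<le> len e" by (rule min_length) blast
  have "s \<le> sqrt (2 / \<delta> * mass f + 2 * \<delta> * energy f)" if "s \<in> S" for s
    using that H1_sup_bound[OF fH \<delta>] unfolding S_def by (auto intro!: real_le_rsqrt)
  then have bdd: "bdd_above S" by (rule bdd_aboveI)
  have ne: "S \<noteq> {}"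
  proof -
    obtain e where "e \<in> arcs G" using arcs by auto
    then have "cmod (f e 0) \<in> S" using len_pos[of e] unfolding S_def by (intro CollectI exI conjI refl) auto
    then show ?thesis by blast
  qed
  define M where "M = Sup S"
  have M: "cmod (f e x) \<le> M" if "e \<in> arcs G" "x \<in> {0..len e}" for e x
    unfolding M_def by (rule cSup_upper[OF _ bdd]) (use that in \<open>auto simp: S_def\<close>)
  have M0: "0 \<le> M"
  proof -
    obtain e where e: "e \<in> arcs G" using arcs by auto
    have "0 \<le> cmod (f e 0)" by simp
    also have "\<dots> \<le> M" by (rule M[OF e]) (use len_pos[OF e] in simp)
    finally show ?thesis .
  qed
  define A where "A = pert_norm q \<sigma>"
  have A: "0 \<le> A" "4 * A \<le> k" using pert_norm_nonneg k by (auto simp: A_def)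
  \<comment> \<open>The lower bound on \<open>k\<close> is designed for this: the error takes at
    most half of the sup norm.\<close>
  have K: "A * (M * (2 / k)) \<le> M / 2"
    using mult_right_mono[OF A(2) M0] k(1) by (simp add: field_simps)
  have "M \<le> cmod c + M / 2"
    unfolding M_def
  proof (rule cSup_least[OF ne])
    fix s assume "s \<in> S"
    then obtain e x where ex: "e \<in> arcs G" "x \<in> {0..len e}" "s = cmod (f e x)" by (auto simp: S_def)
    have "cmod (f e x) \<le> cmod (c * w e x) + cmod (f e x - c * w e x)"
      using norm_triangle_ineq[of "c * w e x" "f e x - c * w e x"] by simp
    also have "\<dots> \<le> cmod c + M / 2"
      using close[OF M ex(1,2)] K w(2)[OF ex(1,2)]
      by (intro add_mono) (auto simp: norm_mult A_def mult_left_le)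
    finally show "s \<le> cmod c + Sup S / 2" using ex(3) by (simp add: M_def)
  qed
  then have Mc: "M \<le> 2 * cmod c" by simp
  \<comment> \<open>Otherwise the sup norm of \<open>f\<close> would vanish, and with it
    \<open>f\<close>; this permits division by |c| at the end.\<close>
  have "c \<noteq> 0"
  proof
    assume "c = 0"
    then have "M \<le> 0" using Mc by simp
    have "f e x = 0" for e x
    proof (cases "e \<in> arcs G \<and> x \<in> {0..len e}")
      case True
      then have "cmod (f e x) \<le> M" by (intro M) simp_all
      from order_trans[OF this \<open>M \<le> 0\<close>] show ?thesis by (simp only: norm_le_zero_iff)
    next
      case False
      then show ?thesis using fH unfolding H1_graph_def C_graph_def by blast
    qed
    then have "f = 0" by (simp add: fun_eq_iff)
    with f(2) show False by simp
  qed
  have "A * (M * (2 / k)) \<le> A * (2 * cmod c * (2 / k))"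
    using Mc A(1) k(1) by (intro mult_left_mono mult_right_mono) auto
  then have d: "cmod (lincomb 1 f (- c) w e x) \<le> A * (2 * cmod c * (2 / k))" if "e \<in> arcs G" "x \<in> {0..len e}" for e x
    using close[OF M that] by (simp add: lincomb_def A_def)
  have "cmod (pert q \<sigma> (lincomb 1 f (- c) w) w) \<le> pert_norm q \<sigma> * ((A * (2 * cmod c * (2 / k))) * 1)"
    by (rule pert_bound[OF q H1_lincomb(1)[OF fH wH] wH d _ w(2)]) (use A k in auto)
  moreover have "pert q \<sigma> (lincomb 1 f (- c) w) w = - (c * pert q \<sigma> w w)"
    using eigenfunctions_perturbation_zero[OF q f(1) w(1)]
    by (simp add: pert_lincomb[OF q fH wH wH] pert_def[of q \<sigma> f w])
  ultimately have "cmod c * cmod (pert q \<sigma> w w) \<le> cmod c * (4 * A\<^sup>2 / k)"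
    by (simp add: norm_mult A_def power2_eq_square mult_ac)
  from mult_left_le_imp_le[OF this] \<open>c \<noteq> 0\<close> show ?thesis by (simp only: A_def zero_less_norm_iff simp_thms)
qed

end

text \<open>A line graph is laid out along \<open>[0, tlen]\<close>: the arc \<open>ed i\<close> joins \<open>vx i\<close> to \<open>vx (Suc i)\<close>, in
  either orientation. A cycle is laid out with \<open>vx 0 = vx m\<close>.\<close>

locale line_coordinates = covered_metric_graph +
  fixes m :: nat and ed :: "nat \<Rightarrow> 'b" and vx :: "nat \<Rightarrow> 'a"
  assumes m_pos: "0 < m"
    and ed_bij: "bij_betw ed {..<m} (arcs G)"
    and ed_ends: "i < m \<Longrightarrow> {tail G (ed i), head G (ed i)} = {vx i, vx (Suc i)}"
    and vx_verts: "vx ` {..m} = verts G"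
begin

definition pos :: "nat \<Rightarrow> real" where "pos i = (\<Sum>j<i. len (ed j))"

abbreviation "tlen \<equiv> pos m"

definition idx :: "'b \<Rightarrow> nat" where "idx e = inv_into {..<m} ed e"

definition fwd :: "'b \<Rightarrow> bool" where "fwd e \<longleftrightarrow> tail G e = vx (idx e)"

definition crd :: "'b \<Rightarrow> real \<Rightarrow> real" where
  "crd e = edge_coord (fwd e) (pos (idx e)) (len e)"

definition par :: "nat \<Rightarrow> real \<Rightarrow> real" where
  "par i = edge_param (fwd (ed i)) (pos i) (len (ed i))"

text \<open>Transports a function of the line coordinate to the graph, truncated after
  \<open>y\<close>; \<open>y = tlen\<close> means no truncation. The zero off the closed edges is
  the representative required by \<open>C_graph\<close>.\<close>

definition cut :: "(real \<Rightarrow> real) \<Rightarrow> real \<Rightarrow> 'b graph_fun" where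
  "cut \<Psi> y e t = (if e \<in> arcs G \<and> t \<in> {0..len e} then complex_of_real (if crd e t \<le> y then \<Psi> (crd e t) else 0) else 0)"

lemma ed_arcs: "i < m \<Longrightarrow> ed i \<in> arcs G"
  using ed_bij by (auto simp: bij_betw_def)

lemma idx_ed: "i < m \<Longrightarrow> idx (ed i) = i"
  using ed_bij by (auto simp: bij_betw_def idx_def)

lemma arc_cases:
  assumes "e \<in> arcs G"
  obtains i where "i < m" "e = ed i"
  using assms ed_bij by (auto simp: bij_betw_def)

lemma len_ed: "i < m \<Longrightarrow> 0 < len (ed i)"
  by (simp add: ed_arcs len_pos)

lemma pos_Suc: "pos (Suc i) = pos i + len (ed i)"
  by (simp add: pos_def)

lemma pos_0: "pos 0 = 0"
  by (simp add: pos_def)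

lemma pos_mono: "i \<le> j \<Longrightarrow> j \<le> m \<Longrightarrow> pos i \<le> pos j"
proof (induction j)
  case (Suc j)
  then show ?case
    using len_ed[of j] by (cases "i = Suc j") (auto simp: pos_Suc)
qed simp

lemma pos_strict_mono: "i < j \<Longrightarrow> j \<le> m \<Longrightarrow> pos i < pos j"
  using pos_mono[of "Suc i" j] len_ed[of i] by (simp add: pos_Suc)

lemma tlen_pos: "0 < tlen"
  using pos_strict_mono[of 0 m] m_pos by (simp add: pos_0)

lemma vx_in: "i \<le> m \<Longrightarrow> vx i \<in> verts G"
  using vx_verts by auto

lemma ends_cases:
  assumes "i < m"
  shows "tail G (ed i) = (if fwd (ed i) then vx i else vx (Suc i))"
    "head G (ed i) = (if fwd (ed i) then vx (Suc i) else vx i)"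
  using ed_ends[OF assms] by (auto simp: fwd_def idx_ed assms doubleton_eq_iff)

lemma crd_ends:
  assumes "i < m"
  shows "crd (ed i) 0 = (if fwd (ed i) then pos i else pos (Suc i))"
    "crd (ed i) (len (ed i)) = (if fwd (ed i) then pos (Suc i) else pos i)"
  using assms by (simp_all add: crd_def edge_coord_def idx_ed pos_Suc)

lemma crd_bounds:
  assumes "i < m" "t \<in> {0..len (ed i)}"
  shows "pos i \<le> crd (ed i) t" "crd (ed i) t \<le> pos (Suc i)"
  using assms by (auto simp: crd_def edge_coord_def idx_ed pos_Suc)

lemma crd_range:
  assumes "e \<in> arcs G" "t \<in> {0..len e}"
  shows "0 \<le> crd e t" "crd e t \<le> tlen"
proof -
  obtain i where i: "i < m" "e = ed i" using assms(1) by (rule arc_cases)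
  show "0 \<le> crd e t" "crd e t \<le> tlen"
    using crd_bounds[of i t] pos_mono[of 0 i] pos_mono[of "Suc i" m] i assms by (auto simp: pos_0)
qed

lemma par_crd:
  assumes "i < m" "t \<in> {0..len (ed i)}"
  shows "par i (crd (ed i) t) = t"
  using assms by (simp add: crd_def par_def edge_coord_def edge_param_def idx_ed)

lemma value_at_vertices:
  assumes f: "f \<in> H1" and i: "i < m"
  shows "f (ed i) (par i (pos i)) = vval f (vx i)"
    "f (ed i) (par i (pos (Suc i))) = vval f (vx (Suc i))"
  using vertex_value[OF f ed_arcs[OF i]] ends_cases[OF i]
  by (auto simp: par_def edge_param_def pos_Suc split: if_splits)

lemma exists_point:
  assumes "0 \<le> z" "z \<le> tlen"
  obtains e t where "e \<in> arcs G" "t \<in> {0..len e}" "crd e t = z"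
proof -
  have "\<exists>i<m. pos i \<le> z \<and> z \<le> pos (Suc i)"
  proof (rule ccontr)
    assume *: "\<not> (\<exists>i<m. pos i \<le> z \<and> z \<le> pos (Suc i))"
    have "i \<le> m \<Longrightarrow> pos i \<le> z" for i
    proof (induction i)
      case (Suc i)
      then show ?case using * by (metis Suc_le_lessD less_imp_le_nat linorder_le_cases)
    qed (simp add: pos_0 assms)
    then have "pos (Suc (m - 1)) = z" "pos (m - 1) \<le> z" using assms m_pos by (auto intro: antisym)
    then show False using * m_pos by (metis Suc_pred' diff_Suc_1 lessI order_refl)
  qed
  then obtain i where i: "i < m" "pos i \<le> z" "z \<le> pos (Suc i)" by auto
  show thesis
    by (rule that[of "ed i" "par i z"])
       (use i ed_arcs[OF i(1)] in \<open>auto simp: crd_def par_def edge_coord_def edge_param_def idx_ed pos_Suc\<close>)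
qed

lemma cut_edge:
  assumes D: "\<And>x. (\<Psi> has_real_derivative \<Psi>' x) (at x)" "\<And>x. (\<Psi>' has_real_derivative - k\<^sup>2 * \<Psi> x) (at x)"
    and y: "tlen \<le> y \<or> \<Psi> y = 0" and i: "i < m"
  shows "continuous_on {0..len (ed i)} (cut \<Psi> y (ed i))" "cut \<Psi> y (ed i) \<in> H1_interval (len (ed i))"
    "f \<in> H1 \<Longrightarrow> edge_form k (len (ed i)) (f (ed i)) (cut \<Psi> y (ed i)) =
       (if y \<le> pos i then 0 else
         f (ed i) (par i (min y (pos (Suc i)))) * complex_of_real (\<Psi>' (min y (pos (Suc i)))) -
         vval f (vx i) * complex_of_real (\<Psi>' (pos i)))"
proof -
  have y': "pos i + len (ed i) \<le> y \<or> \<Psi> y = 0"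
    using y pos_mono[of "Suc i" m] i by (auto simp: pos_Suc)
  have u: "cut \<Psi> y (ed i) t = complex_of_real (if edge_coord (fwd (ed i)) (pos i) (len (ed i)) t \<le> y
      then \<Psi> (edge_coord (fwd (ed i)) (pos i) (len (ed i)) t) else 0)" if "t \<in> {0..len (ed i)}" for t
    using that ed_arcs[OF i] i by (simp add: cut_def crd_def idx_ed)
  note P = oriented_edge_piece[OF len_ed[OF i] D y' u]
  show "continuous_on {0..len (ed i)} (cut \<Psi> y (ed i))" "cut \<Psi> y (ed i) \<in> H1_interval (len (ed i))"
    by (rule P(1), assumption) (rule P(2), assumption)
  assume f: "f \<in> H1"
  show "edge_form k (len (ed i)) (f (ed i)) (cut \<Psi> y (ed i)) =
       (if y \<le> pos i then 0 else
         f (ed i) (par i (min y (pos (Suc i)))) * complex_of_real (\<Psi>' (min y (pos (Suc i)))) -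
         vval f (vx i) * complex_of_real (\<Psi>' (pos i)))"
    using P(3)[where f="f (ed i)"] H1D(1,2)[OF f ed_arcs[OF i]] value_at_vertices(1)[OF f i]
    unfolding edge_form_def par_def pos_Suc by simp
qed

lemma sum_arcs: "(\<Sum>e\<in>arcs G. F e) = (\<Sum>i<m. F (ed i))"
  by (rule sum.reindex_bij_betw[OF ed_bij, symmetric])

text \<open>Boundary terms of consecutive edges cancel at their common vertex, where
  \<open>f\<close> has a single value, so the sum telescopes to the two ends of the layout.\<close>

lemma cut_total_sum:
  assumes D: "\<And>x. (\<Psi> has_real_derivative \<Psi>' x) (at x)" "\<And>x. (\<Psi>' has_real_derivative - k\<^sup>2 * \<Psi> x) (at x)"
    and f: "f \<in> H1"
  shows "(\<Sum>e\<in>arcs G. edge_form k (len e) (f e) (cut \<Psi> tlen e)) =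
    vval f (vx m) * complex_of_real (\<Psi>' tlen) - vval f (vx 0) * complex_of_real (\<Psi>' 0)"
proof -
  have "edge_form k (len (ed i)) (f (ed i)) (cut \<Psi> tlen (ed i)) =
     vval f (vx (Suc i)) * complex_of_real (\<Psi>' (pos (Suc i))) - vval f (vx i) * complex_of_real (\<Psi>' (pos i))" if i: "i < m" for i
  proof -
    have "pos i < tlen" "min tlen (pos (Suc i)) = pos (Suc i)"
      using pos_strict_mono[of i m] pos_mono[of "Suc i" m] i by auto
    then show ?thesis
      using cut_edge(3)[OF D _ i f, of tlen] value_at_vertices(2)[OF f i] by simp
  qed
  then have "(\<Sum>e\<in>arcs G. edge_form k (len e) (f e) (cut \<Psi> tlen e)) =
     (\<Sum>i<m. vval f (vx (Suc i)) * complex_of_real (\<Psi>' (pos (Suc i))) - vval f (vx i) * complex_of_real (\<Psi>' (pos i)))"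
    unfolding sum_arcs by (intro sum.cong) auto
  also have "\<dots> = vval f (vx m) * complex_of_real (\<Psi>' (pos m)) - vval f (vx 0) * complex_of_real (\<Psi>' (pos 0))"
    by (rule sum_lessThan_telescope)
  finally show ?thesis by (simp add: pos_0)
qed

lemma cut_point_sum:
  assumes D: "\<And>x. (\<Psi> has_real_derivative \<Psi>' x) (at x)" "\<And>x. (\<Psi>' has_real_derivative - k\<^sup>2 * \<Psi> x) (at x)"
    and f: "f \<in> H1" and e: "e \<in> arcs G" "t \<in> {0..len e}" and 0: "\<Psi> (crd e t) = 0"
  shows "(\<Sum>e'\<in>arcs G. edge_form k (len e') (f e') (cut \<Psi> (crd e t) e')) =
    f e t * complex_of_real (\<Psi>' (crd e t)) - vval f (vx 0) * complex_of_real (\<Psi>' 0)"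
proof -
  obtain j where j: "j < m" "e = ed j" using e(1) by (rule arc_cases)
  define y where "y = crd e t"
  have y: "pos j \<le> y" "y \<le> pos (Suc j)" "par j y = t"
    using crd_bounds[of j t] par_crd[of j t] j e by (auto simp: y_def)
  define F where "F i = vval f (vx i) * complex_of_real (\<Psi>' (pos i))" for i
  define R where "R = f e t * complex_of_real (\<Psi>' y)"
  define T where "T i = edge_form k (len (ed i)) (f (ed i)) (cut \<Psi> y (ed i))" for i
  note C = cut_edge(3)[OF D _ _ f, of y, folded T_def]
  have 1: "T i = F (Suc i) - F i" if "i < j" for i
  proof -
    have "pos i < y" "min y (pos (Suc i)) = pos (Suc i)"
      using pos_strict_mono[of i j] pos_mono[of "Suc i" j] that j y by auto
    then show ?thesis
      using C[of i] value_at_vertices(2)[OF f, of i] that j 0 by (simp add: F_def y_def)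
  qed
  \<comment> \<open>The edge carrying the cut point. A cut exactly at its left end makes the edge
    contribute zero, in agreement with the formula because then R = F j.\<close>
  have 2: "T j = R - F j"
  proof (cases "y \<le> pos j")
    case True
    then have "y = pos j" using y by simp
    then have "R = F j" using value_at_vertices(1)[OF f j(1)] y(3) j(2) by (simp add: R_def F_def)
    then show ?thesis using C[of j] True j 0 by (simp add: y_def)
  next
    case False
    then show ?thesis using C[of j] j 0 y by (simp add: F_def R_def y_def)
  qed
  have 3: "T i = 0" if "i < m" "j < i" for i
  proof -
    have "y \<le> pos i" using y(2) pos_mono[of "Suc j" i] that by simp
    then show ?thesis using C[of i] that 0 by (simp add: y_def)
  qed
  have "(\<Sum>i<m. T i) = (\<Sum>i<Suc j. T i)"
    by (rule sum.mono_neutral_right) (use j 3 in auto)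
  also have "\<dots> = (\<Sum>i<j. F (Suc i) - F i) + (R - F j)"
    using 1 2 by simp
  also have "\<dots> = R - F 0"
    by (simp add: sum_lessThan_telescope)
  finally show ?thesis
    unfolding sum_arcs T_def F_def R_def by (simp add: y_def pos_0)
qed

text \<open>Consistency has content only where two positions carry the same vertex, that is at the
  two ends of a layout closed to a cycle.\<close>

lemma H1_from_coordinates:
  assumes \<phi>: "\<And>e. e \<in> arcs G \<Longrightarrow> continuous_on {0..len e} (\<phi> e)" "\<And>e. e \<in> arcs G \<Longrightarrow> \<phi> e \<in> H1_interval (len e)"
    and val: "\<And>e t. e \<in> arcs G \<Longrightarrow> t \<in> {0..len e} \<Longrightarrow> \<phi> e t = \<Theta> (crd e t)"
    and out: "\<And>e t. e \<notin> arcs G \<or> t \<notin> {0..len e} \<Longrightarrow> \<phi> e t = 0"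
    and consistent: "\<And>i j. i \<le> m \<Longrightarrow> j \<le> m \<Longrightarrow> vx i = vx j \<Longrightarrow> \<Theta> (pos i) = \<Theta> (pos j)"
  shows "\<phi> \<in> H1" "i \<le> m \<Longrightarrow> vval \<phi> (vx i) = \<Theta> (pos i)"
proof -
  \<comment> \<open>Any position of the vertex will do, by consistency.\<close>
  define F where "F v = \<Theta> (pos (SOME i. i \<le> m \<and> vx i = v))" for v
  have F: "F (vx i) = \<Theta> (pos i)" if "i \<le> m" for i
  proof -
    have "(SOME j. j \<le> m \<and> vx j = vx i) \<le> m \<and> vx (SOME j. j \<le> m \<and> vx j = vx i) = vx i"
      by (rule someI[of _ i]) (use that in simp)
    then show ?thesis unfolding F_def using consistent that by blast
  qed
  have ends: "\<phi> e 0 = F (tail G e)" "\<phi> e (len e) = F (head G e)" if e: "e \<in> arcs G" for e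
  proof -
    obtain i where i: "i < m" "e = ed i" using e by (rule arc_cases)
    show "\<phi> e 0 = F (tail G e)" "\<phi> e (len e) = F (head G e)"
      using val[OF e, of 0] val[OF e, of "len e"] len_pos[OF e] crd_ends[OF i(1)] ends_cases[OF i(1)] F[of i] F[of "Suc i"] i
      by auto
  qed
  show "\<phi> \<in> H1" by (rule H1I(1)[OF \<phi> ends out])
  show "vval \<phi> (vx i) = \<Theta> (pos i)" if "i \<le> m"
    unfolding F[OF that, symmetric] by (rule H1I(2)[OF \<phi> ends out vx_in[OF that]])
qed

text \<open>After telescoping only the end terms remain. They vanish for Neumann conditions at both
  ends and cancel for periodic ones, which are the two alternatives in
  \<open>boundary\<close>.\<close>

lemma free_eigenfunction:
  assumes D: "\<And>x. (\<Psi> has_real_derivative \<Psi>' x) (at x)" "\<And>x. (\<Psi>' has_real_derivative - k\<^sup>2 * \<Psi> x) (at x)"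
    and consistent: "\<And>i j. i \<le> m \<Longrightarrow> j \<le> m \<Longrightarrow> vx i = vx j \<Longrightarrow> \<Psi> (pos i) = \<Psi> (pos j)"
    and boundary: "\<Psi>' tlen = 0 \<and> \<Psi>' 0 = 0 \<or> vx m = vx 0 \<and> \<Psi>' tlen = \<Psi>' 0"
  shows "cut \<Psi> tlen \<in> eigenspace G len (\<lambda>e x. 0) (\<lambda>v. 0) (k\<^sup>2)" "i \<le> m \<Longrightarrow> vval (cut \<Psi> tlen) (vx i) = complex_of_real (\<Psi> (pos i))"
    "cut \<Psi> tlen \<in> H1"
proof -
  have edge: "continuous_on {0..len e} (cut \<Psi> tlen e)" "cut \<Psi> tlen e \<in> H1_interval (len e)" if "e \<in> arcs G" for e
  proof -
    obtain i where i: "i < m" "e = ed i" using \<open>e \<in> arcs G\<close> by (rule arc_cases)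
    show "continuous_on {0..len e} (cut \<Psi> tlen e)" "cut \<Psi> tlen e \<in> H1_interval (len e)"
      using cut_edge(1,2)[OF D _ i(1), of tlen] i by simp_all
  qed
  have val: "cut \<Psi> tlen e t = complex_of_real (\<Psi> (crd e t))" if "e \<in> arcs G" "t \<in> {0..len e}" for e t
    using that crd_range[OF that] by (simp add: cut_def)
  have out: "cut \<Psi> tlen e t = 0" if "e \<notin> arcs G \<or> t \<notin> {0..len e}" for e t
    using that by (auto simp: cut_def)
  have cons: "complex_of_real (\<Psi> (pos i)) = complex_of_real (\<Psi> (pos j))" if "i \<le> m" "j \<le> m" "vx i = vx j" for i j
    using consistent[OF that] by simp
  note H = H1_from_coordinates[of "cut \<Psi> tlen" "\<lambda>x. complex_of_real (\<Psi> x)", OF edge val out cons]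
  show H1: "cut \<Psi> tlen \<in> H1" by (rule H(1))
  show "vval (cut \<Psi> tlen) (vx i) = complex_of_real (\<Psi> (pos i))" if "i \<le> m" by (rule H(2)) (use that in auto)
  have real: "cnj (cut \<Psi> tlen e t) = cut \<Psi> tlen e t" for e t by (simp add: cut_def)
  have "form (\<lambda>e x. 0 - k\<^sup>2) (\<lambda>v. 0) (cut \<Psi> tlen) f = 0" if f: "f \<in> H1" for f
  proof -
    have "form (\<lambda>e x. 0 - k\<^sup>2) (\<lambda>v. 0) (cut \<Psi> tlen) f = cnj (form (\<lambda>e x. 0 - k\<^sup>2) (\<lambda>v. 0) f (cut \<Psi> tlen))"
      by (rule form_hermitian)
    also have "form (\<lambda>e x. 0 - k\<^sup>2) (\<lambda>v. 0) f (cut \<Psi> tlen) =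
       vval f (vx m) * complex_of_real (\<Psi>' tlen) - vval f (vx 0) * complex_of_real (\<Psi>' 0)"
      unfolding free_form_real[OF f H1 real] by (rule cut_total_sum[OF D f])
    also have "\<dots> = 0" using boundary by auto
    finally show ?thesis by simp
  qed
  with H1 show "cut \<Psi> tlen \<in> eigenspace G len (\<lambda>e x. 0) (\<lambda>v. 0) (k\<^sup>2)"
    unfolding eigenspace_iff[OF bounded_potential_zero] by blast
qed

text \<open>The test function \<open>sin (k (y - x)) / k\<close>, cut off at \<open>y\<close>, turns the eigenvalue equation into a
  Volterra equation for \<open>f\<close>. On a cycle it jumps at \<open>0\<close>; subtracting \<open>c\<close> times the same function for
  another point \<open>z\<close> removes the jump.\<close>

lemma eigenfunction_asymptotics:
  assumes q: "bounded_potential q" and k: "k > 0" and f: "f \<in> eigenspace G len q \<sigma> (k\<^sup>2)"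
    and e: "e \<in> arcs G" "t \<in> {0..len e}" and e': "e' \<in> arcs G" "t' \<in> {0..len e'}"
    and c: "\<bar>c\<bar> \<le> 1"
    and consistent: "inj_on vx {..m} \<or> vx m = vx 0 \<and> inj_on vx {..<m} \<and> sin (k * crd e t) = c * sin (k * crd e' t')"
    and M: "\<And>e x. e \<in> arcs G \<Longrightarrow> x \<in> {0..len e} \<Longrightarrow> cmod (f e x) \<le> M" "0 \<le> M"
  shows "cmod ((f e t - vval f (vx 0) * complex_of_real (cos (k * crd e t)))
     - complex_of_real c * (f e' t' - vval f (vx 0) * complex_of_real (cos (k * crd e' t')))) \<le> pert_norm q \<sigma> * (M * (2 / k))"
proof -
  have fH: "f \<in> H1" and f0: "\<And>\<phi>. \<phi> \<in> H1 \<Longrightarrow> form (\<lambda>e x. q e x - k\<^sup>2) \<sigma> f \<phi> = 0"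
    using f unfolding eigenspace_iff[OF q] by auto
  \<comment> \<open>In x this solves the free equation with value 0 and slope -1 at x = y, so
    truncation at y keeps it continuous and the boundary term picks out f(y). Its slope -cos (k y)
    at x = 0 produces the term f(0) cos (k y).\<close>
  define S where "S y x = sin (k * (y - x)) / k" for y x
  define S' where "S' y x = - cos (k * (y - x))" for y x
  have D1: "(S y has_real_derivative S' y x) (at x)" for y x
    unfolding S_def[abs_def] S'_def using k by (auto intro!: derivative_eq_intros)
  have D2: "(S' y has_real_derivative - k\<^sup>2 * S y x) (at x)" for y x
    unfolding S_def S'_def[abs_def] using k by (auto intro!: derivative_eq_intros simp: power2_eq_square)
  have S0: "S y y = 0" for y by (simp add: S_def)
  define y z where "y = crd e t" and "z = crd e' t'"
  have yz: "0 \<le> y" "y \<le> tlen" "0 \<le> z" "z \<le> tlen"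
    using crd_range[OF e] crd_range[OF e'] by (auto simp: y_def z_def)
  define P where "P y = cut (S y) y" for y
  define \<phi> where "\<phi> e t = 1 * P y e t + (- complex_of_real c) * P z e t" for e t
  have P: "continuous_on {0..len e} (P y e)" "P y e \<in> H1_interval (len e)" if "e \<in> arcs G" for e y
  proof -
    obtain i where i: "i < m" "e = ed i" using \<open>e \<in> arcs G\<close> by (rule arc_cases)
    show "continuous_on {0..len e} (P y e)" "P y e \<in> H1_interval (len e)"
      using cut_edge(1,2)[OF D1 D2 _ i(1), of y y] i S0 by (simp_all add: P_def)
  qed
  define \<theta> where "\<theta> y x = (if x \<le> y then S y x else 0)" for y x
  define \<Theta> where "\<Theta> x = complex_of_real (\<theta> y x - c * \<theta> z x)" for x
  have edge: "continuous_on {0..len e} (\<phi> e)" "\<phi> e \<in> H1_interval (len e)" if "e \<in> arcs G" for e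
    using H1_interval_lincomb(1)[OF P(2,1)[OF that, of y] P(2,1)[OF that, of z], of 1 "- complex_of_real c"]
    unfolding \<phi>_def[abs_def] by (auto intro!: continuous_intros P that)
  have val: "\<phi> e t = \<Theta> (crd e t)" if "e \<in> arcs G" "t \<in> {0..len e}" for e t
    using that by (simp add: \<phi>_def P_def cut_def \<Theta>_def \<theta>_def)
  have out: "\<phi> e t = 0" if "e \<notin> arcs G \<or> t \<notin> {0..len e}" for e t
    using that by (auto simp: \<phi>_def P_def cut_def)
  have cons: "\<Theta> (pos i) = \<Theta> (pos j)" if ij: "i \<le> m" "j \<le> m" "vx i = vx j" for i j
    using consistent
  proof
    assume "inj_on vx {..m}"
    then show ?thesis using ij by (auto dest: inj_onD)
  next
    assume cyc: "vx m = vx 0 \<and> inj_on vx {..<m} \<and> sin (k * crd e t) = c * sin (k * crd e' t')"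
    \<comment> \<open>At \<open>tlen\<close> both truncated functions vanish, and at 0 their
      combination has the value (sin (k y) - c sin (k z)) / k, which the choice of \<open>c\<close>
      makes zero.\<close>
    have "\<theta> y tlen = 0" if "y \<le> tlen" for y using that by (auto simp: \<theta>_def S0)
    then have "\<Theta> tlen = 0" using yz by (simp add: \<Theta>_def)
    moreover have "\<Theta> 0 = 0" using yz cyc by (simp add: \<Theta>_def \<theta>_def S_def y_def z_def field_simps)
    ultimately have *: "\<Theta> (pos 0) = \<Theta> (pos m)" by (simp add: pos_0)
    define r where "r i = (if i = m then 0 else i)" for i
    have r: "\<Theta> (pos i) = \<Theta> (pos (r i))" "vx i = vx (r i)" "i \<le> m \<Longrightarrow> r i < m" for i
      using * cyc m_pos by (auto simp: r_def)
    have "r i = r j" using cyc r(2)[of i] r(2)[of j] r(3)[OF ij(1)] r(3)[OF ij(2)] ij(3) by (auto dest: inj_onD)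
    then show ?thesis using r(1)[of i] r(1)[of j] by simp
  qed
  have \<phi>H: "\<phi> \<in> H1" by (rule H1_from_coordinates(1)[OF edge val out cons])
  have real: "cnj (\<phi> e t) = \<phi> e t" for e t by (simp add: \<phi>_def P_def cut_def)
  have psum: "(\<Sum>e'\<in>arcs G. edge_form k (len e') (f e') (P (crd e t) e')) =
      - (f e t - vval f (vx 0) * complex_of_real (cos (k * crd e t)))" if "e \<in> arcs G" "t \<in> {0..len e}" for e t
    using cut_point_sum[OF D1 D2 fH that S0] by (simp add: P_def S'_def)
  have "form (\<lambda>e x. 0 - k\<^sup>2) (\<lambda>v. 0) f \<phi> = (\<Sum>e\<in>arcs G. edge_form k (len e) (f e) (P y e) - complex_of_real c * edge_form k (len e) (f e) (P z e))"
    unfolding free_form_real[OF fH \<phi>H real]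
  proof (rule sum.cong[OF refl])
    fix e assume e: "e \<in> arcs G"
    show "edge_form k (len e) (f e) (\<phi> e) = edge_form k (len e) (f e) (P y e) - complex_of_real c * edge_form k (len e) (f e) (P z e)"
      unfolding \<phi>_def[abs_def] using edge_form_lincomb[OF H1D(1,2)[OF fH e] P[OF e] P[OF e], of k 1 y "- complex_of_real c" z] by simp
  qed
  also have "\<dots> = - ((f e t - vval f (vx 0) * complex_of_real (cos (k * crd e t)))
     - complex_of_real c * (f e' t' - vval f (vx 0) * complex_of_real (cos (k * crd e' t'))))"
    unfolding sum_subtractf sum_distrib_left[symmetric] y_def z_def psum[OF e] psum[OF e'] by (simp add: algebra_simps)
  finally have free: "form (\<lambda>e x. 0 - k\<^sup>2) (\<lambda>v. 0) f \<phi> = \<dots>" .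
  have "form (\<lambda>e x. 0 - k\<^sup>2) (\<lambda>v. 0) f \<phi> + pert q \<sigma> f \<phi> = form (\<lambda>e x. q e x - k\<^sup>2) \<sigma> f \<phi>"
    unfolding form_shift[OF q fH \<phi>H] form_shift[OF bounded_potential_zero fH \<phi>H] form_split[of q \<sigma>] by simp
  also have "\<dots> = 0" by (rule f0[OF \<phi>H])
  finally have eq: "(f e t - vval f (vx 0) * complex_of_real (cos (k * crd e t)))
     - complex_of_real c * (f e' t' - vval f (vx 0) * complex_of_real (cos (k * crd e' t'))) = pert q \<sigma> f \<phi>"
    unfolding free by (metis add_eq_0_iff minus_minus)
  have "\<bar>\<theta> y x\<bar> \<le> 1 / k" for y x
    using k by (auto simp: \<theta>_def S_def abs_mult divide_right_mono)
  then have \<theta>: "\<bar>\<theta> y x - c * \<theta> z x\<bar> \<le> 2 / k" for x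
  proof -
    assume a: "\<And>y x. \<bar>\<theta> y x\<bar> \<le> 1 / k"
    have "\<bar>c * \<theta> z x\<bar> \<le> 1 * (1 / k)" unfolding abs_mult by (intro mult_mono c a) auto
    then have "\<bar>\<theta> y x - c * \<theta> z x\<bar> \<le> 1 / k + 1 / k"
      using a[of y x] abs_triangle_ineq4[of "\<theta> y x" "c * \<theta> z x"] by simp
    then show ?thesis by simp
  qed
  show ?thesis
    unfolding eq
  proof (rule pert_bound[OF q fH \<phi>H M])
    show "cmod (\<phi> e t) \<le> 2 / k" if "e \<in> arcs G" "t \<in> {0..len e}" for e t
      unfolding val[OF that] \<Theta>_def norm_of_real by (rule \<theta>)
  qed (use k in simp_all)
qed

end

section \<open>The total potential\<close>

lemma Cesaro_null:
  fixes a :: "nat \<Rightarrow> real"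
  assumes "a \<longlonglongrightarrow> 0"
  shows "(\<lambda>N. (\<Sum>n<N. a n) / real N) \<longlonglongrightarrow> 0"
proof (rule LIMSEQ_I)
  fix r :: real assume r: "r > 0"
  then obtain K where K: "\<And>n. n \<ge> K \<Longrightarrow> \<bar>a n\<bar> < r / 2"
    using LIMSEQ_D[OF assms, of "r / 2"] by auto
  define A where "A = (\<Sum>n<K. \<bar>a n\<bar>)"
  obtain N1 where N1: "2 * A / r < real N1" using reals_Archimedean2 by blast
  have "norm ((\<Sum>n<N. a n) / real N - 0) < r" if N: "N \<ge> max (Suc K) N1" for N
  proof -
    have "\<bar>\<Sum>n<N. a n\<bar> \<le> (\<Sum>n<N. \<bar>a n\<bar>)" by (rule sum_abs)
    also have "(\<Sum>n<N. \<bar>a n\<bar>) = A + (\<Sum>n=K..<N. \<bar>a n\<bar>)"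
      unfolding A_def lessThan_atLeast0 using N by (intro sum.atLeastLessThan_concat[symmetric]) auto
    also have "(\<Sum>n=K..<N. \<bar>a n\<bar>) \<le> (\<Sum>n=K..<N. r / 2)"
      by (rule sum_mono) (use K in \<open>auto intro: less_imp_le\<close>)
    also have "(\<Sum>n=K..<N. r / 2) \<le> real N * (r / 2)"
      using r N by (simp add: mult_right_mono)
    finally have 1: "\<bar>\<Sum>n<N. a n\<bar> \<le> A + real N * (r / 2)" by simp
    have "real N1 \<le> real N" using N by simp
    with N1 have "2 * A / r < real N" by linarith
    then have "A < real N * (r / 2)" using r by (simp add: field_simps)
    with 1 have "\<bar>\<Sum>n<N. a n\<bar> < real N * r" by (simp add: field_simps)
    then show ?thesis using N by (simp add: field_simps)
  qed
  then show "\<exists>no. \<forall>N\<ge>no. norm ((\<Sum>n<N. a n) / real N - 0) < r" by blast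
qed

text \<open>Frequencies start at 1, as n = 0 would be the zero frequency. The limit in N is 1 at
  multiples of 2 pi and 0 elsewhere.\<close>

definition cos_mean :: "nat \<Rightarrow> real \<Rightarrow> real" where
  "cos_mean N \<theta> = (\<Sum>n<N. cos (real (Suc n) * \<theta>)) / real N"

lemma cos_mean_bound: "\<bar>cos_mean N \<theta>\<bar> \<le> 1"
proof -
  have "\<bar>\<Sum>n<N. cos (real (Suc n) * \<theta>)\<bar> \<le> (\<Sum>n<N. \<bar>cos (real (Suc n) * \<theta>)\<bar>)" by (rule sum_abs)
  also have "\<dots> \<le> (\<Sum>n<N. 1)" by (rule sum_mono) (rule abs_cos_le_one)
  finally show ?thesis by (cases "N = 0") (auto simp: cos_mean_def divide_le_eq)
qed

text \<open>Away from multiples of 2 pi the sums are real parts of geometric sums with ratio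
  \<open>cis \<theta>\<close> different from 1, hence bounded in N, and division by N sends them to
  zero.\<close>

lemma cos_mean_tendsto_0:
  assumes "0 < \<theta>" "\<theta> < 2 * pi"
  shows "(\<lambda>N. cos_mean N \<theta>) \<longlonglongrightarrow> 0"
proof (rule tendsto_0_le)
  have "cis \<theta> \<noteq> 1"
  proof
    assume "cis \<theta> = 1"
    then have "cos \<theta> = 1" by (simp add: complex_eq_iff)
    then obtain j :: int where j: "\<theta> = real_of_int j * 2 * pi" unfolding cos_one_2pi_int by auto
    then have "0 < real_of_int j" "real_of_int j < 1" using assms by (auto simp: zero_less_mult_iff)
    then show False by simp
  qed
  then have pos: "cmod (cis \<theta> - 1) > 0" by simp
  show "(\<lambda>N. inverse (real N)) \<longlonglongrightarrow> 0" by (rule lim_inverse_n)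
  show "\<forall>\<^sub>F N in sequentially. norm (cos_mean N \<theta>) \<le> norm (inverse (real N)) * (2 / cmod (cis \<theta> - 1))"
  proof (rule always_eventually, rule allI)
    fix N
    have "cos (real (Suc n) * \<theta>) = Re (cis \<theta> * cis \<theta> ^ n)" for n
      unfolding Complex.DeMoivre cis_mult by (simp add: algebra_simps)
    then have "(\<Sum>n<N. cos (real (Suc n) * \<theta>)) = Re (cis \<theta> * (\<Sum>n<N. cis \<theta> ^ n))"
      by (simp only: sum_distrib_left Re_sum)
    also have "(\<Sum>n<N. cis \<theta> ^ n) = (cis \<theta> ^ N - 1) / (cis \<theta> - 1)"
      by (rule geometric_sum) fact
    finally have "\<bar>\<Sum>n<N. cos (real (Suc n) * \<theta>)\<bar> \<le> cmod (cis \<theta> * ((cis \<theta> ^ N - 1) / (cis \<theta> - 1)))"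
      by (metis abs_Re_le_cmod)
    also have "\<dots> = cmod (cis \<theta> ^ N - 1) / cmod (cis \<theta> - 1)"
      by (simp add: norm_mult norm_divide)
    also have "\<dots> \<le> 2 / cmod (cis \<theta> - 1)"
      using norm_triangle_ineq4[of "cis \<theta> ^ N" 1] pos by (intro divide_right_mono) (auto simp: norm_power)
    finally have "\<bar>\<Sum>n<N. cos (real (Suc n) * \<theta>)\<bar> / real N \<le> (2 / cmod (cis \<theta> - 1)) / real N"
      by (rule divide_right_mono) simp
    then show "norm (cos_mean N \<theta>) \<le> norm (inverse (real N)) * (2 / cmod (cis \<theta> - 1))"
      unfolding cos_mean_def real_norm_def abs_divide abs_inverse abs_of_nat
      by (simp only: divide_inverse mult_ac)
  qed
qed

lemma cos_mean_tendsto_1: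
  assumes "cos \<theta> = 1"
  shows "(\<lambda>N. cos_mean N \<theta>) \<longlonglongrightarrow> 1"
proof (rule tendsto_eventually)
  obtain j :: int where j: "\<theta> = real_of_int j * 2 * pi" using assms unfolding cos_one_2pi_int by auto
  have "cos (real (Suc n) * \<theta>) = 1" for n
    unfolding cos_one_2pi_int by (rule exI[of _ "int (Suc n) * j"]) (simp add: j)
  then have "cos_mean N \<theta> = 1" if "N \<ge> 1" for N using that by (simp add: cos_mean_def)
  then show "\<forall>\<^sub>F N in sequentially. cos_mean N \<theta> = 1" using eventually_ge_at_top[of 1] by (rule eventually_mono[rotated])
qed

context covered_metric_graph
begin

lemma pert_self:
  "pert q \<sigma> w w = complex_of_real ((\<Sum>e\<in>arcs G. LINT x|edge_measure (len e). q e x * (cmod (w e x))\<^sup>2)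
     + (\<Sum>v\<in>verts G. \<sigma> v * (cmod (vval w v))\<^sup>2))"
proof -
  have sq: "a * cnj a = complex_of_real ((cmod a)\<^sup>2)" for a by (rule complex_norm_square[symmetric])
  show ?thesis
    unfolding pert_def mult.assoc sq of_real_mult[symmetric] of_real_sum of_real_add integral_complex_of_real by simp
qed

definition total_pot :: "('b \<Rightarrow> real \<Rightarrow> real) \<Rightarrow> ('a \<Rightarrow> real) \<Rightarrow> real" where
  "total_pot q \<sigma> = (\<Sum>e\<in>arcs G. LINT x|edge_measure (len e). q e x) + (\<Sum>v\<in>verts G. \<sigma> v)"

end

context line_coordinates
begin

lemma arcs_nonempty: "arcs G \<noteq> {}"
  using ed_arcs[of 0] m_pos by auto

lemma trig_derivs:
  "((\<lambda>x. cos (k * x)) has_real_derivative - k * sin (k * x)) (at x)"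
  "((\<lambda>x. - k * sin (k * x)) has_real_derivative - k\<^sup>2 * cos (k * x)) (at x)"
  "((\<lambda>x. sin (k * x)) has_real_derivative k * cos (k * x)) (at x)"
  "((\<lambda>x. k * cos (k * x)) has_real_derivative - k\<^sup>2 * sin (k * x)) (at x)"
  by (auto intro!: derivative_eq_intros simp: power2_eq_square)

text \<open>The condition on \<open>k\<close> is the Neumann condition for the cosine at
  \<open>tlen\<close>. Doubling 2 cos^2 = 1 + cos of the double angle separates the total potential
  from an oscillating remainder; this doubling turns the 4 of \<open>pert_small\<close> into
  8.\<close>

lemma path_frequency_estimate:
  assumes q: "bounded_potential q" and iso: "isospectral_to_free G len q \<sigma>" and path: "inj_on vx {..m}"
    and k: "k > 0" "4 * pert_norm q \<sigma> \<le> k" "sin (k * tlen) = 0"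
  shows "\<bar>total_pot q \<sigma> + ((\<Sum>e\<in>arcs G. LINT x|edge_measure (len e). q e x * cos (2 * k * crd e x))
     + (\<Sum>i\<le>m. \<sigma> (vx i) * cos (2 * k * pos i)))\<bar> \<le> 8 * (pert_norm q \<sigma>)\<^sup>2 / k"
proof -
  define w where "w = cut (\<lambda>x. cos (k * x)) tlen"
  have cons: "cos (k * pos i) = cos (k * pos j)" if "i \<le> m" "j \<le> m" "vx i = vx j" for i j
    using that path by (auto dest: inj_onD)
  note W = free_eigenfunction[of "\<lambda>x. cos (k * x)" "\<lambda>x. - k * sin (k * x)", OF trig_derivs(1,2) cons, folded w_def]
  have w: "w \<in> eigenspace G len (\<lambda>e x. 0) (\<lambda>v. 0) (k\<^sup>2)" by (rule W(1)) (use k in simp_all)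
  have wv: "vval w (vx i) = complex_of_real (cos (k * pos i))" if "i \<le> m" for i
    by (rule W(2)[OF _ _ _ _ that]) (use k in simp_all)
  have wval: "w e t = complex_of_real (cos (k * crd e t))" if "e \<in> arcs G" "t \<in> {0..len e}" for e t
    using that crd_range[OF that] by (simp add: w_def cut_def)
  have "w \<noteq> 0"
  proof -
    obtain e t where "e \<in> arcs G" "t \<in> {0..len e}" "crd e t = 0"
      by (rule exists_point[of 0]) (use tlen_pos in auto)
    then have "w e t = 1" using wval[of e t] by simp
    then show ?thesis by auto
  qed
  with w obtain f where f: "f \<in> eigenspace G len q \<sigma> (k\<^sup>2)" "f \<noteq> 0"
    using isospectral_to_free_nonzero[OF iso] by blast
  have "cmod (pert q \<sigma> w w) \<le> 4 * (pert_norm q \<sigma>)\<^sup>2 / k"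
  proof (rule pert_small[OF q k(1,2) arcs_nonempty f w])
    show "cmod (w e x) \<le> 1" if "e \<in> arcs G" "x \<in> {0..len e}" for e x
      using wval[OF that] by (simp add: abs_cos_le_one)
    fix M e x assume M: "\<And>e x. e \<in> arcs G \<Longrightarrow> x \<in> {0..len e} \<Longrightarrow> cmod (f e x) \<le> M" and ex: "e \<in> arcs G" "x \<in> {0..len e}"
    have "0 \<le> M" using M[OF ex] norm_ge_zero order_trans by blast
    \<comment> \<open>On a path no jump has to be removed, so c = 0 and the second point is a
      dummy.\<close>
    from eigenfunction_asymptotics[OF q k(1) f(1) ex ex, of 0 M] path M this
    show "cmod (f e x - vval f (vx 0) * w e x) \<le> pert_norm q \<sigma> * (M * (2 / k))"
      by (simp add: wval[OF ex])
  qed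
  then have "\<bar>2 * ((\<Sum>e\<in>arcs G. LINT x|edge_measure (len e). q e x * (cmod (w e x))\<^sup>2)
     + (\<Sum>v\<in>verts G. \<sigma> v * (cmod (vval w v))\<^sup>2))\<bar> \<le> 8 * (pert_norm q \<sigma>)\<^sup>2 / k"
    unfolding pert_self norm_of_real abs_mult by simp
  moreover have "2 * (LINT x|edge_measure (len e). q e x * (cmod (w e x))\<^sup>2) =
     (LINT x|edge_measure (len e). q e x) + (LINT x|edge_measure (len e). q e x * cos (2 * k * crd e x))" if e: "e \<in> arcs G" for e
  proof -
    have c2: "2 * (cos a)\<^sup>2 = 1 + cos (2 * a)" for a :: real by (simp add: cos_double_cos)
    have "2 * (LINT x|edge_measure (len e). q e x * (cmod (w e x))\<^sup>2) = (LINT x|edge_measure (len e). q e x + q e x * cos (2 * k * crd e x))"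
      unfolding integral_mult_right_zero[symmetric]
    proof (rule Bochner_Integration.integral_cong[OF refl])
      fix x assume "x \<in> space (edge_measure (len e))"
      then have "w e x = complex_of_real (cos (k * crd e x))" using e by (intro wval) auto
      then have "2 * (cmod (w e x))\<^sup>2 = 1 + cos (2 * k * crd e x)"
        using c2[of "k * crd e x"] by (simp add: mult.assoc)
      then have "q e x * (2 * (cmod (w e x))\<^sup>2) = q e x * (1 + cos (2 * k * crd e x))" by simp
      then show "2 * (q e x * (cmod (w e x))\<^sup>2) = q e x + q e x * cos (2 * k * crd e x)"
        by (simp add: distrib_left)
    qed
    also have "\<dots> = (LINT x|edge_measure (len e). q e x) + (LINT x|edge_measure (len e). q e x * cos (2 * k * crd e x))"
    proof (rule Bochner_Integration.integral_add)
      show qi: "integrable (edge_measure (len e)) (q e)" by (rule bounded_potential_integrable[OF q e])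
      have "continuous_on {0..len e} (\<lambda>x. cos (2 * k * crd e x))"
        unfolding crd_def edge_coord_def by (cases "fwd e") (auto intro!: continuous_intros)
      then show "integrable (edge_measure (len e)) (\<lambda>x. q e x * cos (2 * k * crd e x))"
        by (intro Bochner_Integration.integrable_bound[OF qi] borel_measurable_times borel_measurable_integrable[OF qi] edge_measurable_continuous)
           (auto simp: abs_mult mult_left_le abs_cos_le_one)
    qed
    finally show ?thesis .
  qed
  moreover have "2 * (\<Sum>v\<in>verts G. \<sigma> v * (cmod (vval w v))\<^sup>2) = (\<Sum>v\<in>verts G. \<sigma> v) + (\<Sum>i\<le>m. \<sigma> (vx i) * cos (2 * k * pos i))"
  proof -
    have bij: "bij_betw vx {..m} (verts G)" using path vx_verts by (simp add: bij_betw_def)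
    have "2 * (\<sigma> (vx i) * (cmod (vval w (vx i)))\<^sup>2) = \<sigma> (vx i) + \<sigma> (vx i) * cos (2 * k * pos i)" if "i \<le> m" for i
    proof -
      have c2: "cos (2 * k * pos i) = 2 * (cos (k * pos i))\<^sup>2 - 1"
        using cos_double_cos[of "k * pos i"] by (simp add: mult.assoc)
      show ?thesis unfolding c2 wv[OF that] norm_of_real by (simp add: algebra_simps)
    qed
    then show ?thesis
      unfolding sum.reindex_bij_betw[OF bij, symmetric] sum_distrib_left by (simp add: sum.distrib)
  qed
  ultimately show ?thesis
    unfolding total_pot_def by (simp add: distrib_left sum_distrib_left sum.distrib algebra_simps)
qed

text \<open>The full expression tends to zero along k = (n + 1) pi / tlen, hence so do its means,
  while the means of the cosines have an explicit pointwise limit. Equating the two limits gives the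
  identity.\<close>

lemma path_total_potential:
  assumes q: "bounded_potential q" and iso: "isospectral_to_free G len q \<sigma>" and path: "inj_on vx {..m}"
  shows "total_pot q \<sigma> + \<sigma> (vx 0) + \<sigma> (vx m) = 0"
proof -
  \<comment> \<open>Spacing of the doubled frequencies: k = (n + 1) \<omega> / 2, which is also why
    the constant 8 / k becomes 16 / \<omega> below.\<close>
  define \<omega> where "\<omega> = 2 * pi / tlen"
  have \<omega>: "\<omega> > 0" using tlen_pos by (simp add: \<omega>_def)
  define H where "H n = (\<Sum>e\<in>arcs G. LINT x|edge_measure (len e). q e x * cos (real (Suc n) * (\<omega> * crd e x)))
     + (\<Sum>i\<le>m. \<sigma> (vx i) * cos (real (Suc n) * (\<omega> * pos i)))" for n
  have int: "integrable (edge_measure (len e)) (\<lambda>x. q e x * g (crd e x))"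
    if e: "e \<in> arcs G" and g: "continuous_on UNIV g" "\<And>x. \<bar>g x\<bar> \<le> 1" for e and g :: "real \<Rightarrow> real"
  proof -
    note qi = bounded_potential_integrable[OF q e]
    have "continuous_on {0..len e} (\<lambda>x. g (crd e x))"
      unfolding crd_def edge_coord_def
      by (cases "fwd e") (auto intro!: continuous_intros continuous_on_compose2[OF g(1)])
    then show ?thesis
      by (intro Bochner_Integration.integrable_bound[OF qi] borel_measurable_times borel_measurable_integrable[OF qi] edge_measurable_continuous)
         (auto simp: abs_mult mult_left_le g(2))
  qed
  have H_lim: "(\<lambda>n. total_pot q \<sigma> + H n) \<longlonglongrightarrow> 0"
  proof (rule tendsto_0_le[OF LIMSEQ_inverse_real_of_nat, where K="16 * (pert_norm q \<sigma>)\<^sup>2 / \<omega>"])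
    obtain N where N: "8 * pert_norm q \<sigma> / \<omega> < real N" using reals_Archimedean2 by blast
    have "norm (total_pot q \<sigma> + H n) \<le> norm (inverse (real (Suc n))) * (16 * (pert_norm q \<sigma>)\<^sup>2 / \<omega>)" if "n \<ge> N" for n
    proof -
      define k where "k = real (Suc n) * \<omega> / 2"
      have k: "k > 0" using \<omega> by (simp add: k_def)
      have "8 * pert_norm q \<sigma> < real N * \<omega>" using N \<omega> by (simp add: field_simps)
      also have "\<dots> \<le> real (Suc n) * \<omega>" using that \<omega> by (intro mult_right_mono) auto
      finally have k': "4 * pert_norm q \<sigma> \<le> k" by (simp add: k_def)
      have "k * tlen = real (Suc n) * pi" using tlen_pos by (simp add: k_def \<omega>_def)
      then have "sin (k * tlen) = 0" by (simp only: sin_npi)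
      from path_frequency_estimate[OF q iso path k k' this]
      have "\<bar>total_pot q \<sigma> + H n\<bar> \<le> 8 * (pert_norm q \<sigma>)\<^sup>2 / k"
        by (simp add: H_def k_def mult.assoc)
      also have "\<dots> = inverse (real (Suc n)) * (16 * (pert_norm q \<sigma>)\<^sup>2 / \<omega>)"
        using \<omega> by (simp add: k_def field_simps del: of_nat_Suc)
      finally show ?thesis by simp
    qed
    then show "\<forall>\<^sub>F n in sequentially. norm (total_pot q \<sigma> + H n) \<le> norm (inverse (real (Suc n))) * (16 * (pert_norm q \<sigma>)\<^sup>2 / \<omega>)"
      unfolding eventually_sequentially by blast
  qed
  have mean: "(\<Sum>n<N. total_pot q \<sigma> + H n) / real N = total_pot q \<sigma> +
     ((\<Sum>e\<in>arcs G. LINT x|edge_measure (len e). q e x * cos_mean N (\<omega> * crd e x)) + (\<Sum>i\<le>m. \<sigma> (vx i) * cos_mean N (\<omega> * pos i)))"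
    if "N > 0" for N
  proof -
    have 1: "(LINT x|edge_measure (len e). q e x * cos_mean N (\<omega> * crd e x)) =
       (\<Sum>n<N. LINT x|edge_measure (len e). q e x * cos (real (Suc n) * (\<omega> * crd e x))) / real N" if e: "e \<in> arcs G" for e
    proof -
      have "(LINT x|edge_measure (len e). q e x * cos_mean N (\<omega> * crd e x)) =
        (LINT x|edge_measure (len e). (\<Sum>n<N. q e x * cos (real (Suc n) * (\<omega> * crd e x))) / real N)"
        by (simp only: cos_mean_def sum_distrib_left times_divide_eq_right)
      also have "\<dots> = (LINT x|edge_measure (len e). (\<Sum>n<N. q e x * cos (real (Suc n) * (\<omega> * crd e x)))) / real N"
        by simp
      also have "(LINT x|edge_measure (len e). (\<Sum>n<N. q e x * cos (real (Suc n) * (\<omega> * crd e x)))) =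
        (\<Sum>n<N. LINT x|edge_measure (len e). q e x * cos (real (Suc n) * (\<omega> * crd e x)))"
        by (rule Bochner_Integration.integral_sum)
           (rule int[OF e, where g="\<lambda>y. cos (real (Suc _) * (\<omega> * y))"], auto intro!: continuous_intros simp: abs_cos_le_one)
      finally show ?thesis .
    qed
    have 2: "(\<Sum>e\<in>arcs G. LINT x|edge_measure (len e). q e x * cos_mean N (\<omega> * crd e x)) =
       (\<Sum>n<N. \<Sum>e\<in>arcs G. LINT x|edge_measure (len e). q e x * cos (real (Suc n) * (\<omega> * crd e x))) / real N"
      unfolding sum_divide_distrib sum.swap[of _ "arcs G" "{..<N}"]
      by (rule sum.cong[OF refl]) (simp only: 1 sum_divide_distrib)
    have 3: "(\<Sum>i\<le>m. \<sigma> (vx i) * cos_mean N (\<omega> * pos i)) = (\<Sum>n<N. \<Sum>i\<le>m. \<sigma> (vx i) * cos (real (Suc n) * (\<omega> * pos i))) / real N"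
      unfolding cos_mean_def by (subst sum.swap) (simp add: sum_divide_distrib sum_distrib_left)
    show ?thesis
      unfolding 2 3 using that by (simp add: H_def sum.distrib add_divide_distrib)
  qed
  have lim1: "(\<lambda>N. LINT x|edge_measure (len e). q e x * cos_mean N (\<omega> * crd e x)) \<longlonglongrightarrow> 0" if e: "e \<in> arcs G" for e
  proof -
    have "(\<lambda>N. LINT x|edge_measure (len e). q e x * cos_mean N (\<omega> * crd e x)) \<longlonglongrightarrow> (LINT x|edge_measure (len e). 0)"
    proof (rule integral_dominated_convergence[where w="\<lambda>x. \<bar>q e x\<bar>"])
      show "integrable (edge_measure (len e)) (\<lambda>x. \<bar>q e x\<bar>)" using bounded_potential_integrable[OF q e] by simp
      show "(\<lambda>x. q e x * cos_mean N (\<omega> * crd e x)) \<in> borel_measurable (edge_measure (len e))" for N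
      proof (rule borel_measurable_integrable, rule int[OF e, where g="\<lambda>y. cos_mean N (\<omega> * y)"])
        show "continuous_on UNIV (\<lambda>y. cos_mean N (\<omega> * y))"
          unfolding cos_mean_def by (cases "N = 0") (auto intro!: continuous_intros)
      qed (rule cos_mean_bound)
      show "AE x in edge_measure (len e). norm (q e x * cos_mean N (\<omega> * crd e x)) \<le> \<bar>q e x\<bar>" for N
        by (rule AE_I2) (simp add: abs_mult mult_left_le cos_mean_bound)
      show "AE x in edge_measure (len e). (\<lambda>N. q e x * cos_mean N (\<omega> * crd e x)) \<longlonglongrightarrow> 0"
      proof (rule AE_I2)
        fix x assume "x \<in> space (edge_measure (len e))"
        then have x: "0 < x" "x < len e" by auto
        obtain i where i: "i < m" "e = ed i" using e by (rule arc_cases)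
        \<comment> \<open>An interior point of an edge has its coordinate strictly between 0 and
          \<open>tlen\<close>, so its phase avoids the multiples of 2 pi.\<close>
        have "pos i < crd e x" "crd e x < pos (Suc i)" using x i by (auto simp: crd_def edge_coord_def idx_ed pos_Suc)
        then have "0 < crd e x" "crd e x < tlen"
          using pos_mono[of 0 i] pos_mono[of "Suc i" m] i(1) by (auto simp: pos_0)
        then have "0 < \<omega> * crd e x" "\<omega> * crd e x < 2 * pi"
          using \<omega> tlen_pos by (auto simp: \<omega>_def field_simps)
        from tendsto_mult_right_zero[OF cos_mean_tendsto_0[OF this]]
        show "(\<lambda>N. q e x * cos_mean N (\<omega> * crd e x)) \<longlonglongrightarrow> 0" .
      qed
    qed simp
    then show ?thesis by simp
  qed
  have lim2: "(\<lambda>N. cos_mean N (\<omega> * pos i)) \<longlonglongrightarrow> (if i = 0 \<or> i = m then 1 else 0)" if "i \<le> m" for i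
  proof (cases "i = 0 \<or> i = m")
    case True
    then have "cos (\<omega> * pos i) = 1" using tlen_pos by (auto simp: \<omega>_def pos_0)
    with True show ?thesis by (simp add: cos_mean_tendsto_1)
  next
    case False
    then have "0 < pos i" "pos i < tlen" using pos_strict_mono[of 0 i] pos_strict_mono[of i m] that by (auto simp: pos_0)
    then have "0 < \<omega> * pos i" "\<omega> * pos i < 2 * pi"
      using \<omega> tlen_pos by (auto simp: \<omega>_def field_simps)
    with False show ?thesis by (simp add: cos_mean_tendsto_0)
  qed
  have "(\<lambda>N. total_pot q \<sigma> + ((\<Sum>e\<in>arcs G. LINT x|edge_measure (len e). q e x * cos_mean N (\<omega> * crd e x)) + (\<Sum>i\<le>m. \<sigma> (vx i) * cos_mean N (\<omega> * pos i))))
     \<longlonglongrightarrow> total_pot q \<sigma> + ((\<Sum>e\<in>arcs G. 0) + (\<Sum>i\<le>m. \<sigma> (vx i) * (if i = 0 \<or> i = m then 1 else 0)))"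
    by (intro tendsto_add tendsto_const tendsto_sum tendsto_mult lim1 lim2) auto
  then have "(\<lambda>N. (\<Sum>n<N. total_pot q \<sigma> + H n) / real N)
     \<longlonglongrightarrow> total_pot q \<sigma> + ((\<Sum>e\<in>arcs G. 0) + (\<Sum>i\<le>m. \<sigma> (vx i) * (if i = 0 \<or> i = m then 1 else 0)))"
    by (rule Lim_transform_eventually)
       (rule eventually_mono[OF eventually_gt_at_top[of "0::nat"]], rule mean[symmetric])
  from LIMSEQ_unique[OF this Cesaro_null[OF H_lim]]
  have "total_pot q \<sigma> + (\<Sum>i\<le>m. \<sigma> (vx i) * (if i = 0 \<or> i = m then 1 else 0)) = 0" by simp
  moreover have "(\<Sum>i\<le>m. \<sigma> (vx i) * (if i = 0 \<or> i = m then 1 else 0)) = (\<Sum>i\<in>{0, m}. \<sigma> (vx i) * (if i = 0 \<or> i = m then 1 else 0))"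
    by (rule sum.mono_neutral_right) auto
  \<comment> \<open>\<open>m_pos\<close> makes 0 and m distinct, so both end terms count.\<close>
  ultimately show ?thesis using m_pos by simp
qed

text \<open>With |cis| = 1 the perturbation evaluated at \<open>w\<close> equals the total potential
  for every admissible k, whereas \<open>pert_small\<close> bounds it by a multiple of 1 /
  k.\<close>

lemma cycle_total_potential:
  assumes q: "bounded_potential q" and iso: "isospectral_to_free G len q \<sigma>"
    and cycle: "vx m = vx 0" "inj_on vx {..<m}"
  shows "total_pot q \<sigma> = 0"
proof -
  define \<omega> where "\<omega> = 2 * pi / tlen"
  have \<omega>: "\<omega> > 0" using tlen_pos by (simp add: \<omega>_def)
  have est: "\<bar>total_pot q \<sigma>\<bar> \<le> 4 * (pert_norm q \<sigma>)\<^sup>2 / k"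
    if n: "k = real (Suc n) * \<omega>" and k': "4 * pert_norm q \<sigma> \<le> k" for k n
  proof -
    have k: "k > 0" using \<omega> n by simp
    have kL: "k * tlen = 2 * pi * real (Suc n)" using tlen_pos by (simp add: n \<omega>_def)
    have per: "sin (k * tlen) = 0" "cos (k * tlen) = 1"
      unfolding kL by (metis mult.commute sin_2npi mult.assoc) (metis mult.commute cos_2npi mult.assoc)
    \<comment> \<open>The only repeated vertex of the layout is the one at its two ends, where
      periodicity supplies the consistency conditions.\<close>
    have same: "i = j \<or> {i, j} = {0, m}" if "i \<le> m" "j \<le> m" "vx i = vx j" for i j
    proof -
      define r where "r i = (if i = m then 0 else i)" for i
      have r: "vx i = vx (r i)" "i \<le> m \<Longrightarrow> r i < m" for i using cycle m_pos by (auto simp: r_def)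
      have "r i = r j" using cycle(2) r(1)[of i] r(1)[of j] r(2)[OF that(1)] r(2)[OF that(2)] that(3) by (auto dest: inj_onD)
      then show ?thesis by (auto simp: r_def split: if_splits)
    qed
    define C S where "C = cut (\<lambda>x. cos (k * x)) tlen" and "S = cut (\<lambda>x. sin (k * x)) tlen"
    have consC: "cos (k * pos i) = cos (k * pos j)" if "i \<le> m" "j \<le> m" "vx i = vx j" for i j
      using same[OF that] per by (auto simp: pos_0 doubleton_eq_iff)
    have consS: "sin (k * pos i) = sin (k * pos j)" if "i \<le> m" "j \<le> m" "vx i = vx j" for i j
      using same[OF that] per by (auto simp: pos_0 doubleton_eq_iff)
    note C = free_eigenfunction[of "\<lambda>x. cos (k * x)" "\<lambda>x. - k * sin (k * x)", OF trig_derivs(1,2) consC, folded C_def]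
    note S = free_eigenfunction[of "\<lambda>x. sin (k * x)" "\<lambda>x. k * cos (k * x)", OF trig_derivs(3,4) consS, folded S_def]
    have C': "C \<in> eigenspace G len (\<lambda>e x. 0) (\<lambda>v. 0) (k\<^sup>2)" "\<And>i. i \<le> m \<Longrightarrow> vval C (vx i) = complex_of_real (cos (k * pos i))" "C \<in> H1"
      by (rule C; use cycle per in simp)+
    have S': "S \<in> eigenspace G len (\<lambda>e x. 0) (\<lambda>v. 0) (k\<^sup>2)" "\<And>i. i \<le> m \<Longrightarrow> vval S (vx i) = complex_of_real (sin (k * pos i))" "S \<in> H1"
      by (rule S; use cycle per in simp)+
    have val: "C e t = complex_of_real (cos (k * crd e t))" "S e t = complex_of_real (sin (k * crd e t))" if "e \<in> arcs G" "t \<in> {0..len e}" for e t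
      using that crd_range[OF that] by (simp_all add: C_def S_def cut_def)
    \<comment> \<open>A quarter period: there the cosine is 0 and the sine is 1, so the value of
      \<open>f\<close> at this point isolates its sine coefficient.\<close>
    define z where "z = pi / (2 * k)"
    have "pi / 2 \<le> k * tlen" unfolding kL using pi_gt_zero by (simp add: field_simps)
    then have z: "0 \<le> z" "z \<le> tlen" "k * z = pi / 2"
      using k by (auto simp: z_def field_simps)
    obtain e' t' where e': "e' \<in> arcs G" "t' \<in> {0..len e'}" "crd e' t' = z" by (rule exists_point[OF z(1,2)])
    obtain e0 t0 where e0: "e0 \<in> arcs G" "t0 \<in> {0..len e0}" "crd e0 t0 = 0"
      by (rule exists_point[of 0]) (use tlen_pos in auto)
    obtain B B0 where B: "finite B" "finite B0" "card B = card B0"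
     "gfun.independent B" "gfun.span B = eigenspace G len q \<sigma> (k\<^sup>2)"
     "gfun.independent B0" "gfun.span B0 = eigenspace G len (\<lambda>e x. 0) (\<lambda>v. 0) (k\<^sup>2)"
      using iso unfolding isospectral_to_free_def by metis
    \<comment> \<open>Cosine and sine cannot be multiples of one function: at coordinate 0 the sine
      vanishes and the cosine does not, which would force the sine to be zero, contrary to its value
      at \<open>z\<close>.\<close>
    have "\<not> card B0 \<le> 1"
    proof
      assume "card B0 \<le> 1"
      then obtain b where "B0 \<subseteq> {b}" using card_le_Suc0_iff_eq[OF B(2)] by (metis One_nat_def insertI1 subsetI)
      then have "gfun.span B0 \<subseteq> gfun.span {b}" by (rule gfun.span_mono)
      then obtain a a' where a: "C = gscale a b" "S = gscale a' b"
        using C'(1) S'(1) unfolding B(7)[symmetric] gfun.span_singleton by blast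
      have "a * b e0 t0 = 1" "a' * b e0 t0 = 0"
        using val[OF e0(1,2)] e0(3) unfolding a by (simp_all add: gscale_def)
      then have "a' = 0" by auto
      then have "S e' t' = 0" unfolding a(2) by (simp add: gscale_def)
      then show False using val(2)[OF e'(1,2)] e'(3) z(3) by simp
    qed
    then have "\<not> card B \<le> Suc 0" using B(3) by simp
    then obtain f1 f2 where f12: "f1 \<in> B" "f2 \<in> B" "f1 \<noteq> f2"
      unfolding card_le_Suc0_iff_eq[OF B(1)] by blast
    define p0 where "p0 = par 0 0"
    \<comment> \<open>Vanishing of this functional means f(z) = i f(0), the relation satisfied by
      exp (i k x). The value f(0) is read off on an edge instead of through \<open>vval\<close>, so
      that \<open>lin\<close> is linear on all families of functions.\<close>
    define lin where "lin f = f e' t' - \<i> * f (ed 0) p0" for f :: "'b graph_fun"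
    have "\<exists>f\<in>gfun.span B. f \<noteq> 0 \<and> lin f = 0"
    proof (cases "lin f1 = 0")
      case True
      moreover have "f1 \<noteq> 0" using B(4) f12(1) gfun.dependent_zero by blast
      ultimately show ?thesis using gfun.span_base[OF f12(1)] by blast
    next
      case False
      \<comment> \<open>The combination of two basis vectors annihilated by \<open>lin\<close>;
        independence keeps it nonzero.\<close>
      define f where "f = gscale (lin f2) f1 - gscale (lin f1) f2"
      have "f \<in> gfun.span B" unfolding f_def
        by (intro gfun.span_diff gfun.span_scale gfun.span_base f12)
      moreover have "lin f = 0" by (simp add: f_def lin_def gscale_def algebra_simps)
      moreover have "f \<noteq> 0"
      proof
        assume "f = 0"
        then have eq: "gscale (lin f2) f1 = gscale (lin f1) f2" by (simp add: f_def)
        have "f2 = gscale (inverse (lin f1)) (gscale (lin f1) f2)"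
          using False by (simp add: gscale_def fun_eq_iff)
        also have "\<dots> = gscale (inverse (lin f1)) (gscale (lin f2) f1)" by (simp only: eq)
        also have "\<dots> \<in> gfun.span (B - {f2})"
          by (intro gfun.span_scale gfun.span_base) (use f12 in auto)
        finally have "gfun.dependent B" using f12(2) by (auto simp: gfun.dependent_def)
        then show False using B(4) by simp
      qed
      ultimately show ?thesis by blast
    qed
    then obtain f where f: "f \<in> eigenspace G len q \<sigma> (k\<^sup>2)" "f \<noteq> 0" "lin f = 0"
      unfolding B(5) by blast
    have fH: "f \<in> H1" using f(1) unfolding eigenspace_iff[OF q] by simp
    have fz: "f e' t' = \<i> * vval f (vx 0)"
      using f(3) value_at_vertices(1)[OF fH m_pos] by (simp add: lin_def p0_def pos_0)
    define w where "w = lincomb 1 C \<i> S"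
    have w: "w \<in> eigenspace G len (\<lambda>e x. 0) (\<lambda>v. 0) (k\<^sup>2)"
    proof -
      have "w = gscale 1 C + gscale \<i> S" by (simp add: w_def lincomb_def gscale_def fun_eq_iff)
      then show ?thesis
        using C'(1) S'(1) unfolding B(7)[symmetric] by (simp only: gfun.span_add gfun.span_scale)
    qed
    have wval: "w e t = cis (k * crd e t)" if "e \<in> arcs G" "t \<in> {0..len e}" for e t
      using val[OF that] by (simp add: w_def lincomb_def complex_eq_iff)
    have wv: "vval w v = cis (k * pos i)" if "i \<le> m" "v = vx i" for i v
      unfolding w_def that(2) H1_lincomb(2)[OF C'(3) S'(3) vx_in[OF that(1)]] using C'(2)[OF that(1)] S'(2)[OF that(1)]
      by (simp add: complex_eq_iff)
    have "cmod (pert q \<sigma> w w) \<le> 4 * (pert_norm q \<sigma>)\<^sup>2 / k"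
    proof (rule pert_small[OF q k k' arcs_nonempty f(1,2) w])
      show "cmod (w e x) \<le> 1" if "e \<in> arcs G" "x \<in> {0..len e}" for e x
        using wval[OF that] by simp
      fix M e x assume M: "\<And>e x. e \<in> arcs G \<Longrightarrow> x \<in> {0..len e} \<Longrightarrow> cmod (f e x) \<le> M" and ex: "e \<in> arcs G" "x \<in> {0..len e}"
      have "0 \<le> M" using M[OF ex] norm_ge_zero order_trans by blast
      have "cis (k * crd e x) = complex_of_real (cos (k * crd e x)) + \<i> * complex_of_real (sin (k * crd e x))"
        by (simp add: complex_eq_iff)
      \<comment> \<open>At the reference point the cosine vanishes and \<open>f\<close> equals i
        f(0), so c = sin (k x) subtracts exactly the sine part of f(0) exp (i k x).\<close>
      then have eq: "f e x - vval f (vx 0) * w e x = (f e x - vval f (vx 0) * complex_of_real (cos (k * crd e x)))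
        - complex_of_real (sin (k * crd e x)) * (f e' t' - vval f (vx 0) * complex_of_real (cos (k * crd e' t')))"
        unfolding wval[OF ex] fz e'(3) z(3) by (simp add: algebra_simps)
      have sin1: "sin (k * crd e' t') = 1" unfolding e'(3) z(3) by simp
      show "cmod (f e x - vval f (vx 0) * w e x) \<le> pert_norm q \<sigma> * (M * (2 / k))"
        unfolding eq
        by (rule eigenfunction_asymptotics[OF q k f(1) ex e'(1,2) _ _ M \<open>0 \<le> M\<close>])
           (use cycle sin1 in auto)
    qed
    moreover have "pert q \<sigma> w w = complex_of_real (total_pot q \<sigma>)"
    proof -
      have "(LINT x|edge_measure (len e). q e x * (cmod (w e x))\<^sup>2) = (LINT x|edge_measure (len e). q e x)" if "e \<in> arcs G" for e
        by (rule Bochner_Integration.integral_cong) (use that in \<open>auto simp: wval\<close>)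
      moreover have "cmod (vval w v) = 1" if "v \<in> verts G" for v
        using that wv unfolding vx_verts[symmetric] by auto
      ultimately show ?thesis unfolding pert_self total_pot_def by simp
    qed
    ultimately show ?thesis by simp
  qed
  show ?thesis
  proof (rule ccontr)
    assume "total_pot q \<sigma> \<noteq> 0"
    then have T: "\<bar>total_pot q \<sigma>\<bar> > 0" by simp
    define A where "A = pert_norm q \<sigma>"
    obtain N where N: "max (4 * A) (4 * A\<^sup>2 / \<bar>total_pot q \<sigma>\<bar>) / \<omega> < real N" using reals_Archimedean2 by blast
    define k where "k = real (Suc N) * \<omega>"
    have "max (4 * A) (4 * A\<^sup>2 / \<bar>total_pot q \<sigma>\<bar>) < real N * \<omega>" using N \<omega> by (simp add: field_simps)
    also have "\<dots> \<le> k" using \<omega> by (simp add: k_def)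
    finally have k: "4 * A \<le> k" "4 * A\<^sup>2 / \<bar>total_pot q \<sigma>\<bar> < k" by auto
    have "k > 0" using \<omega> by (simp add: k_def)
    then have "4 * A\<^sup>2 / k < \<bar>total_pot q \<sigma>\<bar>" using k(2) T by (simp add: field_simps)
    moreover have "\<bar>total_pot q \<sigma>\<bar> \<le> 4 * A\<^sup>2 / k"
      using est[OF k_def] k(1) by (simp add: A_def)
    ultimately show False by simp
  qed
qed

end

section \<open>Layout of a line graph\<close>

definition undirected_path :: "('v, 'e) pre_digraph \<Rightarrow> nat \<Rightarrow> (nat \<Rightarrow> 'e) \<Rightarrow> (nat \<Rightarrow> 'v) \<Rightarrow> bool" where
  "undirected_path G n ed vx \<longleftrightarrow> (\<forall>i<n. ed i \<in> arcs G \<and> {tail G (ed i), head G (ed i)} = {vx i, vx (Suc i)})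
     \<and> inj_on vx {..n} \<and> vx ` {..n} \<subseteq> verts G"

definition incident_arcs :: "('v, 'e) pre_digraph \<Rightarrow> 'v \<Rightarrow> 'e set" where
  "incident_arcs G v = {e \<in> arcs G. v \<in> {tail G e, head G e}}"

lemma deg_eq: "deg G v = card (incident_arcs G v)"
proof -
  have "in_arcs G v \<union> out_arcs G v = incident_arcs G v"
    by (auto simp: in_arcs_def out_arcs_def incident_arcs_def)
  then show ?thesis by (simp add: deg_def)
qed

text \<open>Lets statements about the last vertex of a longest path be applied to its first
  vertex.\<close>

lemma undirected_path_rev:
  assumes "undirected_path G n ed vx"
  shows "undirected_path G n (\<lambda>i. ed (n - 1 - i)) (\<lambda>i. vx (n - i))"
  unfolding undirected_path_def
proof (intro conjI allI impI)
  fix i assume i: "i < n"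
  then have "n - 1 - i < n" "Suc (n - 1 - i) = n - i" "n - 1 - i = n - Suc i" by auto
  then show "ed (n - 1 - i) \<in> arcs G" "{tail G (ed (n - 1 - i)), head G (ed (n - 1 - i))} = {vx (n - i), vx (n - Suc i)}"
    using assms unfolding undirected_path_def by (auto simp: insert_commute)
next
  show "inj_on (\<lambda>i. vx (n - i)) {..n}"
  proof (rule inj_onI)
    fix i j assume "i \<in> {..n}" "j \<in> {..n}" "vx (n - i) = vx (n - j)"
    moreover from this have "n - i = n - j" using assms unfolding undirected_path_def by (auto dest: inj_onD)
    ultimately show "i = j" by auto
  qed
  show "(\<lambda>i. vx (n - i)) ` {..n} \<subseteq> verts G" using assms unfolding undirected_path_def by auto
qed

context metric_graph
begin

section \<open>Longest paths in a graph of degrees at most two\<close>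

lemma finite_incident: "finite (incident_arcs G v)"
  by (auto simp: incident_arcs_def)

lemma undirected_path_extend:
  assumes "undirected_path G n ed vx" "e \<in> arcs G" "{tail G e, head G e} = {vx n, u}" "u \<notin> vx ` {..n}"
  shows "undirected_path G (Suc n) (ed(n := e)) (vx(Suc n := u))"
  unfolding undirected_path_def
proof (intro conjI allI impI)
  fix i assume "i < Suc n"
  then show "(ed(n := e)) i \<in> arcs G"
    "{tail G ((ed(n := e)) i), head G ((ed(n := e)) i)} = {(vx(Suc n := u)) i, (vx(Suc n := u)) (Suc i)}"
    using assms unfolding undirected_path_def by (auto simp: less_Suc_eq)
next
  have "inj_on vx {..n}" using assms(1) by (simp add: undirected_path_def)
  then show "inj_on (vx(Suc n := u)) {..Suc n}"
    using assms(4) by (auto simp: inj_on_def atMost_Suc)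
  have "u \<in> verts G" using assms(2,3) tail_in_verts[of e] head_in_verts[of e] by (auto simp: doubleton_eq_iff)
  then show "(vx(Suc n := u)) ` {..Suc n} \<subseteq> verts G"
    using assms(1) by (auto simp: undirected_path_def atMost_Suc)
qed

lemma undirected_path_ed_inj:
  assumes "undirected_path G n ed vx" "i < n" "j < n" "ed i = ed j"
  shows "i = j"
proof -
  have "{vx i, vx (Suc i)} = {vx j, vx (Suc j)}" using assms unfolding undirected_path_def by metis
  moreover have "inj_on vx {..n}" using assms(1) by (simp add: undirected_path_def)
  ultimately have inj: "inj_on vx {..n}" and "vx i = vx j \<or> vx i = vx (Suc j) \<and> vx (Suc i) = vx j"
    by (auto simp: doubleton_eq_iff)
  from this(2) show ?thesis
  proof
    assume "vx i = vx j"
    then show ?thesis by (rule inj_onD[OF inj]) (use assms(2,3) in auto)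
  next
    assume *: "vx i = vx (Suc j) \<and> vx (Suc i) = vx j"
    have "i = Suc j" by (rule inj_onD[OF inj]) (use * assms(2,3) in auto)
    moreover have "Suc i = j" by (rule inj_onD[OF inj]) (use * assms(2,3) in auto)
    ultimately show ?thesis by simp
  qed
qed

lemma undirected_path_bounded: "undirected_path G n ed vx \<Longrightarrow> n < card (verts G)"
proof -
  assume p: "undirected_path G n ed vx"
  then have "card {..n} \<le> card (verts G)"
    unfolding undirected_path_def by (intro card_inj_on_le) auto
  then show ?thesis by simp
qed

text \<open>At a vertex of degree at most two in the interior of a path no further arc can end, so an arc at the
  last vertex of a longest path either belongs to the path or leads back to the first vertex.\<close>

lemma longest_path_last:
  assumes line: "line_graph G" and p: "undirected_path G n ed vx"
    and longest: "\<And>ed' vx'. \<not> undirected_path G (Suc n) ed' vx'"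
    and e: "e \<in> arcs G" "{tail G e, head G e} = {vx n, u}"
  shows "e \<in> ed ` {..<n} \<or> u = vx 0"
proof (rule ccontr)
  assume contra: "\<not> (e \<in> ed ` {..<n} \<or> u = vx 0)"
  have "u \<in> vx ` {..n}" using undirected_path_extend[OF p e] longest by blast
  then obtain j where j: "j \<le> n" "u = vx j" by auto
  have "u \<noteq> vx n" using e no_loops[OF e(1)] by (auto simp: doubleton_eq_iff)
  then have j': "0 < j" "j < n" using j contra by (auto simp: le_less)
  have ed: "\<And>i. i < n \<Longrightarrow> ed i \<in> arcs G" "\<And>i. i < n \<Longrightarrow> {tail G (ed i), head G (ed i)} = {vx i, vx (Suc i)}"
    using p unfolding undirected_path_def by auto
  have sub: "{ed (j - 1), ed j, e} \<subseteq> incident_arcs G (vx j)"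
    using ed[of j] ed[OF less_imp_diff_less[OF j'(2)], of 1] j' e j unfolding incident_arcs_def by auto
  have "ed (j - 1) \<noteq> ed j" using undirected_path_ed_inj[OF p less_imp_diff_less[OF j'(2), of 1] j'(2)] j'(1) by auto
  moreover have "e \<noteq> ed j" "e \<noteq> ed (j - 1)" using contra j' by auto
  ultimately have "card {ed (j - 1), ed j, e} = 3" by auto
  then have "3 \<le> deg G (vx j)" unfolding deg_eq using card_mono[OF finite_incident sub] by simp
  moreover have "vx j \<in> verts G" using p j unfolding undirected_path_def by auto
  ultimately show False using line unfolding line_graph_def by auto
qed

text \<open>The test for completeness of a layout: once no arc leaves its vertex set, connectedness
  shows that it contains every vertex.\<close>

lemma closed_set_is_verts:
  assumes S: "S \<subseteq> verts G" "S \<noteq> {}" and closed: "\<And>e. e \<in> arcs G \<Longrightarrow> tail G e \<in> S \<longleftrightarrow> head G e \<in> S"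
  shows "S = verts G"
proof -
  obtain s where s: "s \<in> S" using S(2) by auto
  have "v \<in> S" if v: "v \<in> verts G" for v
  proof -
    have "(s, v) \<in> rtrancl_on (verts G) ((arcs_ends G)\<^sup>s)"
      using connected_graph s S(1) v unfolding connected_conv by blast
    then show ?thesis using s
    proof (induction rule: rtrancl_on.induct)
      case (rtrancl_on_into_rtrancl_on a b c)
      then have "b \<in> S" by blast
      moreover have "\<exists>e\<in>arcs G. (b = tail G e \<and> c = head G e) \<or> (b = head G e \<and> c = tail G e)"
        using rtrancl_on_into_rtrancl_on(2) by (auto simp: symcl_def arcs_ends_conv)
      ultimately show ?case using closed by auto
    qed
  qed
  then show ?thesis using S(1) by blast
qed

lemma line_graph_covered:
  assumes "line_graph G"
  shows "covered_metric_graph G len"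
proof (unfold_locales)
  fix v assume "v \<in> verts G"
  then have "card (incident_arcs G v) \<noteq> 0" using assms by (auto simp: line_graph_def deg_eq)
  then have "incident_arcs G v \<noteq> {}" by auto
  then show "\<exists>e\<in>arcs G. tail G e = v \<or> head G e = v" by (auto simp: incident_arcs_def)
qed

text \<open>A longest path uses up all arcs at its inner vertices by the degree bound, and at its
  ends only an arc joining the two ends can be left over. Such an arc closes the path to a cycle,
  possibly as an arc parallel to a single path arc; otherwise the path is the whole graph.\<close>

lemma line_graph_coordinates:
  assumes line: "line_graph G"
  obtains (path) m ed vx where "line_coordinates G len m ed vx" "inj_on vx {..m}" "\<not> loop_graph G"
    | (cycle) m ed vx where "line_coordinates G len m ed vx" "vx m = vx 0" "inj_on vx {..<m}"
proof -
  interpret covered_metric_graph G len by (rule line_graph_covered[OF line])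
  define Q where "Q n \<longleftrightarrow> (\<exists>ed vx. undirected_path G n ed vx)" for n
  have "verts G \<noteq> {}" using connected_graph unfolding connected_conv by simp
  then obtain v where v: "v \<in> verts G" by auto
  then have "Q 0" unfolding Q_def undirected_path_def by (intro exI[of _ "\<lambda>_. undefined"] exI[of _ "\<lambda>_. v"]) auto
  moreover have "\<forall>n. Q n \<longrightarrow> n \<le> card (verts G)" unfolding Q_def using undirected_path_bounded less_imp_le by blast
  ultimately have "\<exists>n. Q n \<and> (\<forall>n'. Q n' \<longrightarrow> n' \<le> n)" by (rule Nat.ex_has_greatest_nat)
  then obtain n where n: "Q n" "\<And>n'. Q n' \<Longrightarrow> n' \<le> n" by blast
  have longest: "\<not> undirected_path G (Suc n) ed' vx'" for ed' vx' using n(2)[of "Suc n"] unfolding Q_def by auto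
  obtain ed vx where p: "undirected_path G n ed vx" using n(1) unfolding Q_def by auto
  have inj: "inj_on vx {..n}" and sub: "vx ` {..n} \<subseteq> verts G"
    and ed: "\<And>i. i < n \<Longrightarrow> ed i \<in> arcs G" "\<And>i. i < n \<Longrightarrow> {tail G (ed i), head G (ed i)} = {vx i, vx (Suc i)}"
    using p unfolding undirected_path_def by auto
  \<comment> \<open>A path without arcs could be extended by any arc at its vertex, whose other end
    is different because loops are excluded.\<close>
  have n0: "0 < n"
  proof (rule ccontr)
    assume "\<not> 0 < n"
    then have [simp]: "n = 0" by simp
    obtain e where e: "e \<in> arcs G" "tail G e = vx 0 \<or> head G e = vx 0" using incident[of "vx 0"] sub by auto
    have "\<exists>u. {tail G e, head G e} = {vx 0, u}" using e(2) by (metis insert_commute)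
    then obtain u where u: "{tail G e, head G e} = {vx 0, u}" by blast
    have "u \<notin> vx ` {..n}" using u no_loops[OF e(1)] by (auto simp: doubleton_eq_iff)
    moreover have "{tail G e, head G e} = {vx n, u}" using u by simp
    ultimately show False using undirected_path_extend[OF p e(1)] longest by blast
  qed
  have inner: "e \<in> ed ` {..<n}" if "0 < i" "i < n" "e \<in> incident_arcs G (vx i)" for i e
  proof (rule ccontr)
    assume ne: "e \<notin> ed ` {..<n}"
    have s: "{ed (i - 1), ed i, e} \<subseteq> incident_arcs G (vx i)"
      using ed[of i] ed[OF less_imp_diff_less[OF that(2)], of 1] that unfolding incident_arcs_def by auto
    have "ed (i - 1) \<noteq> ed i" using undirected_path_ed_inj[OF p less_imp_diff_less[OF that(2), of 1] that(2)] that(1) by auto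
    moreover have "e \<noteq> ed i" "e \<noteq> ed (i - 1)" using ne that by auto
    ultimately have "card {ed (i - 1), ed i, e} = 3" by auto
    then have "3 \<le> deg G (vx i)" unfolding deg_eq using card_mono[OF finite_incident s] by simp
    moreover have "vx i \<in> verts G" using sub that by auto
    ultimately show False using line unfolding line_graph_def by auto
  qed
  have other: "\<exists>u. {tail G e, head G e} = {w, u}" if "e \<in> incident_arcs G w" for e w
    using that by (auto simp: incident_arcs_def)
  have last: "e \<in> ed ` {..<n} \<or> {tail G e, head G e} = {vx n, vx 0}" if e: "e \<in> incident_arcs G (vx n)" for e
  proof -
    obtain u where u: "{tail G e, head G e} = {vx n, u}" using other[OF e] by blast
    have "e \<in> arcs G" using e by (simp add: incident_arcs_def)
    then show ?thesis using longest_path_last[OF line p longest _ u] u by auto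
  qed
  have first: "e \<in> ed ` {..<n} \<or> {tail G e, head G e} = {vx n, vx 0}" if e: "e \<in> incident_arcs G (vx 0)" for e
  proof -
    obtain u where u: "{tail G e, head G e} = {vx 0, u}" using other[OF e] by blast
    have "e \<in> arcs G" using e by (simp add: incident_arcs_def)
    moreover have "{tail G e, head G e} = {vx (n - n), u}" using u by simp
    ultimately have "e \<in> (\<lambda>i. ed (n - 1 - i)) ` {..<n} \<or> u = vx (n - 0)"
      by (rule longest_path_last[OF line undirected_path_rev[OF p] longest])
    moreover have "(\<lambda>i. ed (n - 1 - i)) ` {..<n} \<subseteq> ed ` {..<n}" by auto
    ultimately show ?thesis using u by (auto simp: insert_commute)
  qed
  show thesis
  proof (cases "\<exists>e. e \<in> arcs G \<and> e \<notin> ed ` {..<n} \<and> {tail G e, head G e} = {vx n, vx 0}")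
    case True
    then obtain e where e: "e \<in> arcs G" "e \<notin> ed ` {..<n}" "{tail G e, head G e} = {vx n, vx 0}" by auto
    define ed' where "ed' = ed(n := e)"
    \<comment> \<open>The cycle has n + 1 arcs; the extra position carries the first vertex
      again.\<close>
    define vx' where "vx' = vx(Suc n := vx 0)"
    have img: "ed' ` {..<Suc n} = insert e (ed ` {..<n})" by (auto simp: ed'_def lessThan_Suc)
    \<comment> \<open>At either end the closing arc and one path arc already exhaust degree
      two.\<close>
    have two: "e' = e \<or> e' \<in> ed ` {..<n}" if i: "i = 0 \<or> i = n" and e': "e' \<in> incident_arcs G (vx i)" for e' i
    proof (rule ccontr)
      assume ne: "\<not> (e' = e \<or> e' \<in> ed ` {..<n})"
      define j where "j = (if i = 0 then 0 else n - 1)"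
      have j: "j < n" "i = j \<or> i = Suc j" using i n0 by (auto simp: j_def)
      have s: "{e, e', ed j} \<subseteq> incident_arcs G (vx i)"
        using e i e' j ed[OF j(1)] by (auto simp: incident_arcs_def doubleton_eq_iff)
      have "e \<noteq> ed j" "e' \<noteq> ed j" using ne e(2) j(1) by blast+
      then have "card {e, e', ed j} = 3" using ne by auto
      then have "3 \<le> deg G (vx i)" unfolding deg_eq using card_mono[OF finite_incident s] by simp
      moreover have "vx i \<in> verts G" using sub i by auto
      ultimately show False using line unfolding line_graph_def by auto
    qed
    have all_inc: "e' \<in> ed' ` {..<Suc n}" if "i \<le> n" "e' \<in> incident_arcs G (vx i)" for i e'
      unfolding img using two[of i e'] inner[of i e'] that by (cases "i = 0 \<or> i = n") auto
    have ends: "{tail G (ed' i), head G (ed' i)} = {vx' i, vx' (Suc i)}" if "i < Suc n" for i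
      using that ed(2)[of i] e(3) by (auto simp: ed'_def vx'_def less_Suc_eq)
    have in_vx: "tail G (ed' i) \<in> vx ` {..n} \<and> head G (ed' i) \<in> vx ` {..n}" if "i < Suc n" for i
    proof -
      have "{vx' i, vx' (Suc i)} \<subseteq> vx ` {..n}" using that by (auto simp: vx'_def)
      then show ?thesis unfolding ends[OF that, symmetric] by simp
    qed
    have closed: "tail G e' \<in> vx ` {..n} \<longleftrightarrow> head G e' \<in> vx ` {..n}" if e': "e' \<in> arcs G" for e'
    proof -
      have "e' \<in> ed' ` {..<Suc n}" if "tail G e' \<in> vx ` {..n} \<or> head G e' \<in> vx ` {..n}"
        using that all_inc e' by (auto simp: incident_arcs_def)
      then show ?thesis using in_vx by blast
    qed
    have V: "vx ` {..n} = verts G" by (rule closed_set_is_verts[OF sub _ closed]) auto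
    have A: "arcs G = ed' ` {..<Suc n}"
    proof
      show "arcs G \<subseteq> ed' ` {..<Suc n}"
      proof
        fix e' assume e': "e' \<in> arcs G"
        then have "tail G e' \<in> vx ` {..n}" unfolding V by (rule tail_in_verts)
        then obtain i where "i \<le> n" "tail G e' = vx i" by auto
        then show "e' \<in> ed' ` {..<Suc n}" using all_inc[of i e'] e' by (auto simp: incident_arcs_def)
      qed
      show "ed' ` {..<Suc n} \<subseteq> arcs G" unfolding img using e ed by auto
    qed
    have "line_coordinates G len (Suc n) ed' vx'"
    proof
      show "bij_betw ed' {..<Suc n} (arcs G)"
        unfolding bij_betw_def A
        using undirected_path_ed_inj[OF p] e(2) by (auto simp: inj_on_def ed'_def less_Suc_eq)
      show "vx' ` {..Suc n} = verts G" unfolding V[symmetric] by (auto simp: vx'_def atMost_Suc)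
    qed (use ends in auto)
    moreover have "vx' (Suc n) = vx' 0" by (simp add: vx'_def)
    moreover have "inj_on vx' {..<Suc n}"
      using inj by (auto simp: vx'_def inj_on_def)
    ultimately show thesis by (rule cycle)
  next
    case False
    have all_inc: "e' \<in> ed ` {..<n}" if i: "i \<le> n" and e': "e' \<in> incident_arcs G (vx i)" for i e'
    proof -
      have a: "e' \<in> arcs G" using e' by (simp add: incident_arcs_def)
      consider "i = 0" | "i = n" | "0 < i" "i < n" using i by linarith
      then show ?thesis
        by cases (use first[of e'] last[of e'] inner[of i e'] e' False a in auto)
    qed
    have in_vx: "tail G (ed i) \<in> vx ` {..n} \<and> head G (ed i) \<in> vx ` {..n}" if "i < n" for i
    proof -
      have "{vx i, vx (Suc i)} \<subseteq> vx ` {..n}" using that by auto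
      then show ?thesis unfolding ed(2)[OF that, symmetric] by simp
    qed
    have closed: "tail G e' \<in> vx ` {..n} \<longleftrightarrow> head G e' \<in> vx ` {..n}" if e': "e' \<in> arcs G" for e'
    proof -
      have "e' \<in> ed ` {..<n}" if "tail G e' \<in> vx ` {..n} \<or> head G e' \<in> vx ` {..n}"
        using that all_inc e' by (auto simp: incident_arcs_def)
      then show ?thesis using in_vx by blast
    qed
    have V: "vx ` {..n} = verts G" by (rule closed_set_is_verts[OF sub _ closed]) auto
    have A: "arcs G = ed ` {..<n}"
    proof
      show "arcs G \<subseteq> ed ` {..<n}"
      proof
        fix e' assume e': "e' \<in> arcs G"
        then have "tail G e' \<in> vx ` {..n}" unfolding V by (rule tail_in_verts)
        then obtain i where "i \<le> n" "tail G e' = vx i" by auto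
        then show "e' \<in> ed ` {..<n}" using all_inc[of i e'] e' by (auto simp: incident_arcs_def)
      qed
      show "ed ` {..<n} \<subseteq> arcs G" using ed by auto
    qed
    have "line_coordinates G len n ed vx"
    proof
      show "bij_betw ed {..<n} (arcs G)"
        unfolding bij_betw_def A using undirected_path_ed_inj[OF p] by (auto simp: inj_on_def)
    qed (use n0 ed V in auto)
    moreover have "\<not> loop_graph G"
    proof
      assume "loop_graph G"
      \<comment> \<open>On an open path the first vertex meets only the first arc, so its degree is
        at most one.\<close>
      moreover have "incident_arcs G (vx 0) \<subseteq> {ed 0}"
      proof
        fix e' assume e': "e' \<in> incident_arcs G (vx 0)"
        then obtain i where i: "i < n" "e' = ed i" using all_inc[of 0 e'] by auto
        then have "vx 0 \<in> {vx i, vx (Suc i)}" using e' ed(2)[of i] by (auto simp: incident_arcs_def)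
        then have "i = 0" using inj i by (auto dest: inj_onD)
        then show "e' \<in> {ed 0}" using i by simp
      qed
      then have "deg G (vx 0) \<le> 1" unfolding deg_eq using card_mono[of "{ed 0}"] by fastforce
      moreover have "vx 0 \<in> verts G" using sub by auto
      ultimately show False unfolding loop_graph_def by auto
    qed
    ultimately show thesis using inj path by blast
  qed
qed

end

theorem corollary5:
  fixes G :: "('v, 'e) pre_digraph"
    and len :: "'e \<Rightarrow> real"
    and q :: "'e \<Rightarrow> real \<Rightarrow> real"
    and \<sigma> :: "'v \<Rightarrow> real"
    and lam lam0 :: "nat \<Rightarrow> real"
  assumes "metric_graph G len"
    and "line_graph G"
    and "potential G len q"
    and "eigenvalue_sequence G len q \<sigma> lam"
    and "eigenvalue_sequence G len (\<lambda>e x. 0) (\<lambda>v. 0) lam0"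
    and "\<forall>n. lam n = lam0 n"
    and "loop_graph G \<or> (\<forall>v\<in>verts G. \<sigma> v \<ge> 0)"
  shows "(\<forall>e\<in>arcs G. \<forall>x\<in>{0<..<len e}. q e x = 0) \<and> (\<forall>v\<in>verts G. \<sigma> v = 0)"
proof -
  interpret covered_metric_graph G len
    by (rule metric_graph.line_graph_covered[OF assms(1,2)])
  have iso: "isospectral_to_free G len q \<sigma>"
    by (rule isospectral_to_freeI[OF assms(4-6)])
  have q: "bounded_potential q"
    using assms(3) by (auto simp: potential_def bounded_potential_def)
  have "total_pot q \<sigma> \<le> 0"
    using assms(2)
  proof (cases rule: line_graph_coordinates)
    case (path m ed vx)
    interpret line_coordinates G len m ed vx by (rule path(1))
    \<comment> \<open>A path layout is not a loop graph, so the sign assumption is the alternative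
      that holds.\<close>
    have "\<sigma> (vx 0) \<ge> 0" "\<sigma> (vx m) \<ge> 0" using assms(7) path(3) vx_in by auto
    then show ?thesis using path_total_potential[OF q iso path(2)] by linarith
  next
    case (cycle m ed vx)
    interpret line_coordinates G len m ed vx by (rule cycle(1))
    show ?thesis using cycle_total_potential[OF q iso cycle(2,3)] by simp
  qed
  show ?thesis
  proof (rule total_potential_nonpos_imp_zero[OF assms(3)])
    show "0 \<le> qform q \<sigma> f" if "f \<in> H1" for f
      by (rule isospectral_imp_qform_nonneg[OF q iso that])
    show "(\<Sum>e\<in>arcs G. LINT x|edge_measure (len e). q e x) + (\<Sum>v\<in>verts G. \<sigma> v) \<le> 0"
      using \<open>total_pot q \<sigma> \<le> 0\<close> unfolding total_pot_def .
  qed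
qed

end
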